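(* Let $G=\langle a,w\rangle$ be a permutation group with a cyclic regular normal subgroup $W=\langle w\rangle$ of order $n$ and a cyclic point stabilizer $A=\langle a\rangle$. Let $\alpha$ be an integer such that $w^a=w^\alpha$. Let $H$ be a relatively closed subgroup of $G$. If $H$ has three orbits on $W$, then $H$ is conjugate in $\operatorname{Hol}(W)$ to exactly one of the following relatively closed subgroups: (1) $H_1=\langle a,w^r\rangle$, where $r\in\pi(n)\setminus\{2\}$ and $\operatorname{ord}_r(\alpha)=\frac{r-1}2$; (2) $H_2=\langle a^2,w^r\rangle$, where $r\in\pi(n)\setminus\{2\}$ and $\operatorname{ord}_r(\alpha)=r-1$; (3) $H_3=\langle a,w^{r^2}\rangle$, where $r\in\pi(n)$, $r^2$ divides $n$, and $\operatorname{ord}_{r^2}(\alpha)=r^2-r$; (4) $H_4=\langle aw^r,w^{2r}\rangle$, where $r\in\pi(n)\setminus\{2\}$ and $\operatorname{ord}_r(\alpha)=r-1$, provided $\alpha$ is odd and $n$ is even. The multisets of lengths of orbits of these subgroups are as follows: - $\Omega(H_1)=\Omega(H_2)=\Omega(H_4)=\left\{\!\!\left\{\frac nr,\ 2\times\frac{n(r-1)}{2r}\right\}\!\!\right\}$; - $\Omega(H_3)=\left\{\!\!\left\{\frac n{r^2},\ \frac{n(r-1)}{r^2},\ \frac{n(r^2-r)}{r^2}\right\}\!\!\right\}$.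
   Context: All groups are finite. $G=A\ltimes W$ is regarded as a permutation group on the set $W$ via $u^{cv}=u^cv$ for $u,v\in W$, $c\in A$ (where $u^c=c^{-1}uc$). As $A$ acts faithfully on $W$ by automorphisms, $G\leqslant\operatorname{Hol}(W)=\operatorname{Aut}(W)\ltimes W$. The relative closure of a subgroup $K$ in $G$ is the largest subgroup of $G$ having the same orbits on $W$ as $K$; $K$ is relatively closed in $G$ if it coincides with its relative closure. $\pi(n)$ is the set of prime divisors of $n$; $\operatorname{ord}_m(k)$ is the multiplicative order of $k$ modulo $m$ for coprime $m,k$. $\Omega(H)$ is the multiset of lengths of the orbits of $H$ on $W$; in a multiset, $k\times m$ means the element $m$ with multiplicity $k$, and $m$ alone means $1\times m$. *)

theory Defs
  imports
    "HOL-Algebra.Group_Action"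
    "HOL-Algebra.Generated_Groups"
    "HOL-Combinatorics.Permutations"
    "HOL-Number_Theory.Number_Theory"
begin

text \<open>
  Permutations act on the right: the product of \<open>p\<close> and \<open>q\<close> is ``first \<open>p\<close>, then \<open>q\<close>'', so that
  $x^{pq} = (x^p)^q$, where $x^p$ is the function value \<open>p x\<close>. This is the opposite of the
  convention of \<^const>\<open>BijGroup\<close>.
\<close>

definition perm_group :: "'x set \<Rightarrow> ('x \<Rightarrow> 'x) monoid" where
  "perm_group X = \<lparr>carrier = {p. p permutes X}, monoid.mult = (\<lambda>p q. q \<circ> p), one = id\<rparr>"

lemma group_perm_group: "group (perm_group X)"
proof (rule groupI)
  fix p assume "p \<in> carrier (perm_group X)"
  then have p: "p permutes X" by (simp add: perm_group_def)
  show "\<exists>q\<in>carrier (perm_group X). q \<otimes>\<^bsub>perm_group X\<^esub> p = \<one>\<^bsub>perm_group X\<^esub>"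
    using permutes_inv[OF p] permutes_inv_o(1)[OF p]
    by (intro bexI[of _ "inv_into UNIV p"]) (simp_all add: perm_group_def)
qed (simp_all add: perm_group_def permutes_compose permutes_id o_assoc)

abbreviation perm_subgroup :: "('x \<Rightarrow> 'x) set \<Rightarrow> 'x set \<Rightarrow> ('x \<Rightarrow> 'x) monoid" where
  "perm_subgroup H X \<equiv> (perm_group X)\<lparr>carrier := H\<rparr>"

definition point_orbits :: "'x set \<Rightarrow> ('x \<Rightarrow> 'x) set \<Rightarrow> 'x set set" where
  "point_orbits X H = orbits (perm_subgroup H X) X id"

definition orbit_lengths :: "'x set \<Rightarrow> ('x \<Rightarrow> 'x) set \<Rightarrow> nat multiset" where
  "orbit_lengths X H = image_mset card (mset_set (point_orbits X H))"

definition point_stabilizer :: "'x set \<Rightarrow> ('x \<Rightarrow> 'x) set \<Rightarrow> 'x \<Rightarrow> ('x \<Rightarrow> 'x) set" where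
  "point_stabilizer X H x = stabilizer (perm_subgroup H X) id x"

definition regular_on :: "'x set \<Rightarrow> ('x \<Rightarrow> 'x) set \<Rightarrow> bool" where
  "regular_on X W \<longleftrightarrow> (\<forall>x\<in>X. \<forall>y\<in>X. \<exists>!u. u \<in> W \<and> u x = y)"

definition relative_closure ::
  "'x set \<Rightarrow> ('x \<Rightarrow> 'x) set \<Rightarrow> ('x \<Rightarrow> 'x) set \<Rightarrow> ('x \<Rightarrow> 'x) set" where
  "relative_closure X G K =
     (GREATEST L. subgroup L (perm_subgroup G X) \<and> point_orbits X L = point_orbits X K)"

text \<open>When \<open>K\<close> is a subgroup of \<open>G\<close> the greatest such \<open>L\<close> exists; see \<open>relative_closure_eq\<close>.\<close>

lemma orbit_invariant:
  assumes "subgroup K (perm_subgroup G X)" "subgroup G (perm_group X)"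
    and "k \<in> K" "\<Delta> \<in> point_orbits X K"
  shows "k ` \<Delta> = \<Delta>"
proof -
  interpret group "perm_group X" by (rule group_perm_group)
  have K: "subgroup K (perm_group X)"
    using assms(1,2) incl_subgroup by blast
  obtain x where x: "x \<in> X" "\<Delta> = {g x | g. g \<in> K}"
    using assms(4) by (auto simp: point_orbits_def orbits_def orbit_def)
  have comp: "q \<circ> p \<in> K" if "p \<in> K" "q \<in> K" for p q
    using subgroup.m_closed[OF K that] by (simp add: perm_group_def)
  obtain k' where k': "k' \<in> K" "k \<circ> k' = id"
    using subgroup.m_inv_closed[OF K assms(3)] l_inv[of k] subgroup.mem_carrier[OF K assms(3)]
    by (auto simp: perm_group_def)
  show ?thesis
  proof
    show "k ` \<Delta> \<subseteq> \<Delta>" using x(2) comp[OF _ assms(3)] by fastforce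
    show "\<Delta> \<subseteq> k ` \<Delta>"
    proof
      fix y assume "y \<in> \<Delta>"
      then obtain g where g: "g \<in> K" "y = g x" using x(2) by blast
      have "(k' \<circ> g) x \<in> \<Delta>" using comp[OF g(1) k'(1)] x(2) by blast
      moreover have "y = k ((k' \<circ> g) x)" using k'(2) g(2) by (simp add: fun_eq_iff)
      ultimately show "y \<in> k ` \<Delta>" by blast
    qed
  qed
qed

lemma relative_closure_eq:
  assumes G: "subgroup G (perm_group X)" and K: "subgroup K (perm_subgroup G X)"
  shows "relative_closure X G K = {g \<in> G. \<forall>\<Delta>\<in>point_orbits X K. g ` \<Delta> = \<Delta>}" (is "_ = ?L")
  unfolding relative_closure_def
proof (rule Greatest_equality)
  interpret group "perm_group X" by (rule group_perm_group)
  have KG: "K \<subseteq> G" using subgroup.subset[OF K] by simp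
  have idK: "id \<in> K" using subgroup.one_closed[OF K] by (simp add: perm_group_def)
  have L: "subgroup ?L (perm_group X)"
  proof (rule subgroupI)
    show "?L \<subseteq> carrier (perm_group X)" using subgroup.subset[OF G] by blast
    show "?L \<noteq> {}" using idK KG by auto
  next
    fix g assume g: "g \<in> ?L"
    define h where "h = inv\<^bsub>perm_group X\<^esub> g"
    have gc: "g \<in> carrier (perm_group X)" using g subgroup.subset[OF G] by blast
    have hG: "h \<in> G" using g subgroup.m_inv_closed[OF G] by (simp add: h_def)
    have "h \<circ> g = id" using r_inv[OF gc] by (simp add: h_def perm_group_def)
    then have hg: "h ` (g ` \<Delta>) = \<Delta>" for \<Delta> by (simp add: image_comp)
    have "h ` \<Delta> = \<Delta>" if "\<Delta> \<in> point_orbits X K" for \<Delta>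
    proof -
      have "g ` \<Delta> = \<Delta>" using g that by simp
      then show ?thesis using hg[of \<Delta>] by simp
    qed
    then have "h \<in> ?L" using hG by simp
    then show "inv\<^bsub>perm_group X\<^esub> g \<in> ?L" unfolding h_def .
  next
    fix g h assume gh: "g \<in> ?L" "h \<in> ?L"
    have "h \<circ> g \<in> G" using gh subgroup.m_closed[OF G, of g h] by (simp add: perm_group_def)
    moreover have "(h \<circ> g) ` \<Delta> = \<Delta>" if "\<Delta> \<in> point_orbits X K" for \<Delta>
    proof -
      have "g ` \<Delta> = \<Delta>" "h ` \<Delta> = \<Delta>" using gh that by simp_all
      then show ?thesis by (simp only: image_comp[symmetric])
    qed
    ultimately show "g \<otimes>\<^bsub>perm_group X\<^esub> h \<in> ?L" by (simp add: perm_group_def)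
  qed
  have KL: "K \<subseteq> ?L" using KG orbit_invariant[OF K G] by blast
  have same: "{g x | g. g \<in> ?L} = {g x | g. g \<in> K}" if "x \<in> X" for x
  proof
    have "{g x | g. g \<in> K} \<in> point_orbits X K"
      using that by (auto simp: point_orbits_def orbits_def orbit_def)
    then have inv: "g ` {g x | g. g \<in> K} = {g x | g. g \<in> K}" if "g \<in> ?L" for g
      using that by simp
    have x: "x \<in> {g x | g. g \<in> K}" using idK by (auto intro: exI[of _ id])
    have "g x \<in> {g x | g. g \<in> K}" if "g \<in> ?L" for g
      using imageI[OF x, of g] unfolding inv[OF that] .
    then show "{g x | g. g \<in> ?L} \<subseteq> {g x | g. g \<in> K}" by auto
    show "{g x | g. g \<in> K} \<subseteq> {g x | g. g \<in> ?L}" using KL by auto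
  qed
  have po: "point_orbits X M = (\<lambda>x. {g x | g. g \<in> M}) ` X" for M
    by (simp add: point_orbits_def orbits_def orbit_def image_def Bex_def conj_commute)
  have "(\<lambda>x. {g x | g. g \<in> ?L}) ` X = (\<lambda>x. {g x | g. g \<in> K}) ` X"
    using same by (rule image_cong[OF refl])
  then have "point_orbits X ?L = point_orbits X K"
    by (rule trans[OF po[of ?L] trans[OF _ po[of K, symmetric]]])
  moreover have "subgroup ?L (perm_subgroup G X)"
    by (rule subgroup_incl[OF L G]) blast
  ultimately show "subgroup ?L (perm_subgroup G X) \<and> point_orbits X ?L = point_orbits X K"
    by blast
next
  fix M assume M: "subgroup M (perm_subgroup G X) \<and> point_orbits X M = point_orbits X K"
  have "g \<in> ?L" if "g \<in> M" for g
  proof -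
    have "g \<in> G" using that M subgroup.subset[of M "perm_subgroup G X"] by auto
    moreover have "g ` \<Delta> = \<Delta>" if "\<Delta> \<in> point_orbits X K" for \<Delta>
      using orbit_invariant[OF conjunct1[OF M] G \<open>g \<in> M\<close>] M that by simp
    ultimately show ?thesis by simp
  qed
  then show "M \<subseteq> ?L" by (rule subsetI)
qed

definition relatively_closed :: "'x set \<Rightarrow> ('x \<Rightarrow> 'x) set \<Rightarrow> ('x \<Rightarrow> 'x) set \<Rightarrow> bool" where
  "relatively_closed X G K \<longleftrightarrow>
     subgroup K (perm_subgroup G X) \<and> relative_closure X G K = K"

text \<open>
  Once a base point \<open>x\<^sub>0\<close> is chosen, a regular group \<open>W\<close> is identified with the set \<open>X\<close> it
  permutes by $u \leftrightarrow x_0^u$. The next two lemmas show that this turns the given action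
  of $G = A \ltimes W$ on \<open>X\<close> (with \<open>A\<close> the stabilizer of \<open>x\<^sub>0\<close>) into the action
  $u^{cv} = u^c v = c^{-1} u c v$ on \<open>W\<close>.
\<close>

lemma regular_on_identification:
  assumes "subgroup W (perm_group X)" and "regular_on X W" and "x\<^sub>0 \<in> X"
  shows "bij_betw (\<lambda>u. u x\<^sub>0) W X"
proof -
  have p: "u permutes X" if "u \<in> W" for u
    using subgroup.subset[OF assms(1)] that by (auto simp: perm_group_def)
  have X: "u x\<^sub>0 \<in> X" if "u \<in> W" for u
    using p[OF that] assms(3) by (simp add: permutes_in_image)
  show ?thesis
    unfolding bij_betw_def inj_on_def
  proof (intro conjI ballI impI)
    fix u v assume "u \<in> W" "v \<in> W" "u x\<^sub>0 = v x\<^sub>0"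
    then show "u = v" using assms(2,3) X unfolding regular_on_def by metis
  next
    show "(\<lambda>u. u x\<^sub>0) ` W = X"
      using assms(2,3) X unfolding regular_on_def by blast
  qed
qed

lemma identification_action:
  fixes c u v :: "'x \<Rightarrow> 'x"
  assumes "c \<in> carrier (perm_group X)" and "c x\<^sub>0 = x\<^sub>0"
  shows "(c \<otimes>\<^bsub>perm_group X\<^esub> v) (u x\<^sub>0) =
    (inv\<^bsub>perm_group X\<^esub> c \<otimes>\<^bsub>perm_group X\<^esub> u \<otimes>\<^bsub>perm_group X\<^esub> c \<otimes>\<^bsub>perm_group X\<^esub> v) x\<^sub>0"
proof -
  interpret group "perm_group X" by (rule group_perm_group)
  have "c \<otimes>\<^bsub>perm_group X\<^esub> inv\<^bsub>perm_group X\<^esub> c = id"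
    using r_inv[OF assms(1)] by (simp add: perm_group_def)
  then have "(inv\<^bsub>perm_group X\<^esub> c) (c x\<^sub>0) = x\<^sub>0"
    by (simp add: perm_group_def fun_eq_iff)
  then show ?thesis by (simp add: perm_group_def assms(2))
qed

text \<open>
  The holomorph of \<open>W\<close> as a permutation group, under the same identification: its elements are the
  maps $u \mapsto \sigma(u) v$ with \<open>\<sigma>\<close> an automorphism of \<open>W\<close> and \<open>v \<in> W\<close>.
\<close>

definition holomorph :: "'x set \<Rightarrow> 'x \<Rightarrow> ('x \<Rightarrow> 'x) set \<Rightarrow> ('x \<Rightarrow> 'x) set" where
  "holomorph X x\<^sub>0 W =
     {h \<in> carrier (perm_group X).
        \<exists>\<sigma> \<in> auto (perm_subgroup W X). \<exists>v\<in>W. \<forall>u\<in>W. h (u x\<^sub>0) = (\<sigma> u \<otimes>\<^bsub>perm_group X\<^esub> v) x\<^sub>0}"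

definition conjugate_in ::
  "'x set \<Rightarrow> ('x \<Rightarrow> 'x) set \<Rightarrow> ('x \<Rightarrow> 'x) set \<Rightarrow> ('x \<Rightarrow> 'x) set \<Rightarrow> bool" where
  "conjugate_in X N H K \<longleftrightarrow>
     (\<exists>h\<in>N. K = (\<lambda>x. inv\<^bsub>perm_group X\<^esub> h \<otimes>\<^bsub>perm_group X\<^esub> x \<otimes>\<^bsub>perm_group X\<^esub> h) ` H)"

datatype three_orbit_family = Fam1 | Fam2 | Fam3 | Fam4

text \<open>The divisions in this definition and in \<open>family_orbit_lengths\<close> are all exact in the admissible
  cases.\<close>

fun admissible :: "nat \<Rightarrow> int \<Rightarrow> three_orbit_family \<Rightarrow> nat \<Rightarrow> bool" where
  "admissible n \<alpha> Fam1 r \<longleftrightarrow> r \<in> prime_factors n - {2} \<and> ord (int r) \<alpha> = (r - 1) div 2"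
| "admissible n \<alpha> Fam2 r \<longleftrightarrow> r \<in> prime_factors n - {2} \<and> ord (int r) \<alpha> = r - 1"
| "admissible n \<alpha> Fam3 r \<longleftrightarrow> r \<in> prime_factors n \<and> r\<^sup>2 dvd n \<and> ord (int (r\<^sup>2)) \<alpha> = r\<^sup>2 - r"
| "admissible n \<alpha> Fam4 r \<longleftrightarrow>
     r \<in> prime_factors n - {2} \<and> ord (int r) \<alpha> = r - 1 \<and> odd \<alpha> \<and> even n"

fun family_subgroup ::
  "('g, 'b) monoid_scheme \<Rightarrow> 'g \<Rightarrow> 'g \<Rightarrow> three_orbit_family \<Rightarrow> nat \<Rightarrow> 'g set" where
  "family_subgroup S a w Fam1 r = generate S {a, w [^]\<^bsub>S\<^esub> r}"
| "family_subgroup S a w Fam2 r = generate S {a [^]\<^bsub>S\<^esub> (2::nat), w [^]\<^bsub>S\<^esub> r}"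
| "family_subgroup S a w Fam3 r = generate S {a, w [^]\<^bsub>S\<^esub> r\<^sup>2}"
| "family_subgroup S a w Fam4 r = generate S {a \<otimes>\<^bsub>S\<^esub> w [^]\<^bsub>S\<^esub> r, w [^]\<^bsub>S\<^esub> (2 * r)}"

fun family_orbit_lengths :: "nat \<Rightarrow> three_orbit_family \<Rightarrow> nat \<Rightarrow> nat multiset" where
  "family_orbit_lengths n Fam3 r =
     {#n div r\<^sup>2, n * (r - 1) div r\<^sup>2, n * (r\<^sup>2 - r) div r\<^sup>2#}"
| "family_orbit_lengths n _ r =
     {#n div r, n * (r - 1) div (2 * r), n * (r - 1) div (2 * r)#}"

end

theory Submission
  imports Defs
begin

text \<open>
  Choosing the base point \<open>x\<^sub>0\<close> identifies \<open>X\<close> with the integers modulo \<open>n\<close>, so that \<open>w\<close> and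
  \<open>a\<close> become $x \mapsto x + 1$ and $x \mapsto \alpha x$. Let \<open>d\<close> generate the translations in \<open>H\<close>. Since
  \<open>H\<close> modulo its translations is cyclic, the orbits of \<open>H\<close> are the preimages of the orbits of a single
  affine map $f(x) = \beta x + c$ modulo \<open>d\<close>, and relative closedness implies that no translation
  preserves all orbits of \<open>f\<close> unless it is trivial modulo \<open>d\<close>.

  To find all such \<open>f\<close> with three orbits, move a point of minimal period \<open>L\<close> to \<open>0\<close>. The fixed points
  of the \<open>L\<close>-th iterate of \<open>f\<close> are then the multiples of some divisor \<open>s\<close> of \<open>d\<close>, and $\gcd(x, s)$ is
  invariant under \<open>f\<close>, so \<open>s\<close> has at most three divisors: it is $1$, a prime or the square of a prime.
  In each case the orbit lengths and the absence of invariant translations leave only $d = r$, $d = r^2$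
  and $d = 2r$ with \<open>r\<close> prime. Only translations are needed to conjugate \<open>H\<close> into the list, while
  elements of the holomorph preserve enough structure (the orbit lengths and the translations
  contained in a subgroup) to separate its members.
\<close>

subsection \<open>Affine maps modulo an integer\<close>

text \<open>Relative closedness enters through one principle: an element of \<open>G\<close> that
  moves every point within its own orbit of \<open>H\<close> lies in \<open>H\<close>; for a
  translation this means that it is a multiple of \<open>d\<close>. Minimality of \<open>L\<close>
  ensures that the points fixed by the iterate have period exactly \<open>L\<close>, since their
  periods divide \<open>L\<close>. The set of these points is invariant, so \<open>s\<close> divides
  the image of 0, which is the constant term. Hence the map is multiplication by a unit modulo
  \<open>s\<close>, and this is why gcds with \<open>s\<close> do not change. The delicate case is s
  = 1: all orbits have the same length, no base point is distinguished and the gcd says nothing. A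
  3-adic argument then supplies a base point that is fixed modulo 3. Generators of \<open>H\<close>
  and of the listed group are never matched against each other. It suffices that a translate of
  \<open>H\<close> is contained in the listed group: both have three orbits, so the orbits coincide,
  and closedness of \<open>H\<close> turns equal orbits into equal groups.\<close>

definition aff :: "int \<Rightarrow> int \<Rightarrow> int \<Rightarrow> int" where
  "aff \<beta> c x = \<beta> * x + c"

definition reach :: "int \<Rightarrow> int \<Rightarrow> int \<Rightarrow> int \<Rightarrow> int \<Rightarrow> bool" where
  "reach m \<beta> c x y \<longleftrightarrow> (\<exists>j. [(aff \<beta> c ^^ j) x = y] (mod m))"

definition period :: "int \<Rightarrow> int \<Rightarrow> int \<Rightarrow> int \<Rightarrow> nat" where
  "period m \<beta> c x = (LEAST j. 0 < j \<and> [(aff \<beta> c ^^ j) x = x] (mod m))"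

definition orb :: "int \<Rightarrow> int \<Rightarrow> int \<Rightarrow> int \<Rightarrow> int set" where
  "orb m \<beta> c x = {y \<in> {0..<m}. reach m \<beta> c x y}"

lemma aff_funpow: "(aff \<beta> c ^^ j) x = \<beta> ^ j * x + (aff \<beta> c ^^ j) 0"
  by (induction j) (auto simp: aff_def algebra_simps)

lemma aff_funpow_diff: "(aff \<beta> c ^^ j) x - (aff \<beta> c ^^ j) y = \<beta> ^ j * (x - y)"
  by (subst (1 2) aff_funpow) (simp add: algebra_simps)

lemma aff_0_funpow: "(aff \<beta> 0 ^^ j) x = \<beta> ^ j * x"
  by (induction j) (auto simp: aff_def)

text \<open>\<open>aff \<beta> c s - s\<close> is the constant term of the conjugate x |-> f (x + s)
  - s, in which the point \<open>s\<close> has become 0. Every change of base point below takes this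
  form.\<close>

lemma aff_shift_funpow:
  "(aff \<beta> (aff \<beta> c s - s) ^^ j) x = (aff \<beta> c ^^ j) (x + s) - s"
proof (induction j)
  case (Suc j)
  have "aff \<beta> (aff \<beta> c s - s) (y - s) = aff \<beta> c y - s" for y
    by (simp add: aff_def algebra_simps)
  then show ?case by (simp add: Suc)
qed simp

lemma reach_shift: "reach m \<beta> (aff \<beta> c s - s) x y \<longleftrightarrow> reach m \<beta> c (x + s) (y + s)"
  unfolding reach_def aff_shift_funpow by (simp add: cong_iff_dvd_diff algebra_simps)

lemma reach_dvd: "reach m \<beta> c x y \<Longrightarrow> k dvd m \<Longrightarrow> reach k \<beta> c x y"
  unfolding reach_def using cong_dvd_modulus by blast

lemma card_multiples:
  fixes d s :: int
  assumes "0 < d" "s dvd d" "0 < s"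
  shows "card {x \<in> {0..<d}. s dvd x} = nat (d div s)"
proof -
  have "{x \<in> {0..<d}. s dvd x} = (\<lambda>k. s * k) ` {0..<d div s}"
  proof (intro equalityI subsetI)
    fix x assume "x \<in> {x \<in> {0..<d}. s dvd x}"
    then obtain k where k: "x = s * k" "0 \<le> x" "x < d" by auto
    from assms obtain q where q: "d = s * q" by auto
    have "0 \<le> k" "k < q" using k q assms by (auto simp: zero_le_mult_iff)
    then show "x \<in> (\<lambda>k. s * k) ` {0..<d div s}" using k q assms by auto
  next
    fix x assume "x \<in> (\<lambda>k. s * k) ` {0..<d div s}"
    then show "x \<in> {x \<in> {0..<d}. s dvd x}" using assms by auto
  qed
  moreover have "inj_on (\<lambda>k. s * k) {0..<d div s}" using assms by (auto simp: inj_on_def)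
  ultimately show ?thesis by (simp add: card_image)
qed

lemma card_nonmultiples:
  fixes d s :: int
  assumes "0 < d" "s dvd d" "0 < s"
  shows "int (card {x \<in> {0..<d}. \<not> s dvd x}) = d - d div s"
proof -
  define M where "M = {x \<in> {0..<d}. s dvd x}"
  have M: "M \<subseteq> {0..<d}" by (auto simp: M_def)
  have "{x \<in> {0..<d}. \<not> s dvd x} = {0..<d} - M" by (auto simp: M_def)
  then have "card {x \<in> {0..<d}. \<not> s dvd x} = nat d - card M"
    using M by (simp add: card_Diff_subset finite_subset[OF M])
  moreover have "card M \<le> nat d" using card_mono[OF _ M] by simp
  moreover have "int (card M) = d div s"
    using card_multiples[OF assms] assms unfolding M_def by (simp add: pos_imp_zdiv_nonneg_iff)
  ultimately show ?thesis using assms(1) by linarith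
qed

section \<open>Periods and orbits of an affine permutation modulo \<open>m\<close>\<close>

locale affine_mod =
  fixes m \<beta> c :: int
  assumes m_pos: "0 < m" and cop: "coprime \<beta> m"
begin

abbreviation f where "f \<equiv> aff \<beta> c"
abbreviation R where "R \<equiv> reach m \<beta> c"
abbreviation per where "per \<equiv> period m \<beta> c"
abbreviation orb' where "orb' \<equiv> orb m \<beta> c"

lemma cong_funpow: "[(f ^^ j) x = (f ^^ j) y] (mod m) \<longleftrightarrow> [x = y] (mod m)"
  using cop by (simp add: cong_iff_dvd_diff aff_funpow_diff coprime_dvd_mult_right_iff coprime_commute)

lemma period_ex: "\<exists>j>0. [(f ^^ j) x = x] (mod m)"
proof -
  have "\<not> inj_on (\<lambda>j. (f ^^ j) x mod m) {0..nat m}"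
  proof
    assume "inj_on (\<lambda>j. (f ^^ j) x mod m) {0..nat m}"
    moreover have "(\<lambda>j. (f ^^ j) x mod m) ` {0..nat m} \<subseteq> {0..<m}" using m_pos by auto
    ultimately have "card {0..nat m} \<le> card {0..<m}" by (metis card_inj_on_le finite_atLeastLessThan_int)
    then show False by simp
  qed
  then obtain i j where ij: "i < j" "[(f ^^ i) x = (f ^^ j) x] (mod m)"
    unfolding inj_on_def cong_def by (metis linorder_neqE_nat)
  have "(f ^^ j) x = (f ^^ i) ((f ^^ (j - i)) x)"
    using ij(1) funpow_add[of i "j - i" f] by simp
  then have "[x = (f ^^ (j - i)) x] (mod m)" using ij(2) cong_funpow by metis
  then show ?thesis using ij(1) by (intro exI[of _ "j - i"]) (simp add: cong_sym)
qed

lemma per_pos: "0 < per x" and per_cong: "[(f ^^ per x) x = x] (mod m)"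
  using LeastI_ex[OF period_ex[of x]] by (simp_all add: period_def)

lemma per_least: "0 < j \<Longrightarrow> [(f ^^ j) x = x] (mod m) \<Longrightarrow> per x \<le> j"
  unfolding period_def by (rule Least_le) simp

lemma per_mult_cong: "[(f ^^ (per x * k)) x = x] (mod m)"
proof (induction k)
  case (Suc k)
  have "(f ^^ (per x * Suc k)) x = (f ^^ per x) ((f ^^ (per x * k)) x)"
    by (simp add: funpow_add)
  also have "[\<dots> = (f ^^ per x) x] (mod m)" using Suc cong_funpow by blast
  finally show ?case using per_cong cong_trans by blast
qed simp

lemma funpow_mod_per: fixes j :: nat shows "[(f ^^ j) x = (f ^^ (j mod per x)) x] (mod m)"
proof -
  have "(f ^^ j) x = (f ^^ (j mod per x)) ((f ^^ (per x * (j div per x))) x)"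
    by (simp flip: funpow_add o_apply[of "f ^^ _" "f ^^ _"])
  then show ?thesis using per_mult_cong cong_funpow by simp
qed

lemma per_dvd_iff: "[(f ^^ j) x = x] (mod m) \<longleftrightarrow> per x dvd j"
proof
  assume "[(f ^^ j) x = x] (mod m)"
  then have "[(f ^^ (j mod per x)) x = x] (mod m)"
    using funpow_mod_per cong_trans cong_sym by blast
  then have "j mod per x = 0"
    using per_least[of "j mod per x" x] per_pos[of x] by (meson mod_less_divisor not_gr_zero not_le)
  then show "per x dvd j" by auto
qed (use per_mult_cong in auto)

lemma R_trans: assumes "R x y" "R y z" shows "R x z"
proof -
  obtain i j where "[(f ^^ i) x = y] (mod m)" "[(f ^^ j) y = z] (mod m)"
    using assms by (auto simp: reach_def)
  then have "[(f ^^ (j + i)) x = z] (mod m)"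
    using cong_funpow cong_trans by (metis funpow_add o_apply)
  then show ?thesis by (auto simp: reach_def)
qed

lemma R_sym: assumes "R x y" shows "R y x"
proof -
  obtain i where i: "[(f ^^ i) x = y] (mod m)" using assms by (auto simp: reach_def)
  \<comment> \<open>From y, which is \<open>i\<close> steps after x, another
    \<open>per x * i - i\<close> steps complete \<open>i\<close> full periods of x; the subtraction
    is exact because periods are positive.\<close>
  have "(f ^^ (per x * i)) x = (f ^^ (per x * i - i)) ((f ^^ i) x)"
    using per_pos[of x] by (simp flip: funpow_add o_apply[of "f ^^ _" "f ^^ _"])
  then have "[(f ^^ (per x * i - i)) y = x] (mod m)"
    using i cong_funpow per_mult_cong[of x i] by (metis cong_sym cong_trans)
  then show ?thesis by (auto simp: reach_def)
qed

lemma R_cong: "[x = y] (mod m) \<Longrightarrow> R x y"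
  unfolding reach_def by (rule exI[of _ 0]) simp

lemma R_step: "R x ((f ^^ j) x)"
  unfolding reach_def by (rule exI[of _ j]) simp

lemma orb_eq: "orb' x = (\<lambda>j. (f ^^ j) x mod m) ` {..<per x}"
proof (intro equalityI subsetI)
  fix y assume "y \<in> orb' x"
  then obtain j where j: "[(f ^^ j) x = y] (mod m)" "0 \<le> y" "y < m"
    by (auto simp: orb_def reach_def)
  then have "y = (f ^^ (j mod per x)) x mod m"
    using funpow_mod_per[of j x] by (simp add: cong_def)
  then show "y \<in> (\<lambda>j. (f ^^ j) x mod m) ` {..<per x}" using per_pos by auto
qed (use m_pos in \<open>auto simp: orb_def reach_def cong_def\<close>)

lemma card_orb: "card (orb' x) = per x"
proof -
  have "i = j" if "i \<le> j" "j < per x" "[(f ^^ i) x = (f ^^ j) x] (mod m)" for i j :: nat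
  proof -
    have "(f ^^ j) x = (f ^^ i) ((f ^^ (j - i)) x)"
      using that(1) funpow_add[of i "j - i" f] by simp
    then have "[(f ^^ (j - i)) x = x] (mod m)" using that(3) cong_funpow cong_sym by metis
    then show ?thesis using that(1,2) per_least[of "j - i" x] by (cases "i = j") auto
  qed
  then have "inj_on (\<lambda>j. (f ^^ j) x mod m) {..<per x}"
    unfolding inj_on_def cong_def by (metis lessThan_iff nat_le_linear)
  then show ?thesis by (simp add: orb_eq card_image)
qed

lemma finite_orb: "finite (orb' x)" by (simp add: orb_eq)

lemma orb_cong: "R x y \<Longrightarrow> orb' x = orb' y"
  unfolding orb_def using R_trans R_sym by blast

lemma orb_disjoint: "\<not> R x y \<Longrightarrow> orb' x \<inter> orb' y = {}"
  unfolding orb_def using R_trans R_sym by blast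

lemma per_R: "R x y \<Longrightarrow> per x = per y"
  using card_orb orb_cong by metis

lemma R_mod: "R x (y mod m) \<longleftrightarrow> R x y"
  unfolding reach_def by (simp add: cong_def)

lemma mod_in_orb: "y mod m \<in> orb' x \<longleftrightarrow> R x y"
  using m_pos by (simp add: orb_def R_mod)

text \<open>A system of representatives of the orbits, kept as points so that convenient ones such
  as 0 and 1 can be substituted later.\<close>

definition three :: "int \<Rightarrow> int \<Rightarrow> int \<Rightarrow> bool" where
  "three x y z \<longleftrightarrow> \<not> R x y \<and> \<not> R x z \<and> \<not> R y z \<and> (\<forall>t. R x t \<or> R y t \<or> R z t)"

lemma card_three:
  assumes "\<not> R x y" "\<not> R x z" "\<not> R y z"
  shows "card (orb' x \<union> orb' y \<union> orb' z) = per x + per y + per z"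
  using assms by (subst card_Un_disjoint | simp add: finite_orb Int_Un_distrib2 orb_disjoint card_orb)+

lemma three_sum: assumes "three x y z" shows "int (per x) + int (per y) + int (per z) = m"
proof -
  have "orb' x \<union> orb' y \<union> orb' z = {0..<m}"
    using assms by (auto simp: three_def orb_def)
  then have "card {0..<m} = per x + per y + per z"
    using card_three[of x y z] assms by (simp add: three_def)
  then show ?thesis using m_pos by simp
qed

text \<open>Counting replaces a direct proof that every point is reached: three different orbits
  whose lengths add up to \<open>m\<close> leave no residue over.\<close>

lemma threeI:
  assumes "\<not> R x y" "\<not> R x z" "\<not> R y z" "int (per x) + int (per y) + int (per z) = m"
  shows "three x y z"
proof -
  have "orb' x \<union> orb' y \<union> orb' z \<subseteq> {0..<m}" by (auto simp: orb_def)
  moreover have "card (orb' x \<union> orb' y \<union> orb' z) = card {0..<m}"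
    using card_three[OF assms(1-3)] assms(4) by simp
  ultimately have eq: "orb' x \<union> orb' y \<union> orb' z = {0..<m}"
    by (intro card_subset_eq) auto
  have "R x t \<or> R y t \<or> R z t" for t
  proof -
    have "t mod m \<in> {0..<m}" using m_pos by simp
    then show ?thesis unfolding eq[symmetric] by (auto simp: mod_in_orb)
  qed
  then show ?thesis using assms by (simp add: three_def)
qed

lemma three_perm: "three x y z \<Longrightarrow> three y x z" "three x y z \<Longrightarrow> three x z y"
  unfolding three_def using R_sym by blast+

end

subsection \<open>Orders and powers\<close>

text \<open>The claim is transferred to natural numbers by replacing \<open>a\<close> by its
  residue. If \<open>a\<close> and \<open>m\<close> are not coprime, \<open>ord m a\<close> is 0 and
  both sides say that \<open>j\<close> is 0.\<close>

lemma ord_dvd_int: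
  fixes m a :: int
  assumes "0 < m"
  shows "[a ^ j = 1] (mod m) \<longleftrightarrow> ord m a dvd j"
proof -
  define M A where "M = nat m" and "A = nat (a mod m)"
  have m: "m = int M" and A: "int A = a mod m" using assms by (auto simp: M_def A_def)
  have pow: "[a ^ k = 1] (mod m) \<longleftrightarrow> [A ^ k = 1] (mod M)" for k
  proof -
    have "[a ^ k = int A ^ k] (mod m)" unfolding A by (intro cong_pow) (simp add: cong_def)
    then have "[a ^ k = 1] (mod m) \<longleftrightarrow> [int (A ^ k) = int 1] (mod int M)"
      unfolding m by (metis cong_sym cong_trans of_nat_1 of_nat_power)
    then show ?thesis by (simp only: cong_int_iff)
  qed
  have "coprime m a \<longleftrightarrow> coprime (int M) (int A)" unfolding A m
    by (metis coprime_mod_right_iff assms less_irrefl m)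
  then have "coprime m a \<longleftrightarrow> coprime M A" by simp
  then have "ord m a = ord M A" unfolding ord_def pow by simp
  then show ?thesis by (simp only: pow ord_divides)
qed

lemma ord_eqI:
  fixes m a :: int
  assumes "0 < m" "\<And>j. [a ^ j = 1] (mod m) \<longleftrightarrow> k dvd j"
  shows "ord m a = k"
  using assms ord_dvd_int by (metis dvd_antisym dvd_refl)

text \<open>Lifting the exponent at 3: a sum of \<open>3 * M\<close> powers of \<beta> is 1 +
  \<beta> + \<beta>^2 times a sum of \<open>M\<close> powers of \<beta>^3. The first factor contains
  exactly one 3, so each induction step removes one 3 from the sum and one from
  \<open>L\<close>.\<close>

lemma sum_powers_dvd_3:
  fixes \<beta> :: int
  assumes "[\<beta> = 1] (mod 3)" "3 ^ e dvd (\<Sum>i<L. \<beta> ^ i)"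
  shows "3 ^ e dvd L"
  using assms
proof (induction e arbitrary: \<beta> L)
  case (Suc e)
  have "[(\<Sum>i<L. \<beta> ^ i) = (\<Sum>i<L. 1 ^ i)] (mod 3)" by (intro cong_sum cong_pow Suc.prems)
  moreover have "3 dvd (\<Sum>i<L. \<beta> ^ i)" using Suc.prems(2) dvd_trans[of 3 "3 ^ Suc e"] by simp
  ultimately have "3 dvd int L" by (simp add: cong_dvd_iff)
  then obtain M where M: "L = 3 * M" by (metis dvdE int_dvd_int_iff of_nat_numeral)
  have split: "(\<Sum>i<3 * M. \<beta> ^ i) = (1 + \<beta> + \<beta>\<^sup>2) * (\<Sum>i<M. (\<beta> ^ 3) ^ i)"
    by (induction M)
      (simp_all add: algebra_simps numeral_3_eq_3 power_mult[symmetric] power_add power2_eq_square power3_eq_cube)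
  obtain k where k: "\<beta> = 1 + 3 * k"
    using Suc.prems(1) by (metis add.commute cong_iff_lin cong_sym mult.commute)
  have "1 + \<beta> + \<beta>\<^sup>2 = 3 * (1 + 3 * (k + k\<^sup>2))" by (simp add: k power2_eq_square algebra_simps)
  from Suc.prems(2)[unfolded M split this] have "3 * 3 ^ e dvd 3 * ((1 + 3 * (k + k\<^sup>2)) * (\<Sum>i<M. (\<beta> ^ 3) ^ i))"
    by (simp only: power_Suc mult.assoc)
  then have "3 ^ e dvd (1 + 3 * (k + k\<^sup>2)) * (\<Sum>i<M. (\<beta> ^ 3) ^ i)" by (simp only: dvd_mult_cancel_left) simp
  moreover have "coprime (3 ^ e) (1 + 3 * (k + k\<^sup>2))"
  proof -
    have "coprime 3 (1 + 3 * (k + k\<^sup>2))"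
      using gcd_add_mult[of 3 "k + k\<^sup>2" 1] by (simp only: coprime_iff_gcd_eq_1 ac_simps) simp
    then show ?thesis by (rule coprime_power_left_iff[THEN iffD2, OF disjI1])
  qed
  ultimately have "3 ^ e dvd (\<Sum>i<M. (\<beta> ^ 3) ^ i)" by (simp add: coprime_dvd_mult_right_iff)
  moreover have "[\<beta> ^ 3 = 1] (mod 3)" using cong_pow[OF Suc.prems(1), of 3] by simp
  ultimately show ?case using Suc.IH by (simp add: M)
qed simp

text \<open>An odd square is 1 modulo 8, and each further squaring contributes an even factor. The
  first squaring yields three factors 2 at once, whence the offset 3 against
  \<open>Suc e\<close>.\<close>

lemma two_power_dvd_power_diff_1:
  fixes \<beta> :: int
  assumes "odd \<beta>"
  shows "2 ^ (e + 3) dvd \<beta> ^ (2 ^ Suc e * t) - 1"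
proof -
  have "2 ^ (e + 3) dvd \<beta> ^ (2 ^ Suc e) - 1"
  proof (induction e)
    case 0
    obtain k where k: "\<beta> = 2 * k + 1" using assms oddE by blast
    have "\<beta> ^ 2 - 1 = 4 * (k * (k + 1))" by (simp add: k power2_eq_square algebra_simps)
    moreover have "even (k * (k + 1))" by simp
    ultimately have "4 * 2 dvd \<beta> ^ 2 - 1" by (metis mult_dvd_mono dvd_refl)
    then show ?case by simp
  next
    case (Suc e)
    have "\<beta> ^ (2 ^ Suc (Suc e)) - 1 = (\<beta> ^ (2 ^ Suc e) - 1) * (\<beta> ^ (2 ^ Suc e) + 1)"
      unfolding power_Suc[of 2 "Suc e"] mult.commute[of 2] power_mult[of \<beta> "2 ^ Suc e" 2]
      by (simp add: power2_eq_square algebra_simps)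
    moreover have "even (\<beta> ^ (2 ^ Suc e) + 1)" using assms by simp
    ultimately have "2 ^ (e + 3) * 2 dvd \<beta> ^ (2 ^ Suc (Suc e)) - 1"
      using Suc by (metis mult_dvd_mono)
    then show ?case by (simp only: add_Suc power_Suc mult.commute)
  qed
  moreover have "\<beta> ^ (2 ^ Suc e) - 1 dvd \<beta> ^ (2 ^ Suc e * t) - 1"
    unfolding power_mult by (metis dvd_triv_left power_diff_1_eq)
  ultimately show ?thesis using dvd_trans by blast
qed

text \<open>The odd part of \<open>u\<close> divides by hypothesis. The factor
  \<open>2 ^ Suc e\<close> of \<open>u\<close> yields \<open>2 ^ (e + 3)\<close>, two factors 2 more
  than \<open>u\<close> has. This gain excludes an even orbit length in
  \<open>two_orbits_of_multiples\<close>.\<close>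

lemma four_dvd_power_diff_1:
  fixes \<beta> :: int
  assumes "odd \<beta>" "even u" "0 < u" "2 * int u dvd \<beta> ^ u - 1"
  shows "4 * int u dvd \<beta> ^ u - 1"
proof -
  obtain k t where kt: "u = 2 ^ k * t" "odd t"
    using assms(3) multiplicity_decompose'[of u 2] that by fastforce
  with assms(2) obtain e where e: "k = Suc e" by (cases k) auto
  have "2 ^ (e + 3) dvd \<beta> ^ u - 1" using two_power_dvd_power_diff_1[OF assms(1)] by (simp add: kt e)
  moreover have "int t dvd \<beta> ^ u - 1" using assms(4) by (rule dvd_trans[rotated]) (simp add: kt(1))
  moreover have "coprime (2 ^ (e + 3)) (int t)" using kt(2) by simp
  ultimately have "2 ^ (e + 3) * int t dvd \<beta> ^ u - 1" by (rule divides_mult)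
  moreover have "2 ^ (e + 3) * int t = 4 * int u" by (simp add: kt e power_add)
  ultimately show ?thesis by simp
qed

lemma aff_funpow_0: "(aff \<beta> c ^^ L) 0 = c * (\<Sum>i<L. \<beta> ^ i)"
proof (induction L)
  case (Suc L)
  have "(\<Sum>i<Suc L. \<beta> ^ i) = 1 + \<beta> * (\<Sum>i<L. \<beta> ^ i)"
    by (subst sum.lessThan_Suc_shift) (simp add: sum_distrib_left)
  then have "c * (\<Sum>i<Suc L. \<beta> ^ i) = \<beta> * (c * (\<Sum>i<L. \<beta> ^ i)) + c"
    by (simp add: algebra_simps)
  then show ?case by (simp only: funpow.simps o_apply Suc) (simp only: aff_def)
qed simp

lemma dvd_mult_iff_div_gcd:
  fixes m a x :: int
  assumes "0 < m"
  shows "m dvd a * x \<longleftrightarrow> m div gcd a m dvd x"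
proof -
  define g where "g = gcd a m"
  have g0: "g \<noteq> 0" using assms by (simp add: g_def)
  then obtain a' m' where am: "a = g * a'" "m = g * m'" "coprime a' m'"
    using gcd_coprime_exists[of a m] unfolding g_def mult.commute[of "gcd a m"] by blast
  have "m dvd a * x \<longleftrightarrow> m' dvd a' * x" using g0 unfolding am(1,2) mult.assoc by (simp only: dvd_mult_cancel_left) simp
  also have "\<dots> \<longleftrightarrow> m' dvd x" using am(3) by (simp only: coprime_dvd_mult_right_iff coprime_commute)
  also have "m' = m div g" using g0 am(2) by simp
  finally show ?thesis by (simp only: g_def)
qed

subsection \<open>Affine maps with three orbits\<close>

text \<open>
  The three alternatives describe the maps that generate, together with the translations, the
  groups \<open>H\<^sub>1\<close> or \<open>H\<^sub>2\<close>, \<open>H\<^sub>3\<close>, and \<open>H\<^sub>4\<close>, respectively.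
\<close>

definition special :: "int \<Rightarrow> int \<Rightarrow> int \<Rightarrow> bool" where
  "special m \<beta> c \<longleftrightarrow> (\<exists>r. prime r \<and>
     (r \<noteq> 2 \<and> m = r \<and> r dvd c \<and> ord r \<beta> = nat ((r - 1) div 2) \<or>
      m = r\<^sup>2 \<and> r\<^sup>2 dvd c \<and> ord (r\<^sup>2) \<beta> = nat (r\<^sup>2 - r) \<or>
      r \<noteq> 2 \<and> m = 2 * r \<and> r dvd c \<and> odd c \<and> ord r \<beta> = nat (r - 1)))"

context affine_mod
begin

lemma cop_dvd: "k dvd m \<Longrightarrow> coprime \<beta> k"
  using coprime_divisors[OF dvd_refl _ cop] .

lemma per_shift: "period m \<beta> (aff \<beta> c s - s) x = per (x + s)"
  unfolding period_def aff_shift_funpow by (simp add: cong_iff_dvd_diff algebra_simps)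

lemma three_shift: "affine_mod.three m \<beta> (aff \<beta> c s - s) x y z \<longleftrightarrow> three (x + s) (y + s) (z + s)"
proof -
  interpret N: affine_mod m \<beta> "aff \<beta> c s - s" using m_pos cop by unfold_locales
  have "(\<forall>t. P (t + s)) \<longleftrightarrow> (\<forall>t. P t)" for P :: "int \<Rightarrow> bool"
    by (metis diff_add_cancel)
  from this[of "\<lambda>t. R (x + s) t \<or> R (y + s) t \<or> R (z + s) t"]
  show ?thesis by (simp add: three_def N.three_def reach_shift)
qed

lemma three_cong: assumes "three x y z" "R x u" "R y v" shows "three u v z"
proof -
  have ux: "R u t \<longleftrightarrow> R x t" for t using assms(2) R_sym R_trans by blast
  have vy: "R v t \<longleftrightarrow> R y t" for t using assms(3) R_sym R_trans by blast
  have "\<not> R u v" using assms ux R_sym R_trans unfolding three_def by blast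
  then show ?thesis using assms(1) unfolding three_def ux vy by simp
qed

text \<open>\<open>u\<close> and \<open>v\<close> lie in two different ones of the three orbits; a
  representative of the remaining one serves as \<open>w\<close>.\<close>

lemma three_ex2: assumes "three x y z" "\<not> R u v" shows "\<exists>w. three u v w"
proof -
  have same: "\<not> (R k u \<and> R k v)" for k using assms(2) R_sym R_trans by blast
  note t = assms(1) three_perm[OF assms(1)]
  note t' = t three_perm[OF t(2)] three_perm[OF t(3)]
  have "R x u \<or> R y u \<or> R z u" "R x v \<or> R y v \<or> R z v" using assms(1) by (auto simp: three_def)
  then show ?thesis using same three_cong t' three_perm(1)[OF t'(5)]
    by blast
qed

lemma funpow_cong_power: assumes "k dvd c" shows "[(f ^^ j) x = \<beta> ^ j * x] (mod k)"
  using assms by (subst aff_funpow) (simp add: aff_funpow_0 cong_iff_dvd_diff)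

text \<open>Since \<open>s\<close> divides the constant term, the map is multiplication by \<beta>
  modulo \<open>s\<close>, and \<beta> is a unit there.\<close>

lemma R_gcd: assumes "s dvd m" "s dvd c" "R x y" shows "gcd x s = gcd y s"
proof -
  have "coprime \<beta> s" by (rule cop_dvd[OF assms(1)])
  then have "gcd (\<beta> ^ j * x) s = gcd x s" for j
    by (intro gcd_mult_left_left_cancel) (simp add: coprime_commute)
  moreover obtain j where "[(f ^^ j) x = y] (mod m)" using assms(3) by (auto simp: reach_def)
  then have "[\<beta> ^ j * x = y] (mod s)"
    using funpow_cong_power[OF assms(2)] cong_dvd_modulus[OF _ assms(1)] cong_trans cong_sym by meson
  ultimately show ?thesis by (metis cong_gcd_eq)
qed

lemma funpow_eq_self_iff:
  assumes "prime m" "m dvd c" "\<not> m dvd x"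
  shows "[(f ^^ j) x = x] (mod m) \<longleftrightarrow> ord m \<beta> dvd j"
proof -
  have "coprime x m" using assms(1,3) prime_imp_coprime coprime_commute by blast
  then have "[\<beta> ^ j * x = 1 * x] (mod m) \<longleftrightarrow> [\<beta> ^ j = 1] (mod m)" by (rule cong_mult_rcancel)
  then show ?thesis using funpow_cong_power[OF assms(2), of j x] ord_dvd_int[OF m_pos, of \<beta> j]
    by (simp add: cong_def)
qed

lemma per_prime:
  assumes "prime m" "m dvd c" "\<not> m dvd x"
  shows "per x = ord m \<beta>"
  using funpow_eq_self_iff[OF assms] by (metis dvd_antisym dvd_refl per_dvd_iff)

lemma per_0: assumes "m dvd c" shows "per 0 = 1"
proof -
  have "[(f ^^ 1) 0 = 0] (mod m)" using funpow_cong_power[OF assms, of 1 0] by simp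
  then show ?thesis using per_dvd_iff[of 1 0] by simp
qed

lemma R_dvd: assumes "s dvd m" "s dvd c" "R x y" shows "s dvd x \<longleftrightarrow> s dvd y"
  using R_gcd[OF assms] by (metis gcd_dvd1 gcd_proj2_iff abs_dvd_iff dvd_abs_iff)

text \<open>The iterate of order \<open>per 0\<close> fixes 0, so it fixes x exactly when (\<beta> ^
  per 0 - 1) * x vanishes modulo \<open>m\<close>; the solutions of this linear condition are the
  multiples of one divisor of \<open>m\<close>. By minimality, a period dividing
  \<open>per 0\<close> equals it.\<close>

lemma min_period_multiples:
  assumes "\<And>x. per 0 \<le> per x"
  obtains s where "0 < s" "s dvd m" "s dvd c" "\<And>x. per x = per 0 \<longleftrightarrow> s dvd x"
proof
  define s where "s = m div gcd (\<beta> ^ per 0 - 1) m"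
  have "m = s * gcd (\<beta> ^ per 0 - 1) m" by (simp add: s_def)
  then show "0 < s" "s dvd m" using m_pos
    by (metis dvd_triv_left gcd_ge_0_int zero_less_mult_iff not_le, metis dvd_triv_left)
  show iff: "per x = per 0 \<longleftrightarrow> s dvd x" for x
  proof -
    have "m dvd (f ^^ per 0) 0" using per_cong[of 0] by (simp add: cong_iff_dvd_diff)
    moreover have "(f ^^ per 0) x - x = (\<beta> ^ per 0 - 1) * x + (f ^^ per 0) 0"
      by (subst aff_funpow) (simp add: left_diff_distrib)
    ultimately have "[(f ^^ per 0) x = x] (mod m) \<longleftrightarrow> m dvd (\<beta> ^ per 0 - 1) * x"
      by (simp only: cong_iff_dvd_diff dvd_add_left_iff)
    then have "per x dvd per 0 \<longleftrightarrow> s dvd x"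
      using dvd_mult_iff_div_gcd[OF m_pos] by (simp add: s_def per_dvd_iff)
    moreover have "per x dvd per 0 \<longleftrightarrow> per x = per 0"
      using assms[of x] dvd_imp_le[OF _ per_pos[of 0]] by (metis dvd_refl le_antisym)
    ultimately show ?thesis by simp
  qed
  \<comment> \<open>\<open>c\<close> is the image of 0, so it has the same period as 0.\<close>
  show "s dvd c" using per_R[OF R_step[of 0 1]] by (subst iff[symmetric]) (simp add: aff_def)
qed

lemma multiples_orb:
  assumes "s dvd m" "0 < s" "s dvd x" "\<And>y. R x y \<longleftrightarrow> s dvd y"
  shows "int (per x) * s = m"
proof -
  have "orb' x = {y \<in> {0..<m}. s dvd y}" using assms(4) by (auto simp: orb_def)
  then have "per x = nat (m div s)" using card_multiples[OF m_pos assms(1,2)] card_orb[of x] by simp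
  then show ?thesis using assms(1,2) m_pos
    by (simp add: pos_imp_zdiv_nonneg_iff)
qed

lemma transitive_period: assumes "\<And>x y. R x y" shows "int (per x) = m"
  using multiples_orb[of 1 x] assms by simp

lemma funpow_parity: assumes "odd \<beta>" "odd c" shows "even ((f ^^ j) x) \<longleftrightarrow> even (x + int j)"
  by (induction j) (use assms in \<open>auto simp: aff_def\<close>)

text \<open>
  Here $m / r$ is prime to \<open>r\<close>, and modulo $m / r$ the map is a single cycle. So all points outside
  the multiples of \<open>r\<close> have period $\mathrm{lcm}(r - 1, m / r)$. As they form two orbits,
  $\gcd(r - 1, m / r) = 2$, and then translation by $2r$ preserves every orbit.
\<close>

lemma two_orbits_outside_multiples:
  assumes r: "prime r" "r \<noteq> 2" "r dvd m" "r dvd c" and ordr: "ord r \<beta> = nat (r - 1)"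
    and 0: "\<And>x. R 0 x \<longleftrightarrow> r dvd x" and th: "three 0 y z"
    and free: "\<And>t. (\<And>x. R x (x + t)) \<Longrightarrow> m dvd t"
  shows "m = 2 * r \<and> odd c"
proof -
  have r2: "2 < r" using r(1,2) prime_ge_2_int[of r] by simp
  define q where "q = m div r"
  have mq: "m = r * q" using r(3) by (simp add: q_def)
  have q0: "0 < q" using m_pos mq r2 by (simp add: zero_less_mult_iff)
  interpret r: affine_mod r \<beta> c using r2 r(3) cop_dvd by unfold_locales auto
  interpret q: affine_mod q \<beta> c using q0 mq cop_dvd by unfold_locales auto
  have pow: "[(f ^^ j) x = x] (mod r) \<longleftrightarrow> nat (r - 1) dvd j" if "\<not> r dvd x" for x j
    using r.funpow_eq_self_iff[OF r(1,4) that] ordr by simp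
  \<comment> \<open>If r^2 divided \<open>m\<close>, then, as \<beta> is not 1 modulo
    \<open>r\<close>, some multiple of \<open>r\<close> would be fixed modulo r^2. But all multiples
    of \<open>r\<close> form one orbit, and they are not all congruent modulo r^2.\<close>
  have "\<not> r dvd q"
  proof
    assume "r dvd q"
    then have sq: "r * r dvd m" by (simp add: mq)
    interpret S: affine_mod "r * r" \<beta> c using sq r2 cop_dvd by unfold_locales auto
    obtain c' where c: "c = r * c'" using r(4) by auto
    have "\<not> r dvd \<beta> - 1"
    proof
      assume "r dvd \<beta> - 1"
      then have "[\<beta> ^ 1 = 1] (mod r)" by (simp add: cong_iff_dvd_diff)
      then have "nat (r - 1) dvd 1" using ord_dvd_int[of r \<beta> 1] ordr r2 by simp
      then show False using r2 by simp
    qed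
    then have "coprime (\<beta> - 1) r" using r(1) by (simp add: prime_imp_coprime coprime_commute)
    then obtain y0 where "[(\<beta> - 1) * y0 = - c'] (mod r)"
      using cong_solve_dvd_int[of "\<beta> - 1" r "- c'"] by (auto simp: coprime_iff_gcd_eq_1)
    then have "r dvd (\<beta> - 1) * y0 + c'" by (simp add: cong_iff_dvd_diff)
    then have "r * r dvd r * ((\<beta> - 1) * y0 + c')" by (rule mult_dvd_mono[OF dvd_refl])
    moreover have "f (r * y0) - r * y0 = r * ((\<beta> - 1) * y0 + c')"
      by (simp add: aff_def c algebra_simps)
    ultimately have "r * r dvd f (r * y0) - r * y0" by simp
    then have "[(f ^^ 1) (r * y0) = r * y0] (mod r * r)" by (simp add: cong_iff_dvd_diff)
    then have "S.per (r * y0) dvd 1" using S.per_dvd_iff by blast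
    then have fixed: "[(f ^^ j) (r * y0) = r * y0] (mod r * r)" for j using S.per_dvd_iff by simp
    have "R (r * y0) (r * y0 + r)" using 0 R_sym R_trans by (meson dvd_add dvd_refl dvd_triv_left)
    then have "S.R (r * y0) (r * y0 + r)" using reach_dvd sq by blast
    then have "[r * y0 = r * y0 + r] (mod r * r)"
      using fixed unfolding reach_def using cong_sym cong_trans by blast
    then have "r * r dvd r" by (simp add: cong_iff_dvd_diff)
    then show False using r2 by (auto dest: zdvd_imp_le simp: mult_le_cancel_left1)
  qed
  then have rq: "coprime r q" using r(1) by (simp add: prime_imp_coprime)
  have cong_m: "[x = y] (mod m) \<longleftrightarrow> [x = y] (mod r) \<and> [x = y] (mod q)" for x y
    unfolding mq using coprime_cong_mult[OF _ _ rq, of x y] cong_dvd_modulus[of x y "r * q" r]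
      cong_dvd_modulus[of x y "r * q" q] dvd_triv_left dvd_triv_right by blast
  \<comment> \<open>Every residue modulo \<open>q\<close> is represented by a multiple of
    \<open>r\<close>, and these form a single orbit.\<close>
  have trans_q: "q.R x y" for x y
  proof -
    obtain k where k: "[r * k = 1] (mod q)" using cong_solve_coprime_int rq by blast
    have *: "[r * k * x = x] (mod q)" for x using cong_scalar_right[OF k, of x] by simp
    have "R (r * k * x) (r * k * y)" using 0 R_sym R_trans by (meson dvd_mult2 dvd_triv_left)
    then have "q.R (r * k * x) (r * k * y)" using reach_dvd mq by simp
    then show ?thesis using q.R_cong[OF *] q.R_sym q.R_trans by meson
  qed
  have per_q: "int (q.per x) = q" for x using q.transitive_period trans_q by blast
  have per: "per x = lcm (nat (r - 1)) (nat q)" if "\<not> r dvd x" for x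
  proof -
    have "per x dvd j \<longleftrightarrow> lcm (nat (r - 1)) (nat q) dvd j" for j
    proof -
      have "q.per x = nat q" using per_q[of x] by simp
      then show ?thesis
        using pow[OF that] by (simp add: per_dvd_iff[symmetric] cong_m q.per_dvd_iff)
    qed
    then show ?thesis by (metis dvd_antisym dvd_refl)
  qed
  have "\<not> r dvd y" "\<not> r dvd z" using th by (auto simp: three_def 0)
  moreover have "int (per 0) = q" using multiples_orb[of r 0] 0 r(3) r2 mq by simp
  ultimately have "q + 2 * int (lcm (nat (r - 1)) (nat q)) = m"
    using three_sum[OF th] per[of y] per[of z] by linarith
  then have "2 * int (lcm (nat (r - 1)) (nat q)) = (r - 1) * q"
    unfolding mq left_diff_distrib by linarith
  also have "\<dots> = int (nat (r - 1) * nat q)" using r2 q0 by simp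
  also have "\<dots> = int (gcd (nat (r - 1)) (nat q)) * int (lcm (nat (r - 1)) (nat q))"
    by (subst prod_gcd_lcm_nat) (rule of_nat_mult)
  finally have "int 2 = int (gcd (nat (r - 1)) (nat q))"
    using r2 q0 by (simp add: lcm_0_iff_nat del: of_nat_eq_iff)
  then have g2: "gcd (nat (r - 1)) (nat q) = 2" by linarith
  then have "even (nat q)" by (metis gcd_dvd2)
  then have evq: "even q" using q0 by (simp add: even_nat_iff)
  then have "even m" by (simp add: mq)
  then have odd_b: "odd \<beta>" using cop by (metis coprime_common_divisor odd_one)
  \<comment> \<open>With \<open>c\<close> even, the iterates of 0 would all be even and miss 1
    modulo the even number \<open>q\<close>.\<close>
  have odd_c: "odd c"
  proof
    assume "even c"
    obtain j where "[(f ^^ j) 0 = 1] (mod q)" using trans_q[of 0 1] by (auto simp: reach_def)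
    then have "[(f ^^ j) 0 = 1] (mod 2)" using evq cong_dvd_modulus by blast
    then show False using \<open>even c\<close> by (simp add: aff_funpow_0 cong_iff_dvd_diff)
  qed
  have "R x (x + 2 * r)" for x
  proof (cases "r dvd x")
    case True
    then show ?thesis using 0 R_sym R_trans by (meson dvd_add dvd_triv_right)
  next
    case False
    obtain i where i: "[(f ^^ i) x = x + 2 * r] (mod q)"
      using trans_q[of x "x + 2 * r"] by (auto simp: reach_def)
    then have "[(f ^^ i) x = x + 2 * r] (mod 2)" using evq cong_dvd_modulus by blast
    then have "even ((f ^^ i) x) \<longleftrightarrow> even x" by (auto simp: cong_iff_dvd_diff)
    then have "even i" using funpow_parity[OF odd_b odd_c] by auto
    \<comment> \<open>Since the gcd of \<open>r - 1\<close> and \<open>q\<close> is 2 and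
      \<open>i\<close> is even, some multiple of \<open>r - 1\<close> is congruent to
      \<open>i\<close> modulo \<open>q\<close>. That iterate fixes x modulo \<open>r\<close> and
      adds \<open>2 * r\<close> to it modulo \<open>q\<close>.\<close>
    then obtain k where k: "[nat (r - 1) * k = i] (mod nat q)"
      using cong_solve_dvd_nat[of "nat (r - 1)" "nat q" i] g2 by auto
    then have "nat (r - 1) * k mod q.per x = i mod q.per x" using per_q[of x] by (metis cong_def nat_int)
    then have "[(f ^^ (nat (r - 1) * k)) x = (f ^^ i) x] (mod q)"
      using q.funpow_mod_per[of _ x] by (metis cong_sym cong_trans)
    then have "[(f ^^ (nat (r - 1) * k)) x = x + 2 * r] (mod q)" using i cong_trans by blast
    moreover have "[(f ^^ (nat (r - 1) * k)) x = x] (mod r)" using pow[OF False] by simp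
    then have "[(f ^^ (nat (r - 1) * k)) x = x + 2 * r] (mod r)" by (simp add: cong_def)
    ultimately show ?thesis unfolding reach_def cong_m by blast
  qed
  then have "m dvd 2 * r" by (rule free)
  then have "q dvd 2" using r2 by (simp add: mq mult.commute)
  then have "q = 2" using evq q0 by (metis zdvd_antisym_nonneg even_numeral less_imp_le zero_le_numeral)
  then show ?thesis using odd_c mq by simp
qed

lemma three_total: "three x y z \<Longrightarrow> R x t \<or> R y t \<or> R z t"
  by (simp add: three_def)

lemma prime_int_iff_divisors:
  assumes "1 < s" "\<And>e. e dvd s \<Longrightarrow> 0 < e \<Longrightarrow> e \<noteq> s \<Longrightarrow> e = 1"
  shows "prime (s :: int)"
  unfolding prime_int_iff using assms by force

text \<open>
  Translation by $m / r$ does not preserve both orbits inside the multiples of \<open>r\<close>; as these orbits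
  have the same length, this forces $r = 2$. If \<open>L\<close> is their common length, then $m = 4L$ and
  $\beta^L \equiv 1$ modulo $2L$ but not modulo $4L$, so \<open>L\<close> is odd, and then translation by $4$
  preserves every orbit.
\<close>

lemma two_orbits_of_multiples:
  assumes r: "prime r" "r dvd m" "r dvd c"
    and th: "three 0 v 1" "r dvd v" and out: "\<And>x y. \<not> r dvd x \<Longrightarrow> \<not> r dvd y \<Longrightarrow> R x y"
    and mult: "\<And>x y. r dvd x \<Longrightarrow> R x y \<Longrightarrow> r dvd y"
    and min: "\<And>x. per x = per 0 \<longleftrightarrow> r dvd x"
    and free: "\<And>t. (\<And>x. R x (x + t)) \<Longrightarrow> m dvd t"
  shows "r = 2 \<and> m = 4 \<and> 4 dvd c \<and> ord 4 \<beta> = 2"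
proof -
  have r2: "2 \<le> r" using r(1) prime_ge_2_int by simp
  define L where "L = per 0"
  have L0: "0 < L" using per_pos by (simp add: L_def)
  have pL: "per x = L" if "r dvd x" for x using min that by (simp add: L_def)
  define q where "q = m div r"
  have mq: "m = r * q" using r(2) by (simp add: q_def)
  have q0: "0 < q" using m_pos mq r2 by (simp add: zero_less_mult_iff)
  interpret q: affine_mod q \<beta> c using q0 mq cop_dvd by unfold_locales auto
  have n1: "\<not> r dvd 1" using r2 by auto
  have F: "orb' 0 \<union> orb' v = {y \<in> {0..<m}. r dvd y}"
  proof -
    have "R 0 y \<or> R v y \<longleftrightarrow> r dvd y" for y
      using three_total[OF th(1), of y] mult[of 0 y] mult[of v y] mult[of y 1] th(2) n1 R_sym by auto
    then show ?thesis by (auto simp: orb_def)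
  qed
  have "2 * int L = q"
  proof -
    have "card (orb' 0 \<union> orb' v) = L + L"
      using th(1) pL[of 0] pL[OF th(2)]
      by (subst card_Un_disjoint) (auto simp: finite_orb orb_disjoint card_orb three_def)
    then have "L + L = nat (m div r)" using F card_multiples[OF m_pos r(2)] r2 by simp
    then show ?thesis using q0 by (simp add: q_def)
  qed
  \<comment> \<open>Otherwise congruence modulo \<open>m\<close> splits into congruences modulo
    \<open>r\<close> and \<open>q\<close>. As non-multiples of \<open>r\<close>, \<open>q\<close>
    and \<open>v + q\<close> share an orbit, so 0 reaches v modulo \<open>q\<close>; modulo
    \<open>r\<close> both v and all iterates of 0 vanish. Thus 0 would reach v.\<close>
  have rq: "r dvd q"
  proof (rule ccontr)
    assume nq: "\<not> r dvd q"
    then have cop_rq: "coprime r q" using r(1) by (simp add: prime_imp_coprime)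
    have "R q (v + q)" using out nq th(2) by (simp add: dvd_add_right_iff)
    then have "q.R q (v + q)" using reach_dvd mq by simp
    moreover have "q.R 0 q" "q.R (v + q) v" by (rule q.R_cong, simp add: cong_def)+
    ultimately have "q.R 0 v" using q.R_trans by blast
    then obtain j where j: "[(f ^^ j) 0 = v] (mod q)" by (auto simp: reach_def)
    have "r dvd (f ^^ j) 0" using r(3) by (simp add: aff_funpow_0)
    then have "[(f ^^ j) 0 = v] (mod r)" using th(2) by (simp add: cong_iff_dvd_diff)
    then have "[(f ^^ j) 0 = v] (mod m)" unfolding mq using coprime_cong_mult[OF _ j cop_rq] by simp
    then show False using th(1) by (auto simp: three_def reach_def)
  qed
  have "\<not> m dvd q" using q0 r2 by (auto simp: mq dest: zdvd_imp_le)
  then obtain x where x: "\<not> R x (x + q)" using free by blast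
  have rx: "r dvd x" using x out[of x "x + q"] rq by (auto simp: dvd_add_left_iff)
  have covers: "R x y \<or> R (x + q) y" if "r dvd y" for y
  proof -
    have "\<not> R 1 x" "\<not> R 1 (x + q)" using mult[of x 1] mult[of "x + q" 1] rx rq n1 R_sym by auto
    moreover obtain w where w: "three x (x + q) w" using three_ex2[OF th(1) x] by blast
    ultimately have "R w 1" using three_total[OF w, of 1] R_sym by blast
    then show ?thesis using three_total[OF w, of y] mult[of y w] mult[of w 1] that n1 R_sym by blast
  qed
  have "q.R x y \<longleftrightarrow> r dvd y" for y
  proof
    assume "q.R x y"
    then obtain j where "[(f ^^ j) x = y] (mod q)" by (auto simp: reach_def)
    then have "[(f ^^ j) x = y] (mod r)" using rq cong_dvd_modulus by blast
    then have "r dvd (f ^^ j) x \<longleftrightarrow> r dvd y" by (rule cong_dvd_iff)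
    moreover have "r dvd (f ^^ j) x" using rx r(3) by (subst aff_funpow) (simp add: aff_funpow_0)
    ultimately show "r dvd y" by simp
  next
    assume "r dvd y"
    then have "R x y \<or> R (x + q) y" by (rule covers)
    then have "q.R x y \<or> q.R (x + q) y" using reach_dvd mq by auto
    moreover have "q.R x (x + q)" by (rule q.R_cong) (simp add: cong_def)
    ultimately show "q.R x y" using q.R_trans by blast
  qed
  \<comment> \<open>Modulo \<open>q\<close> the two orbits inside the multiples of \<open>r\<close>
    have merged into one, of length \<open>q / r\<close>. This length divides \<open>L\<close>,
    which is \<open>q / 2\<close>, so \<open>r\<close> is even.\<close>
  then have t: "int (q.per x) * r = q" using q.multiples_orb[OF rq _ rx] r2 by simp
  have "[(f ^^ L) x = x] (mod q)"
    using per_cong[of x] pL[OF rx] mq cong_dvd_modulus[of _ _ m q] by simp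
  then obtain w where "L = q.per x * w" by (auto simp: q.per_dvd_iff)
  then have "int (q.per x) * (2 * int w) = int (q.per x) * r"
    using t \<open>2 * int L = q\<close> by (simp add: algebra_simps)
  then have "r = 2 * int w" using q.per_pos[of x] by simp
  then have r_eq: "r = 2" using r(1) by (metis dvd_triv_left prime_int_numeral_eq primes_dvd_imp_eq two_is_prime_nat)
  then have m4: "m = 4 * int L" using mq \<open>2 * int L = q\<close> by simp
  have odd_b: "odd \<beta>" using cop r(2) r_eq by (metis coprime_common_divisor odd_one)
  have even_c: "even c" using r(3) r_eq by simp
  \<comment> \<open>For even \<open>L\<close>, \<open>four_dvd_power_diff_1\<close> would make the
    iterate of order \<open>L\<close> fix 1, whose orbit has length \<open>2 * L\<close>.\<close>
  have "odd L"
  proof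
    assume "even L"
    have "m dvd (f ^^ L) 2 - 2" "m dvd (f ^^ L) 0"
      using per_cong[of 2] per_cong[of 0] pL[of 2] pL[of 0] by (simp_all add: r_eq cong_iff_dvd_diff)
    moreover have eq: "(f ^^ L) x - x = x * (\<beta> ^ L - 1) + (f ^^ L) 0" for x
      by (subst aff_funpow) (simp add: algebra_simps)
    ultimately have "m dvd 2 * (\<beta> ^ L - 1)" by (simp add: dvd_add_left_iff)
    then have "2 * (2 * int L) dvd 2 * (\<beta> ^ L - 1)" by (simp add: m4)
    then have "2 * int L dvd \<beta> ^ L - 1" by (simp only: dvd_mult_cancel_left) simp
    then have "m dvd \<beta> ^ L - 1" using four_dvd_power_diff_1[OF odd_b \<open>even L\<close> L0] m4 by simp
    then have "m dvd (f ^^ L) 1 - 1" unfolding eq[of 1] mult_1 using \<open>m dvd (f ^^ L) 0\<close> by (rule dvd_add)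
    then have "[(f ^^ L) 1 = 1] (mod m)" by (simp only: cong_iff_dvd_diff)
    then have "per 1 dvd L" by (simp add: per_dvd_iff)
    moreover have "int (per 1) = 2 * int L"
      using three_sum[OF th(1)] pL[of 0] pL[OF th(2)] m4 by simp
    ultimately show False using L0 by (auto dest: dvd_imp_le)
  qed
  have four_m: "4 dvd m" by (simp add: m4)
  interpret four: affine_mod 4 \<beta> c using four_m cop_dvd by unfold_locales auto
  \<comment> \<open>On even numbers the map is x |-> x + c modulo 4, because \<beta> - 1 and x are
    both even.\<close>
  have fx: "[(f ^^ j) x = x + int j * c] (mod 4)" if ev: "even x" for x j
  proof (induction j)
    case (Suc j)
    obtain b where b: "\<beta> = 2 * b + 1" using odd_b oddE by blast
    obtain y where y: "x = 2 * y" using ev by auto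
    obtain c' where c': "c = 2 * c'" using even_c by auto
    have "[f ((f ^^ j) x) = f (x + int j * c)] (mod 4)"
      using four.cong_funpow[of 1] Suc by simp
    moreover have "f (x + int j * c) = x + int (Suc j) * c + 4 * (b * (y + int j * c'))"
      by (simp add: aff_def b y c' algebra_simps)
    then have "[f (x + int j * c) = x + int (Suc j) * c] (mod 4)" by (simp only: cong_iff_dvd_diff) simp
    ultimately show ?case unfolding funpow.simps o_apply by (rule cong_trans)
  qed simp
  have c4: "4 dvd c"
  proof -
    have "[(f ^^ L) 0 = 0] (mod 4)"
      using cong_dvd_modulus[OF per_cong[of 0], of 4] four_m unfolding L_def by blast
    then have "4 dvd int L * c" using fx[of 0 L] by (metis add_0 cong_0_iff cong_sym cong_trans even_zero)
    moreover have "coprime (2 ^ 2) (int L)" using \<open>odd L\<close> by (subst coprime_power_left_iff) simp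
    ultimately show ?thesis by (simp add: coprime_dvd_mult_right_iff)
  qed
  have "R x (x + 4)" for x
  proof (cases "even x")
    case False
    then show ?thesis using out[of x "x + 4"] by (simp add: r_eq)
  next
    case True
    have stay: "[x = y] (mod 4)" if Rxy: "R x y" and ev: "even x" for x y
    proof -
      obtain j where "[(f ^^ j) x = y] (mod 4)"
        using reach_dvd[OF Rxy four_m] by (auto simp: reach_def)
      moreover have "[x + int j * c = x] (mod 4)" using c4 by (simp add: cong_iff_dvd_diff)
      ultimately show ?thesis using fx[OF ev] cong_sym cong_trans by meson
    qed
    show ?thesis
    proof (rule ccontr)
      \<comment> \<open>The orbits of x and x + 4 would be the two orbits of even numbers. Both stay
        in the residue class of x modulo 4, so x + 2 would belong to neither.\<close>
      assume nR: "\<not> R x (x + 4)"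
      then obtain w where w: "three x (x + 4) w" using three_ex2[OF th(1)] by blast
      have e1: "\<not> R x 1" "\<not> R (x + 4) 1" using mult[of x 1] mult[of "x + 4" 1] True n1 r_eq by auto
      then have "R w 1" using three_total[OF w, of 1] by blast
      then have "\<not> R w (x + 2)" using mult[of "x + 2" 1] True n1 r_eq R_sym R_trans by (metis dvd_add_left_iff dvd_refl)
      then have "R x (x + 2) \<or> R (x + 4) (x + 2)" using three_total[OF w, of "x + 2"] by blast
      then have "[x = x + 2] (mod 4) \<or> [x + 4 = x + 2] (mod 4)" using stay True by fastforce
      then show False by (simp add: cong_iff_dvd_diff)
    qed
  qed
  then have "m dvd 4" by (rule free)
  then have m: "m = 4" using m4 L0 by (auto dest: zdvd_imp_le)
  have "[\<beta> ^ j = 1] (mod 4) \<longleftrightarrow> 2 dvd j" for j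
  proof -
    have "\<not> [\<beta> = 1] (mod 4)"
    proof
      assume b: "[\<beta> = 1] (mod 4)"
      obtain j where j: "[(f ^^ j) 1 = 3] (mod 4)" using out[of 1 3] m r_eq by (auto simp: reach_def)
      have "[\<beta> ^ j * 1 = 1] (mod 4)" using cong_pow[OF b, of j] by simp
      then have "[3 = 1] (mod (4::int))"
        using cong_sym[OF j] funpow_cong_power[OF c4, of j 1] by (blast intro: cong_trans)
      then show False by (simp add: cong_def)
    qed
    moreover have "[\<beta>\<^sup>2 = 1] (mod 4)"
    proof -
      obtain b where b: "\<beta> = 2 * b + 1" using odd_b oddE by blast
      have "\<beta>\<^sup>2 - 1 = 4 * (b * (b + 1))" by (simp add: b power2_eq_square algebra_simps)
      then show ?thesis by (simp add: cong_iff_dvd_diff)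
    qed
    then have "[(\<beta>\<^sup>2) ^ k = 1 ^ k] (mod 4)" for k by (rule cong_pow)
    then have sq: "[\<beta> ^ (2 * k) = 1] (mod 4)" for k by (simp add: power_mult)
    then have "[\<beta> * \<beta> ^ (2 * k) = \<beta> * 1] (mod 4)" for k by (intro cong_mult) auto
    then have "[\<beta> ^ (2 * k + 1) = \<beta>] (mod 4)" for k by simp
    ultimately show ?thesis using sq cong_sym cong_trans by (metis evenE oddE)
  qed
  then have "ord 4 \<beta> = 2" by (intro ord_eqI) auto
  then show ?thesis using m c4 r_eq by simp
qed

text \<open>The gcd with \<open>s\<close> is \<open>s\<close> on the orbit of 0, 1 on that of 1 and
  \<open>e\<close> on that of \<open>v\<close>, so \<open>s\<close> has no other positive divisors.
  If \<open>e\<close> is not 1, then s = e^2 and the orbits are the gcd classes; these are invariant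
  under translation by \<open>s\<close>, so m = s. If e = 1, then \<open>s\<close> is prime: either
  translation by \<open>s\<close> preserves all orbits and m = s, or \<beta> is a primitive root
  modulo \<open>s\<close> and \<open>two_orbits_outside_multiples\<close> applies.\<close>

lemma single_orbit_of_multiples:
  assumes s: "1 < s" "s dvd m" "s dvd c"
    and 0: "\<And>x. R 0 x \<longleftrightarrow> s dvd x" and th: "three 0 1 v"
    and min: "\<And>x. per 0 \<le> per x"
    and free: "\<And>t. (\<And>x. R x (x + t)) \<Longrightarrow> m dvd t"
  shows "special m \<beta> c"
proof -
  define e where "e = gcd v s"
  have nv: "\<not> s dvd v" using th 0 by (auto simp: three_def)
  have n1: "\<not> s dvd 1" using s(1) zdvd_imp_le[of s 1] by auto
  have e0: "0 < e" using s(1) by (simp add: e_def)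
  have es: "e dvd s" by (simp add: e_def)
  have ne: "e \<noteq> s" using nv by (metis e_def gcd_dvd1)
  have R0_gcd: "gcd x s = s" if "R 0 x" for x
    using that 0 s(1) by (auto intro: gcd_proj2_if_dvd_int)
  have R1_gcd: "gcd x s = 1" if "R 1 x" for x using R_gcd[OF s(2,3) that] by simp
  have Rv_gcd: "gcd x s = e" if "R v x" for x using R_gcd[OF s(2,3) that] by (simp add: e_def)
  have divs: "e' = 1 \<or> e' = e" if "e' dvd s" "0 < e'" "e' \<noteq> s" for e'
  proof -
    have "gcd e' s = e'" using that by (simp add: gcd_proj1_if_dvd_int)
    moreover have "\<not> R 0 e'" using R0_gcd[of e'] that calculation by auto
    ultimately show ?thesis using three_total[OF th, of e'] R1_gcd[of e'] Rv_gcd[of e'] by auto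
  qed
  show ?thesis
  proof (cases "e = 1")
    case False
    then have e1: "1 < e" using e0 by simp
    obtain k where k: "s = e * k" using es by auto
    have k0: "0 < k" using k e0 s(1) zero_less_mult_pos[of e k] by simp
    have "k \<noteq> 1" using ne k by auto
    moreover have "k \<noteq> s" using k e1 k0 by auto
    ultimately have "k = e" using divs[of k] k k0 by auto
    then have s_eq: "s = e\<^sup>2" using k by (simp add: power2_eq_square)
    have pe: "prime e"
    proof (rule prime_int_iff_divisors[OF e1])
      fix e' assume e': "e' dvd e" "0 < e'" "e' \<noteq> e"
      then have "e' < e" using e0 zdvd_imp_le by force
      moreover have "e \<le> s" using es s(1) by (auto intro: zdvd_imp_le)
      ultimately show "e' = 1" using divs[of e'] e' es by (auto intro: dvd_trans)
    qed
    have same: "R x y" if "gcd x s = gcd y s" for x y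
    proof -
      have "e \<noteq> 1" "e \<noteq> s" "s \<noteq> 1" using e1 ne s(1) by auto
      then have "R k x \<longleftrightarrow> R k y" if "k \<in> {0, 1, v}" for k
        using three_total[OF th, of x] three_total[OF th, of y] R0_gcd[of x] R0_gcd[of y]
          R1_gcd[of x] R1_gcd[of y] Rv_gcd[of x] Rv_gcd[of y] that \<open>gcd x s = gcd y s\<close> by auto
      then show ?thesis using three_total[OF th, of x] R_sym R_trans by blast
    qed
    have "R x (x + s)" for x by (rule same) simp
    then have "m dvd s" by (rule free)
    then have ms: "m = s" using s(1,2) m_pos by (simp add: zdvd_antisym_nonneg)
    have "R 1 x \<longleftrightarrow> \<not> e dvd x" for x
    proof -
      have "R 1 x \<longleftrightarrow> gcd x s = 1" using same[of 1 x] R1_gcd[of x] by auto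
      also have "\<dots> \<longleftrightarrow> \<not> e dvd x"
      proof
        assume "gcd x s = 1"
        then show "\<not> e dvd x" using es e1 gcd_greatest[of e x s] by auto
      next
        assume ex: "\<not> e dvd x"
        then have "gcd x s \<noteq> e" "gcd x s \<noteq> s" using es by (metis gcd_dvd1, metis dvd_trans gcd_dvd1)
        then show "gcd x s = 1" using divs[of "gcd x s"] s(1) by auto
      qed
      finally show ?thesis .
    qed
    then have "orb' 1 = {x \<in> {0..<m}. \<not> e dvd x}" by (simp add: orb_def)
    then have "int (per 1) = m - m div e"
      using card_nonmultiples[OF m_pos, of e] es ms e0 card_orb[of 1] by simp
    moreover have "m div e = e" using e0 by (simp add: ms s_eq power2_eq_square)
    ultimately have per1: "per 1 = nat (e\<^sup>2 - e)" by (simp add: ms s_eq)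
    have "ord m \<beta> = per 1"
    proof (rule ord_eqI[OF m_pos])
      fix j
      have "[(f ^^ j) 1 = \<beta> ^ j * 1] (mod m)" using funpow_cong_power[of m j 1] s(3) ms by blast
      then show "[\<beta> ^ j = 1] (mod m) \<longleftrightarrow> per 1 dvd j" unfolding per_dvd_iff[symmetric]
        by (simp add: cong_def)
    qed
    then show ?thesis unfolding special_def using pe ms s_eq s(3) per1 by auto
  next
    case True
    have ps: "prime s" using divs True by (intro prime_int_iff_divisors s) auto
    have per0: "int (per 0) * s = m" using multiples_orb[OF s(2) _ _ 0] s(1) by simp
    have sum: "int (per 0) + int (per 1) + int (per v) = m" using three_sum[OF th] .
    \<comment> \<open>For s = 2 the two outer orbits together would be only as long as the orbit of
      0, against its minimality.\<close>
    have s2: "s \<noteq> 2"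
    proof
      assume "s = 2"
      then have "per 1 + per v = per 0" using per0 sum by simp
      then show False using min[of 1] per_pos[of v] by simp
    qed
    interpret s: affine_mod s \<beta> c using s cop_dvd by unfold_locales auto
    note ord = s.per_prime[OF ps s(3)]
    show ?thesis
    proof (cases "\<forall>x. R x (x + s)")
      case True
      then have "m dvd s" by (intro free) blast
      then have ms: "m = s" using s(1,2) m_pos by (simp add: zdvd_antisym_nonneg)
      then have "per 0 = 1" using per0 s(1) by simp
      then have "2 * int (ord s \<beta>) = s - 1" using ord[OF n1] ord[OF nv] sum ms by simp
      then have "ord s \<beta> = nat ((s - 1) div 2)" by simp
      then show ?thesis unfolding special_def using ps s2 ms s(3) by auto
    next
      case False
      \<comment> \<open>\<open>x0\<close> and \<open>x0 + s\<close> represent both outer orbits but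
        agree modulo \<open>s\<close>. Hence the nonzero residues modulo \<open>s\<close> form a
        single orbit.\<close>
      then obtain x0 where x0: "\<not> R x0 (x0 + s)" by blast
      have nx0: "\<not> s dvd x0" using x0 0 R_sym R_trans by (metis dvd_add dvd_refl)
      obtain w where w: "three x0 (x0 + s) w" using three_ex2[OF th x0] by blast
      have "\<not> s dvd x0 + s" using nx0 by simp
      then have "\<not> R x0 0" "\<not> R (x0 + s) 0" using nx0 0 R_sym by blast+
      then have "R w 0" using three_total[OF w, of 0] by blast
      have "s.R x0 y \<longleftrightarrow> \<not> s dvd y" for y
      proof
        assume "s.R x0 y"
        then have "gcd x0 s = gcd y s" by (rule s.R_gcd[OF dvd_refl s(3)])
        then show "\<not> s dvd y" using nx0 s(1) by (metis gcd_dvd1 gcd_proj2_if_dvd_int less_imp_le one_dvd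
              abs_of_pos zero_less_one less_trans)
      next
        assume y: "\<not> s dvd y"
        then have "\<not> R w y" using \<open>R w 0\<close> 0 R_sym R_trans by blast
        then have "R x0 y \<or> R (x0 + s) y" using three_total[OF w, of y] by blast
        then have "s.R x0 y \<or> s.R (x0 + s) y" using reach_dvd s(2) by blast
        moreover have "s.R x0 (x0 + s)" by (rule s.R_cong) (simp add: cong_def)
        ultimately show "s.R x0 y" using s.R_trans by blast
      qed
      then have "s.orb' x0 = {y \<in> {0..<s}. \<not> s dvd y}" by (simp add: orb_def)
      also have "\<dots> = {1..<s}"
      proof (intro equalityI subsetI)
        fix y assume y: "y \<in> {y \<in> {0..<s}. \<not> s dvd y}"
        then have "y \<noteq> 0" by auto
        then show "y \<in> {1..<s}" using y by simp
      next
        fix y assume "y \<in> {1..<s}"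
        then show "y \<in> {y \<in> {0..<s}. \<not> s dvd y}" using zdvd_not_zless[of y s] by simp
      qed
      finally have "ord s \<beta> = nat (s - 1)" using ord[OF nx0] s.card_orb[of x0] by simp
      moreover from this have "m = 2 * s \<and> odd c"
        by (intro two_orbits_outside_multiples[OF ps s2 s(2,3) _ 0 th free])
      ultimately show ?thesis unfolding special_def using ps s2 s(3) by auto
    qed
  qed
qed

text \<open>Only a nontrivial translation has no fixed point modulo 3. In that case the return of 0
  after \<open>L\<close> steps makes every power of 3 dividing \<open>3 * L\<close> divide the sum
  of \<open>L\<close> powers of \<beta>, hence \<open>L\<close> by \<open>sum_powers_dvd_3\<close>;
  so \<open>L\<close> would be divisible by all powers of 3.\<close>

lemma equal_periods_fixed_mod_3:
  assumes L: "[(f ^^ L) 0 = 0] (mod m)" "m = 3 * int L" "0 < L"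
  shows "\<exists>x. 3 dvd f x - x"
proof (cases "[\<beta> = 1] (mod 3) \<and> \<not> 3 dvd c")
  case True
  have "3 ^ e dvd L" for e
  proof (induction e)
    case (Suc e)
    then have "int (3 ^ e) dvd int L" by (simp only: int_dvd_int_iff)
    then have "3 ^ Suc e dvd m" using L(2) by simp
    then have "3 ^ Suc e dvd c * (\<Sum>i<L. \<beta> ^ i)"
      using L(1) by (simp only: aff_funpow_0 cong_0_iff) (rule dvd_trans)
    moreover have "coprime 3 c" using True by (intro prime_imp_coprime) auto
    then have "coprime (3 ^ Suc e) c" by simp
    ultimately have "3 ^ Suc e dvd (\<Sum>i<L. \<beta> ^ i)" by (simp only: coprime_dvd_mult_right_iff)
    then show ?case using sum_powers_dvd_3 True by blast
  qed simp
  then have "3 ^ L \<le> L" using L(3) by (intro dvd_imp_le) auto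
  moreover have "L < 3 ^ L" by (rule power_gt_expt) simp
  ultimately show ?thesis by simp
next
  case False
  show ?thesis
  proof (cases "3 dvd c")
    case True
    then show ?thesis by (intro exI[of _ 0]) (simp add: aff_def)
  next
    case nc: False
    then have "\<not> 3 dvd \<beta> - 1" using False by (simp add: cong_iff_dvd_diff)
    then have "coprime (\<beta> - 1) 3" using prime_imp_coprime[of 3 "\<beta> - 1"] coprime_commute by auto
    then obtain x where "[(\<beta> - 1) * x = - c] (mod 3)"
      using cong_solve_dvd_int[of "\<beta> - 1" 3 "- c"] by (auto simp: coprime_iff_gcd_eq_1)
    then have "3 dvd f x - x" by (simp add: cong_iff_dvd_diff aff_def algebra_simps)
    then show ?thesis ..
  qed
qed

text \<open>Modulo 3 the map is multiplication by \<beta>. If \<beta> is 1, the orbits are the three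
  residue classes, so translation by 3 preserves them and m = 3. If \<beta> is 2, the orbit of 0
  lies in the multiples of 3 and by its length exhausts them, and
  \<open>two_orbits_outside_multiples\<close> applies with r = 3.\<close>

lemma equal_periods_dvd_3:
  assumes th: "three 0 y z" and per: "\<And>x. per x = L" and c: "3 dvd c"
    and free: "\<And>t. (\<And>x. R x (x + t)) \<Longrightarrow> m dvd t"
  shows "special m \<beta> c"
proof -
  have mL: "m = 3 * int L" using three_sum[OF th] per by simp
  then have "3 dvd m" by simp
  interpret t: affine_mod 3 \<beta> c using \<open>3 dvd m\<close> cop_dvd by unfold_locales auto
  have p3: "prime (3::int)" by simp
  show ?thesis
  proof (cases "[\<beta> = 1] (mod 3)")
    case True
    have stay: "[x = y] (mod 3)" if Rxy: "R x y" for x y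
    proof -
      obtain j where j: "[(f ^^ j) x = y] (mod 3)" using reach_dvd[OF Rxy \<open>3 dvd m\<close>] by (auto simp: reach_def)
      have "[\<beta> ^ j * x = 1 * x] (mod 3)" using cong_pow[OF True, of j] by (intro cong_mult) auto
      then have "[(f ^^ j) x = x] (mod 3)" using funpow_cong_power[OF c, of j x] by (simp add: cong_def)
      then show ?thesis using j by (simp add: cong_def)
    qed
    have "\<not> R 0 1" "\<not> R 0 2" "\<not> R 1 2"
      using stay[of 0 1] stay[of 0 2] stay[of 1 2] by (auto simp: cong_def)
    then have th': "three 0 1 2" by (rule threeI) (use per[of 0] per[of 1] per[of 2] mL in linarith)
    have "R x (x + 3)" for x
    proof -
      obtain i where i: "i \<in> {0, 1, 2}" "R i x" using three_total[OF th', of x] by auto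
      obtain k where k: "k \<in> {0, 1, 2}" "R k (x + 3)" using three_total[OF th', of "x + 3"] by auto
      have "i mod 3 = k mod 3" using stay[OF i(2)] stay[OF k(2)] by (simp add: cong_def)
      then have "i = k" using i(1) k(1) by auto
      then show ?thesis using i(2) k(2) R_sym R_trans by blast
    qed
    then have "m dvd 3" by (rule free)
    then have m: "m = 3" using \<open>3 dvd m\<close> m_pos by (simp add: zdvd_antisym_nonneg)
    have "ord 3 \<beta> = 1"
      using cong_pow[OF True] by (intro ord_eqI) auto
    then show ?thesis unfolding special_def using m c by (intro exI[of _ 3]) simp
  next
    case False
    have "\<not> 3 dvd \<beta>" using t.cop by (metis coprime_common_divisor dvd_refl not_prime_unit p3)
    then have "[\<beta> = 2] (mod 3)" using False by (simp add: cong_def) presburger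
    then have b2: "[\<beta>\<^sup>2 = 1] (mod 3)" using cong_pow[of \<beta> 2 3 2] by (simp add: cong_def)
    then have "ord 3 \<beta> dvd 2" using ord_dvd_int[of 3 \<beta> 2] by simp
    moreover have "ord 3 \<beta> \<noteq> 1" using ord_dvd_int[of 3 \<beta> 1] False by auto
    ultimately have ord: "ord 3 \<beta> = 2"
      by (metis prime_nat_iff two_is_prime_nat)
    have sub: "orb' 0 \<subseteq> {x \<in> {0..<m}. 3 dvd x}"
    proof
      fix x assume x: "x \<in> orb' 0"
      then have "t.R 0 x" using reach_dvd \<open>3 dvd m\<close> by (auto simp: orb_def)
      then obtain j where "[(f ^^ j) 0 = x] (mod 3)" by (auto simp: reach_def)
      then have "3 dvd x" using c by (metis aff_funpow_0 cong_dvd_iff dvd_mult2)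
      then show "x \<in> {x \<in> {0..<m}. 3 dvd x}" using x by (auto simp: orb_def)
    qed
    moreover have "card (orb' 0) = card {x \<in> {0..<m}. 3 dvd x}"
      using card_multiples[OF m_pos \<open>3 dvd m\<close>] card_orb[of 0] per mL by simp
    ultimately have "orb' 0 = {x \<in> {0..<m}. 3 dvd x}"
      by (intro card_subset_eq) (rule finite_subset[of _ "{0..<m}"], auto)
    then have 0: "R 0 x \<longleftrightarrow> 3 dvd x" for x
      using mod_in_orb[of x 0] m_pos dvd_mod_iff[OF \<open>3 dvd m\<close>, of x] by auto
    have "m = 2 * 3 \<and> odd c"
      using two_orbits_outside_multiples[OF p3 _ \<open>3 dvd m\<close> c _ 0 th free] ord by simp
    then show ?thesis unfolding special_def using ord c by (intro exI[of _ 3]) simp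
  qed
qed

text \<open>For s = 1 all periods agree and the base point is moved to a point fixed modulo 3. For
  larger \<open>s\<close>, 0 and 1 represent two orbits, and the cases differ by whether the third
  one lies inside or outside the multiples of \<open>s\<close>.\<close>

lemma three_orbits_special_min:
  assumes th: "three x y z" and min: "\<And>x. per 0 \<le> per x"
    and free: "\<And>t. (\<And>x. R x (x + t)) \<Longrightarrow> m dvd t"
  shows "\<exists>s. special m \<beta> (f s - s)"
proof -
  have here: "\<exists>s. special m \<beta> (f s - s)" if "special m \<beta> c"
    using that by (intro exI[of _ 0]) (simp add: aff_def)
  obtain s where s: "0 < s" "s dvd m" "s dvd c" and F: "\<And>x. per x = per 0 \<longleftrightarrow> s dvd x"
    using min_period_multiples[OF min] by blast
  have mult: "s dvd y" if "s dvd x" "R x y" for x y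
    using that per_R F by metis
  show ?thesis
  proof (cases "s = 1")
    case True
    then have per: "per x = per 0" for x using F by simp
    have "m = 3 * int (per 0)" using three_sum[OF th] per[of x] per[of y] per[of z] by simp
    then obtain u where u: "3 dvd f u - u"
      using equal_periods_fixed_mod_3[OF per_cong _ per_pos] by blast
    interpret N: affine_mod m \<beta> "f u - u" using m_pos cop by unfold_locales
    have "N.three (x - u) (y - u) (z - u)" using th by (simp add: three_shift)
    moreover have "\<exists>w. \<not> N.R 0 w"
      using calculation N.R_sym N.R_trans unfolding N.three_def by blast
    ultimately obtain w v where "N.three 0 w v" using N.three_ex2 by blast
    moreover have "N.per x = per 0" for x using per_shift[of u x] per[of "x + u"] by simp
    moreover have N_free: "m dvd t" if "\<And>x. N.R x (x + t)" for t
    proof (rule free)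
      fix x show "R x (x + t)" using that[of "x - u"] by (simp add: reach_shift algebra_simps)
    qed
    ultimately have "special m \<beta> (f u - u)" using N.equal_periods_dvd_3[OF _ _ u N_free] by blast
    then show ?thesis ..
  next
    case False
    then have s1: "1 < s" using s(1) by simp
    then have n1: "\<not> s dvd 1" using zdvd_imp_le[of s 1] by auto
    have "\<not> R 0 1" using mult[of 0 1] n1 by auto
    then obtain v where v: "three 0 1 v" using three_ex2[OF th] by blast
    show ?thesis
    proof (cases "s dvd v")
      case False
      have "R 0 x \<longleftrightarrow> s dvd x" for x
        using three_total[OF v, of x] mult[of 0 x] mult[of x 1] mult[of x v] n1 False R_sym by auto
      then show ?thesis using single_orbit_of_multiples[OF s1 s(2,3) _ v min free] here by blast
    next
      case True
      have out: "R 1 x" if "\<not> s dvd x" for x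
        using three_total[OF v, of x] mult[of 0 x] mult[of v x] that True by auto
      \<comment> \<open>A proper divisor of \<open>s\<close> is not a multiple of \<open>s\<close>,
        so it shares the orbit of 1 and therefore its gcd with \<open>s\<close>.\<close>
      have "e = 1" if "e dvd s" "0 < e" "e \<noteq> s" for e
      proof -
        have "\<not> s dvd e" using that s(1) zdvd_antisym_nonneg[of e s] by linarith
        then have "gcd 1 s = gcd e s" using R_gcd[OF s(2,3)] out by blast
        then show ?thesis using that by (simp add: gcd_proj1_if_dvd_int)
      qed
      then have ps: "prime s" using s1 by (intro prime_int_iff_divisors)
      have v': "three 0 v 1" using v three_perm by blast
      have out': "R x y" if "\<not> s dvd x" "\<not> s dvd y" for x y
        using out that R_sym R_trans by blast
      have "s = 2 \<and> m = 4 \<and> 4 dvd c \<and> ord 4 \<beta> = 2"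
        by (rule two_orbits_of_multiples[OF ps s(2,3) v' True]) (use out' mult F free in blast)+
      then have "special m \<beta> c" unfolding special_def by (intro exI[of _ 2]) simp
      then show ?thesis by (rule here)
    qed
  qed
qed

lemma three_orbits_special:
  assumes th: "three x y z" and free: "\<And>t. (\<And>x. R x (x + t)) \<Longrightarrow> m dvd t"
  shows "\<exists>s. special m \<beta> (f s - s)"
proof -
  obtain u where u: "\<And>x. per u \<le> per x"
    using ex_has_least_nat[of "\<lambda>_. True" 0 per] by auto
  interpret N: affine_mod m \<beta> "f u - u" using m_pos cop by unfold_locales
  have "N.three (x - u) (y - u) (z - u)" using th by (simp add: three_shift)
  moreover have "N.per 0 \<le> N.per x" for x by (simp add: per_shift u)
  moreover have "m dvd t" if "\<And>x. N.R x (x + t)" for t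
  proof (rule free)
    fix x show "R x (x + t)" using that[of "x - u"] by (simp add: reach_shift algebra_simps)
  qed
  ultimately obtain s where "special m \<beta> (N.f s - s)" using N.three_orbits_special_min by blast
  moreover have "N.f s - s = f (s + u) - (s + u)" by (simp add: aff_def algebra_simps)
  ultimately show ?thesis by metis
qed

subsection \<open>The affine maps of the four families\<close>

text \<open>All nonzero residues have period (m - 1) / 2, so the orbit of 1 misses one of them; by
  counting there is no fourth orbit.\<close>

lemma three_prime:
  assumes m: "prime m" "m \<noteq> 2" "m dvd c" and ord: "ord m \<beta> = nat ((m - 1) div 2)"
  shows "\<exists>z. three 0 1 z \<and> per 0 = 1 \<and> per 1 = nat ((m - 1) div 2) \<and> per z = nat ((m - 1) div 2)"
proof -
  have m2: "2 < m" using m(1,2) prime_ge_2_int[of m] by simp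
  have "odd m" using m(1) m2 prime_odd_int by blast
  then obtain h where h: "m = 2 * h + 1" by (rule oddE)
  have n1: "\<not> m dvd 1" using m2 by auto
  have "orb' 1 \<noteq> {x \<in> {0..<m}. \<not> m dvd x}"
  proof
    assume "orb' 1 = {x \<in> {0..<m}. \<not> m dvd x}"
    then have "int (per 1) = m - m div m" using card_nonmultiples[OF m_pos dvd_refl m_pos] card_orb[of 1] by simp
    then show False using per_prime[OF m(1,3) n1] ord m2 h by simp
  qed
  moreover have "orb' 1 \<subseteq> {x \<in> {0..<m}. \<not> m dvd x}"
    using R_dvd[OF dvd_refl m(3), of 1] n1 unfolding orb_def by blast
  ultimately obtain z where z: "\<not> m dvd z" "\<not> R 1 z" by (auto simp: orb_def)
  have "\<not> R 0 1" "\<not> R 0 z" using R_dvd[OF dvd_refl m(3), of 0 1] R_dvd[OF dvd_refl m(3), of 0 z] n1 z(1) by auto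
  moreover have per: "per 1 = nat ((m - 1) div 2)" "per z = nat ((m - 1) div 2)"
    using per_prime[OF m(1,3)] n1 z(1) ord by auto
  ultimately have "three 0 1 z" using z(2) per_0[OF m(3)] h m2 by (intro threeI) auto
  then show ?thesis using per per_0[OF m(3)] by blast
qed

text \<open>\<beta> is a primitive root modulo r^2, so the units form the orbit of 1. Multiplying
  this orbit by \<open>r\<close> shows that the nonzero multiples of \<open>r\<close> form the orbit
  of \<open>r\<close>.\<close>

lemma three_prime_square:
  assumes r: "prime r" "m = r\<^sup>2" "m dvd c" and ord: "ord m \<beta> = nat (r\<^sup>2 - r)"
  shows "three 0 r 1 \<and> per 0 = 1 \<and> per r = nat (r - 1) \<and> per 1 = nat (r\<^sup>2 - r)"
proof -
  have r2: "2 \<le> r" using r(1) prime_ge_2_int by blast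
  have rm: "r dvd m" using r(2) by (simp add: power2_eq_square)
  have rc: "r dvd c" using rm r(3) dvd_trans by blast
  have n1: "\<not> r dvd 1" using r2 by auto
  have mr: "m div r = r" using r(2) r2 by (simp add: power2_eq_square)
  have nr: "\<not> m dvd r" using r2 r(2) zdvd_imp_le[of m r] by (auto simp: power2_eq_square mult_le_cancel_left1)
  have "[(f ^^ j) 1 = 1] (mod m) \<longleftrightarrow> ord m \<beta> dvd j" for j
    using funpow_cong_power[OF r(3), of j 1] ord_dvd_int[OF m_pos, of \<beta> j] by (simp add: cong_def)
  then have per1: "per 1 = nat (r\<^sup>2 - r)" using ord by (metis dvd_antisym dvd_refl per_dvd_iff)
  have "orb' 1 = {x \<in> {0..<m}. \<not> r dvd x}"
  proof (rule card_subset_eq)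
    show "orb' 1 \<subseteq> {x \<in> {0..<m}. \<not> r dvd x}" using R_dvd[OF rm rc, of 1] n1 unfolding orb_def by blast
    show "card (orb' 1) = card {x \<in> {0..<m}. \<not> r dvd x}"
      using card_nonmultiples[OF m_pos rm] card_orb[of 1] per1 r2 mr r(2) by simp
  qed (rule finite_subset[of _ "{0..<m}"], auto)
  then have R1: "R 1 x" if "\<not> r dvd x" for x
    using that mod_in_orb[of x 1] m_pos rm by (auto simp: dvd_mod_iff)
  have Rr: "R r (r * k)" if nk: "\<not> r dvd k" for k
  proof -
    obtain j where "[(f ^^ j) 1 = k] (mod m)" using R1[OF nk] by (auto simp: reach_def)
    then have "[\<beta> ^ j = k] (mod m)" using funpow_cong_power[OF r(3), of j 1] by (simp add: cong_def)
    then have "[\<beta> ^ j * r = k * r] (mod m)" by (rule cong_scalar_right)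
    then have "[(f ^^ j) r = r * k] (mod m)"
      using funpow_cong_power[OF r(3), of j r] by (simp add: cong_def mult.commute)
    then show ?thesis by (auto simp: reach_def)
  qed
  have "orb' r = {x \<in> {0..<m}. r dvd x} - {0}"
  proof (intro equalityI subsetI)
    fix x assume x: "x \<in> orb' r"
    then have "r dvd x" "\<not> m dvd x" using R_dvd[OF rm rc, of r x] R_dvd[OF dvd_refl r(3), of r x] nr
      unfolding orb_def by auto
    then show "x \<in> {x \<in> {0..<m}. r dvd x} - {0}" using x by (auto simp: orb_def)
  next
    fix x assume x: "x \<in> {x \<in> {0..<m}. r dvd x} - {0}"
    then obtain k where k: "x = r * k" by auto
    have "\<not> r dvd k"
    proof
      assume "r dvd k"
      then have "m dvd x" by (auto simp: k r(2) power2_eq_square)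
      then show False using x zdvd_not_zless[of x m] by auto
    qed
    then show "x \<in> orb' r" using Rr k x by (auto simp: orb_def)
  qed
  then have perr: "per r = nat (r - 1)"
    using card_multiples[OF m_pos rm] card_orb[of r] r2 mr m_pos by (simp add: card_Diff_singleton)
  have "\<not> R 0 r" "\<not> R 0 1" "\<not> R r 1"
    using R_dvd[OF rm rc, of 0 1] R_dvd[OF dvd_refl r(3), of 0 r] R_dvd[OF rm rc, of r 1] n1 nr by auto
  moreover have "0 \<le> r\<^sup>2 - r" using r2 by (simp add: power2_eq_square)
  ultimately have "three 0 r 1" using per1 perr per_0[OF r(3)] r2 r(2) by (intro threeI) auto
  then show ?thesis using per1 perr per_0[OF r(3)] by blast
qed

text \<open>Modulo \<open>r\<close> the map is multiplication by a primitive root; modulo 2 every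
  step changes parity. As \<open>r - 1\<close> is even, a non-multiple of \<open>r\<close> returns
  modulo \<open>r\<close> only with its parity restored, so 1 never reaches 1 + r, which differs
  from it in parity alone.\<close>

lemma three_double_prime:
  assumes r: "prime r" "r \<noteq> 2" "m = 2 * r" "r dvd c" "odd c" and ord: "ord r \<beta> = nat (r - 1)"
  shows "three 0 1 (1 + r) \<and> per 0 = 2 \<and> per 1 = nat (r - 1) \<and> per (1 + r) = nat (r - 1)"
proof -
  have r2: "2 < r" using r(1,2) prime_ge_2_int[of r] by simp
  have odd_r: "odd r" using r(1) r2 prime_odd_int by blast
  have odd_b: "odd \<beta>" using cop r(3) by (metis coprime_common_divisor dvd_triv_left odd_one)
  have cop2: "coprime 2 r" using odd_r by simp
  interpret r: affine_mod r \<beta> c using r2 r(3) cop_dvd by unfold_locales auto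
  have cong_m: "[x = y] (mod m) \<longleftrightarrow> [x = y] (mod r) \<and> (even x \<longleftrightarrow> even y)" for x y
  proof -
    have "even x \<longleftrightarrow> even y" if "[x = y] (mod 2)" using that by (rule cong_dvd_iff)
    moreover have "[x = y] (mod 2)" if "even x \<longleftrightarrow> even y" using that by (simp add: cong_iff_dvd_diff)
    ultimately show ?thesis unfolding r(3)
      using coprime_cong_mult[OF _ _ cop2, of x y] cong_dvd_modulus[of x y "2 * r" 2]
        cong_dvd_modulus[of x y "2 * r" r] dvd_triv_left dvd_triv_right by blast
  qed
  note par = funpow_parity[OF odd_b r(5)]
  have n1: "\<not> r dvd 1" "\<not> r dvd 1 + r" using r2 by (auto simp: dvd_add_left_iff)
  have per: "per x = nat (r - 1)" if nx: "\<not> r dvd x" for x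
  proof -
    have "even (nat (r - 1))" using odd_r r2 by (simp add: even_nat_iff)
    then have "[(f ^^ j) x = x] (mod m) \<longleftrightarrow> nat (r - 1) dvd j" for j
      using r.funpow_eq_self_iff[OF r(1,4) nx, of j] ord par[of j x] dvd_trans[of 2 _ j] by (auto simp: cong_m)
    then show ?thesis by (metis dvd_antisym dvd_refl per_dvd_iff)
  qed
  have "[(f ^^ j) 0 = 0] (mod m) \<longleftrightarrow> 2 dvd j" for j
    using r.funpow_cong_power[OF r(4), of j 0] par[of j 0] by (simp add: cong_m)
  then have per0: "per 0 = 2" by (metis dvd_antisym dvd_refl per_dvd_iff)
  have rm: "r dvd m" using r(3) by simp
  have "\<not> R 1 (1 + r)"
  proof
    assume "R 1 (1 + r)"
    then obtain j where j: "[(f ^^ j) 1 = 1 + r] (mod m)" by (auto simp: reach_def)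
    then have "[(f ^^ j) 1 = 1 + r] (mod r)" using cong_m by blast
    then have "[(f ^^ j) 1 = 1] (mod r)" by (simp add: cong_def)
    then have "nat (r - 1) dvd j" using r.funpow_eq_self_iff[OF r(1,4) n1(1)] ord by simp
    moreover have "even (nat (r - 1))" using odd_r r2 by (simp add: even_nat_iff)
    ultimately have "even j" using dvd_trans by blast
    then show False using j par[of j 1] odd_r by (simp add: cong_m)
  qed
  moreover have "\<not> R 0 1" "\<not> R 0 (1 + r)" using R_dvd[OF rm r(4), of 0 1] R_dvd[OF rm r(4), of 0 "1 + r"] n1 by auto
  ultimately have "three 0 1 (1 + r)" using per[OF n1(1)] per[OF n1(2)] per0 r2 r(3) by (intro threeI) auto
  then show ?thesis using per[OF n1(1)] per[OF n1(2)] per0 by blast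
qed

text \<open>A coarser partition with the same number of classes is the same partition. This turns
  inclusion of groups with three orbits into equality of their orbits.\<close>

lemma three_reach_eq:
  assumes "three x y z" "affine_mod.three m \<beta>' c' u v w" "coprime \<beta>' m"
    and sub: "\<And>s t. R s t \<Longrightarrow> reach m \<beta>' c' s t" and "reach m \<beta>' c' s t"
  shows "R s t"
proof -
  interpret N: affine_mod m \<beta>' c' using assms(3) m_pos by unfold_locales
  have cover: "N.R x t \<or> N.R y t \<or> N.R z t" for t
    using three_total[OF assms(1), of t] sub by blast
  have no_two: False if "\<And>t. N.R p t \<or> N.R q t" for p q
  proof -
    have "\<not> (N.R k i \<and> N.R k j)" if "\<not> N.R i j" for i j k using that N.R_sym N.R_trans by blast
    moreover have "\<not> N.R u v" "\<not> N.R u w" "\<not> N.R v w" using assms(2) by (auto simp: N.three_def)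
    ultimately show False using that[of u] that[of v] that[of w] by blast
  qed
  have "\<not> N.R x y"
  proof
    assume "N.R x y"
    then have "N.R x t \<or> N.R z t" for t using cover[of t] N.R_trans by blast
    then show False by (rule no_two)
  qed
  moreover have "\<not> N.R x z" "\<not> N.R y z"
  proof -
    have "False" if k: "k \<in> {x, y}" "N.R k z" for k
    proof -
      have "N.R x t \<or> N.R y t" for t using cover[of t] k N.R_trans by blast
      then show False by (rule no_two)
    qed
    then show "\<not> N.R x z" "\<not> N.R y z" by blast+
  qed
  ultimately have eq: "k = l" if "k \<in> {x, y, z}" "l \<in> {x, y, z}" "N.R k l" for k l
    using that N.R_sym by blast
  obtain k where k: "k \<in> {x, y, z}" "R k s" using three_total[OF assms(1), of s] by blast
  obtain l where l: "l \<in> {x, y, z}" "R l t" using three_total[OF assms(1), of t] by blast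
  have "N.R k t" using sub[OF k(2)] assms(5) by (rule N.R_trans)
  then have "N.R k l" using N.R_sym[OF sub[OF l(2)]] by (rule N.R_trans)
  then have "k = l" by (rule eq[OF k(1) l(1)])
  then show ?thesis using R_trans[OF R_sym[OF k(2)]] l(2) by simp
qed

end

subsection \<open>Permutation groups\<close>

lemma mult_perm_group [simp]: "p \<otimes>\<^bsub>perm_group X\<^esub> q = q \<circ> p"
  by (simp add: perm_group_def)

lemma carrier_perm_group: "p \<in> carrier (perm_group X) \<longleftrightarrow> p permutes X"
  by (simp add: perm_group_def)

lemma one_perm_group: "\<one>\<^bsub>perm_group X\<^esub> = id"
  by (simp add: perm_group_def)

lemma subgroup_perm_groupI:
  assumes "finite X" "S \<subseteq> carrier (perm_group X)" "S \<noteq> {}"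
    and closed: "\<And>p q. p \<in> S \<Longrightarrow> q \<in> S \<Longrightarrow> p \<otimes>\<^bsub>perm_group X\<^esub> q \<in> S"
  shows "subgroup S (perm_group X)"
proof -
  interpret group "perm_group X" by (rule group_perm_group)
  have fin: "finite (carrier (perm_group X))"
    using finite_permutations[OF assms(1)] by (simp add: perm_group_def)
  show ?thesis
  proof (rule subgroupI[OF assms(2,3) _ closed])
    fix p assume p: "p \<in> S"
    then have pc: "p \<in> carrier (perm_group X)" using assms(2) by blast
    \<comment> \<open>Only positive powers are available, since \<open>S\<close> is not yet known to
      contain the identity. The exponent \<open>2 * ord p - 1\<close> used for the inverse is
      positive even when \<open>ord p\<close> is 1.\<close>
    have "p [^]\<^bsub>perm_group X\<^esub> Suc k \<in> S" for k :: nat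
    proof (induction k)
      case 0
      show ?case using p by (simp add: one_perm_group)
    next
      case (Suc k)
      show ?case using closed[OF Suc p] by (simp only: nat_pow_Suc)
    qed
    moreover have "0 < ord p" using ord_ge_1[OF fin pc] by simp
    then have "2 * ord p - 1 = Suc (2 * ord p - 2)" by simp
    ultimately have "p [^]\<^bsub>perm_group X\<^esub> (2 * ord p - 1) \<in> S" by metis
    moreover have "p [^]\<^bsub>perm_group X\<^esub> (2 * ord p - 1) \<otimes>\<^bsub>perm_group X\<^esub> p = \<one>\<^bsub>perm_group X\<^esub>"
    proof -
      have "Suc (2 * ord p - 1) = 2 * ord p" using \<open>0 < ord p\<close> by simp
      then have "p [^]\<^bsub>perm_group X\<^esub> (2 * ord p - 1) \<otimes>\<^bsub>perm_group X\<^esub> p = p [^]\<^bsub>perm_group X\<^esub> (2 * ord p)"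
        by (metis nat_pow_Suc)
      then show ?thesis using pc by (simp add: pow_eq_id del: mult_perm_group)
    qed
    then have "inv\<^bsub>perm_group X\<^esub> p = p [^]\<^bsub>perm_group X\<^esub> (2 * ord p - 1)"
      using pc by (intro inv_equality) auto
    ultimately show "inv\<^bsub>perm_group X\<^esub> p \<in> S" by simp
  qed
qed

lemma point_orbits_image: "point_orbits X H = (\<lambda>x. {h x | h. h \<in> H}) ` X"
  by (auto simp: point_orbits_def orbits_def orbit_def)

lemma orbit_lengths_conjugate:
  assumes h: "h \<in> carrier (perm_group X)" and H: "H \<subseteq> carrier (perm_group X)"
    and K: "K = (\<lambda>x. inv\<^bsub>perm_group X\<^esub> h \<otimes>\<^bsub>perm_group X\<^esub> x \<otimes>\<^bsub>perm_group X\<^esub> h) ` H"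
  shows "orbit_lengths X K = orbit_lengths X H"
proof -
  interpret group "perm_group X" by (rule group_perm_group)
  have hp: "h permutes X" using h by (simp add: carrier_perm_group)
  have inj: "inj h" using hp by (rule permutes_inj)
  have "h \<otimes>\<^bsub>perm_group X\<^esub> inv\<^bsub>perm_group X\<^esub> h = id" using r_inv[OF h] by (simp only: one_perm_group)
  then have hinv: "(inv\<^bsub>perm_group X\<^esub> h) (h y) = y" for y by (simp add: fun_eq_iff)
  have "{g (h y) | g. g \<in> K} = h ` {g y | g. g \<in> H}" for y
  proof -
    have "{g (h y) | g. g \<in> K} = (\<lambda>g. g (h y)) ` K" by blast
    also have "\<dots> = (\<lambda>g. h (g y)) ` H" unfolding K image_image by (simp add: hinv)
    also have "\<dots> = h ` {g y | g. g \<in> H}" by blast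
    finally show ?thesis .
  qed
  moreover have "point_orbits X K = (\<lambda>x. {g x | g. g \<in> K}) ` (h ` X)"
    unfolding permutes_image[OF hp] by (rule point_orbits_image)
  ultimately have "point_orbits X K = image h ` point_orbits X H"
    unfolding point_orbits_image[of X H] image_image by simp
  moreover have "inj_on (image h) (point_orbits X H)"
    using inj by (simp add: inj_on_def inj_image_eq_iff)
  ultimately have "orbit_lengths X K = image_mset (\<lambda>\<Delta>. card (h ` \<Delta>)) (mset_set (point_orbits X H))"
    unfolding orbit_lengths_def by (simp add: image_mset_mset_set[symmetric] multiset.map_comp o_def)
  also have "\<dots> = orbit_lengths X H"
    unfolding orbit_lengths_def using inj by (simp add: card_image inj_on_subset)
  finally show ?thesis .
qed

subsection \<open>Coordinates modulo \<open>n\<close>\<close>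

locale cyclic_regular_normal =
  fixes X :: "'x set" and x\<^sub>0 :: 'x and G W :: "('x \<Rightarrow> 'x) set"
    and a w :: "'x \<Rightarrow> 'x" and n :: nat and \<alpha> :: int
  assumes finX: "finite X" and x0: "x\<^sub>0 \<in> X"
    and G: "subgroup G (perm_group X)" and G_gen: "G = generate (perm_group X) {a, w}"
    and reg: "regular_on X W" and W_gen: "W = generate (perm_group X) {w}" and card_W: "card W = n"
    and a_fix: "a x\<^sub>0 = x\<^sub>0"
    and conj_w: "inv\<^bsub>perm_group X\<^esub> a \<otimes>\<^bsub>perm_group X\<^esub> w \<otimes>\<^bsub>perm_group X\<^esub> a = w [^]\<^bsub>perm_group X\<^esub> \<alpha>"
begin

abbreviation P where "P \<equiv> perm_group X"

sublocale P: group P by (rule group_perm_group)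

lemma a_carrier: "a \<in> carrier P" and w_carrier: "w \<in> carrier P"
proof -
  have "{a, w} \<subseteq> G" unfolding G_gen by (blast intro: generate.incl)
  then show "a \<in> carrier P" "w \<in> carrier P" using subgroup.subset[OF G] by auto
qed

lemma finite_carrier: "finite (carrier P)"
  using finite_permutations[OF finX] by (simp add: perm_group_def)

lemma carrier_inj: "p \<in> carrier P \<Longrightarrow> inj p"
  unfolding carrier_perm_group by (rule permutes_inj)

lemma carrier_image: "p \<in> carrier P \<Longrightarrow> x \<in> X \<Longrightarrow> p x \<in> X"
  by (simp add: carrier_perm_group permutes_in_image)

definition pt :: "int \<Rightarrow> 'x" where "pt k = (w [^]\<^bsub>P\<^esub> k) x\<^sub>0"

lemma pow_w_carrier: "w [^]\<^bsub>P\<^esub> (k :: int) \<in> carrier P"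
  using w_carrier by (rule P.int_pow_closed)

lemma pt_in: "pt k \<in> X"
  unfolding pt_def by (rule carrier_image[OF pow_w_carrier x0])

lemma pow_w_pt: "(w [^]\<^bsub>P\<^esub> l) (pt k) = pt (k + l)"
  using P.int_pow_mult[OF w_carrier, of k l] by (simp add: pt_def)

lemma W_pow: "W = {w [^]\<^bsub>P\<^esub> (k :: int) | k. True}"
  unfolding W_gen using P.generate_pow[OF w_carrier] by auto

lemma n_pos: "0 < n"
proof -
  have "W \<subseteq> carrier P" using pow_w_carrier by (auto simp: W_pow)
  then have "finite W" using finite_carrier finite_subset by blast
  moreover have "w [^]\<^bsub>P\<^esub> (0::int) \<in> W" unfolding W_pow by blast
  ultimately show ?thesis using card_W card_gt_0_iff by blast
qed

lemma ord_w: "P.ord w = n"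
  using P.generate_pow_card[OF w_carrier] card_W W_gen by simp

lemma pt_eq_iff: "pt k = pt l \<longleftrightarrow> [k = l] (mod int n)"
proof -
  have "pt k = pt l \<longleftrightarrow> w [^]\<^bsub>P\<^esub> k = w [^]\<^bsub>P\<^esub> l"
  proof
    assume eq: "pt k = pt l"
    have "w [^]\<^bsub>P\<^esub> k \<in> W" "w [^]\<^bsub>P\<^esub> l \<in> W" unfolding W_pow by blast+
    then show "w [^]\<^bsub>P\<^esub> k = w [^]\<^bsub>P\<^esub> l"
      using reg x0 pt_in[of k] eq unfolding regular_on_def pt_def by metis
  qed (simp add: pt_def)
  also have "\<dots> \<longleftrightarrow> [l = k] (mod int n)"
    unfolding P.int_pow_eq[OF w_carrier] ord_w cong_iff_dvd_diff ..
  finally show ?thesis by (simp add: cong_sym_eq)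
qed

lemma pt_surj: assumes "x \<in> X" obtains k where "x = pt k"
proof -
  obtain u where "u \<in> W" "u x\<^sub>0 = x" using reg x0 assms unfolding regular_on_def by metis
  then show ?thesis using that by (auto simp: W_pow pt_def)
qed

lemma perm_eqI:
  assumes "p \<in> carrier P" "q \<in> carrier P" "\<And>k. p (pt k) = q (pt k)"
  shows "p = q"
proof
  fix x show "p x = q x"
  proof (cases "x \<in> X")
    case True then show ?thesis using pt_surj assms(3) by metis
  next
    case False then show ?thesis using assms(1,2) by (simp add: carrier_perm_group permutes_not_in)
  qed
qed

lemma a_pt: "a (pt k) = pt (\<alpha> * k)"
proof -
  have "a \<otimes>\<^bsub>P\<^esub> w [^]\<^bsub>P\<^esub> \<alpha> = w \<otimes>\<^bsub>P\<^esub> a"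
    unfolding conj_w[symmetric] using a_carrier w_carrier
    by (simp only: P.m_assoc[symmetric] P.r_inv P.l_one P.m_closed P.inv_closed)
  then have "w [^]\<^bsub>P\<^esub> \<alpha> \<circ> a = a \<circ> w" by simp
  then have step: "(w [^]\<^bsub>P\<^esub> \<alpha>) (a x) = a (w x)" for x by (metis o_apply)
  have w1: "w (pt k) = pt (k + 1)" for k
    using pow_w_pt[of 1 k] w_carrier by simp
  have up: "a (pt (k + 1)) = (w [^]\<^bsub>P\<^esub> \<alpha>) (a (pt k))" for k
    using step[of "pt k"] by (simp add: w1)
  show ?thesis
  proof (induction k rule: int_induct[where k = 0])
    case base
    then show ?case by (simp add: pt_def one_perm_group a_fix)
  next
    case (step1 i)
    then show ?case using up[of i] by (simp add: pow_w_pt distrib_left)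
  next
    case (step2 i)
    have "(w [^]\<^bsub>P\<^esub> \<alpha>) (a (pt (i - 1))) = (w [^]\<^bsub>P\<^esub> \<alpha>) (pt (\<alpha> * (i - 1)))"
      using up[of "i - 1"] step2 by (simp add: pow_w_pt algebra_simps)
    moreover have "inj (w [^]\<^bsub>P\<^esub> \<alpha>)" by (rule carrier_inj[OF pow_w_carrier])
    ultimately show ?case by (simp add: inj_eq)
  qed
qed

text \<open>A common factor g of \<open>l\<close> and \<open>n\<close> would give the points 0 and n
  / g the same image, against injectivity.\<close>

lemma coprime_of_affine:
  assumes "h \<in> carrier P" "\<And>t. h (pt t) = pt (l * t + e)"
  shows "coprime l (int n)"
proof -
  define g where "g = gcd l (int n)"
  have g0: "0 < g" using n_pos by (simp add: g_def)
  obtain k where k: "int n = g * k" by (metis dvdE g_def gcd_dvd2)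
  have "int n dvd l * k" unfolding k by (simp add: g_def mult_dvd_mono)
  then have "h (pt k) = h (pt 0)" by (simp add: assms(2) pt_eq_iff cong_iff_dvd_diff)
  then have "int n dvd k" using carrier_inj[OF assms(1)] by (simp add: inj_eq pt_eq_iff cong_0_iff)
  moreover have "0 < k" using k g0 n_pos by (metis of_nat_0_less_iff zero_less_mult_pos)
  ultimately have "g * k \<le> 1 * k" using k by (auto dest: zdvd_imp_le)
  then have "g = 1" using g0 \<open>0 < k\<close> by simp
  then show ?thesis by (simp add: g_def coprime_iff_gcd_eq_1)
qed

lemma coprime_\<alpha>: "coprime \<alpha> (int n)"
  using coprime_of_affine[OF a_carrier, of \<alpha> 0] by (simp add: a_pt)

text \<open>Normal form of the elements of \<open>G\<close>; in the coordinates \<open>pt\<close> it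
  is the map x |-> \<alpha>^i * x + b.\<close>

definition T :: "nat \<Rightarrow> int \<Rightarrow> 'x \<Rightarrow> 'x" where
  "T i b = a [^]\<^bsub>P\<^esub> i \<otimes>\<^bsub>P\<^esub> w [^]\<^bsub>P\<^esub> b"

lemma T_carrier: "T i b \<in> carrier P"
  unfolding T_def using a_carrier pow_w_carrier by (intro P.m_closed P.nat_pow_closed)

lemma T_pt: "T i b (pt k) = pt (\<alpha> ^ i * k + b)"
proof -
  have "(a [^]\<^bsub>P\<^esub> i) (pt k) = pt (\<alpha> ^ i * k)"
    by (induction i) (simp_all add: one_perm_group a_pt mult.assoc)
  then show ?thesis by (simp add: T_def pow_w_pt)
qed

lemma T_mult: "T i b \<otimes>\<^bsub>P\<^esub> T j b' = T (i + j) (\<alpha> ^ j * b + b')"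
proof (rule perm_eqI)
  show "(T i b \<otimes>\<^bsub>P\<^esub> T j b') (pt k) = T (i + j) (\<alpha> ^ j * b + b') (pt k)" for k
    by (simp add: T_pt power_add algebra_simps)
qed (auto intro!: T_carrier P.m_closed simp del: mult_perm_group)

lemma T_eq_iff: "T i b = T j b' \<longleftrightarrow> [\<alpha> ^ i = \<alpha> ^ j] (mod int n) \<and> [b = b'] (mod int n)"
proof
  assume eq: "T i b = T j b'"
  have "[\<alpha> ^ i * k + b = \<alpha> ^ j * k + b'] (mod int n)" for k
    using arg_cong[OF eq, of "\<lambda>p. p (pt k)"] by (simp add: T_pt pt_eq_iff)
  from this[of 0] this[of 1] show "[\<alpha> ^ i = \<alpha> ^ j] (mod int n) \<and> [b = b'] (mod int n)"
    using cong_diff by fastforce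
next
  assume "[\<alpha> ^ i = \<alpha> ^ j] (mod int n) \<and> [b = b'] (mod int n)"
  then have "T i b (pt k) = T j b' (pt k)" for k
    unfolding T_pt pt_eq_iff by (intro cong_add cong_mult) auto
  then show "T i b = T j b'" by (intro perm_eqI T_carrier)
qed

lemma a_T: "a = T 1 0" and w_T: "w [^]\<^bsub>P\<^esub> (k :: int) = T 0 k"
  using a_carrier by (simp_all add: T_def perm_group_def)

lemma pow_w_T: "w [^]\<^bsub>P\<^esub> (k :: nat) = T 0 (int k)"
  by (simp flip: w_T int_pow_int)

lemma pow_a_T: "a [^]\<^bsub>P\<^esub> (k :: nat) = T k 0"
  by (simp add: T_def one_perm_group)

lemma G_eq: "G = {T i b | i b. True}"
proof
  have "subgroup {T i b | i b. True} P"
  proof (rule subgroup_perm_groupI[OF finX])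
    fix p q assume "p \<in> {T i b | i b. True}" "q \<in> {T i b | i b. True}"
    then obtain i b j b' where "p = T i b" "q = T j b'" by auto
    then have "p \<otimes>\<^bsub>P\<^esub> q = T (i + j) (\<alpha> ^ j * b + b')" by (simp only: T_mult)
    then show "p \<otimes>\<^bsub>P\<^esub> q \<in> {T i b | i b. True}" by blast
  qed (use T_carrier in auto)
  moreover have "w = T 0 1" using w_T[of 1] w_carrier by simp
  then have "{a, w} \<subseteq> {T i b | i b. True}" using a_T by blast
  ultimately show "G \<subseteq> {T i b | i b. True}" unfolding G_gen by (intro P.generate_subgroup_incl)
  have aw: "a \<in> G" "w \<in> G" unfolding G_gen by (blast intro: generate.incl)+
  have "a [^]\<^bsub>P\<^esub> i \<in> G" for i :: nat
    using P.subgroup_int_pow_closed[OF G aw(1), of "int i"] by (simp add: int_pow_int)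
  then have "T i b \<in> G" for i b
    unfolding T_def using P.subgroup_int_pow_closed[OF G aw(2)] subgroup.m_closed[OF G] by blast
  then show "{T i b | i b. True} \<subseteq> G" by blast
qed

section \<open>Orbits and relative closure in coordinates\<close>

definition rel :: "('x \<Rightarrow> 'x) set \<Rightarrow> int \<Rightarrow> int \<Rightarrow> bool" where
  "rel H x y \<longleftrightarrow> (\<exists>h\<in>H. h (pt x) = pt y)"

lemma subgroup_in_G:
  "subgroup H (perm_subgroup G X) \<longleftrightarrow> subgroup H P \<and> H \<subseteq> G"
  using P.incl_subgroup[OF G] P.subgroup_incl[OF _ G] subgroup.subset[of H "perm_subgroup G X"]
  by auto

definition cls :: "('x \<Rightarrow> 'x) set \<Rightarrow> int \<Rightarrow> 'x set" where
  "cls H x = {h (pt x) | h. h \<in> H}"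

lemma pt_in_cls: "pt y \<in> cls H x \<longleftrightarrow> rel H x y"
  unfolding cls_def rel_def by (auto, metis)

lemma point_orbits_eq: "point_orbits X H = range (cls H)"
proof -
  have X: "range pt = X" using pt_in pt_surj by blast
  have "point_orbits X H = (\<lambda>x. {h x | h. h \<in> H}) ` range pt"
    unfolding X by (rule point_orbits_image)
  then show ?thesis by (simp add: image_image cls_def)
qed

lemma cls_subset: assumes "H \<subseteq> carrier P" shows "cls H x \<subseteq> X"
  using assms carrier_image[OF _ pt_in] unfolding cls_def by blast

lemma cls_eq_image: assumes "H \<subseteq> carrier P" shows "cls H x = pt ` {y. rel H x y}"
proof
  show "cls H x \<subseteq> pt ` {y. rel H x y}"
  proof
    fix z assume z: "z \<in> cls H x"
    then obtain y where "z = pt y" using cls_subset[OF assms] pt_surj by blast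
    then show "z \<in> pt ` {y. rel H x y}" using z pt_in_cls by blast
  qed
qed (use pt_in_cls in blast)

text \<open>By \<open>relative_closure_eq\<close> the closure consists of the elements of
  \<open>G\<close> that map each orbit of \<open>H\<close> onto itself. As orbits are finite and
  permutations injective, it is enough that every point stays in its orbit.\<close>

lemma relatively_closed_iff:
  assumes H: "subgroup H P" "H \<subseteq> G"
  shows "relatively_closed X G H \<longleftrightarrow> (\<forall>i b. (\<forall>x. rel H x (\<alpha> ^ i * x + b)) \<longrightarrow> T i b \<in> H)"
proof -
  have HG: "subgroup H (perm_subgroup G X)" using H subgroup_in_G by blast
  have HP: "H \<subseteq> carrier P" using subgroup.subset[OF H(1)] .
  have inv: "h ` \<Delta> = \<Delta>" if "h \<in> H" "\<Delta> \<in> point_orbits X H" for h \<Delta>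
    using orbit_invariant[OF HG G that] .
  have pres: "(\<forall>\<Delta>\<in>point_orbits X H. T i b ` \<Delta> = \<Delta>) \<longleftrightarrow> (\<forall>x. rel H x (\<alpha> ^ i * x + b))" for i b
  proof
    assume inv: "\<forall>\<Delta>\<in>point_orbits X H. T i b ` \<Delta> = \<Delta>"
    show "\<forall>x. rel H x (\<alpha> ^ i * x + b)"
    proof
      fix x
      have "pt x \<in> cls H x" using subgroup.one_closed[OF H(1)] by (auto simp: one_perm_group cls_def intro!: exI[of _ id])
      then have "T i b (pt x) \<in> cls H x" using inv point_orbits_eq by blast
      then show "rel H x (\<alpha> ^ i * x + b)" by (simp add: T_pt pt_in_cls)
    qed
  next
    assume rel: "\<forall>x. rel H x (\<alpha> ^ i * x + b)"
    show "\<forall>\<Delta>\<in>point_orbits X H. T i b ` \<Delta> = \<Delta>"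
    proof
      fix \<Delta> assume D: "\<Delta> \<in> point_orbits X H"
      then obtain x where x: "\<Delta> = cls H x" by (auto simp: point_orbits_eq)
      have "finite \<Delta>" using cls_subset[OF HP] finX x finite_subset by blast
      moreover have "T i b ` \<Delta> \<subseteq> \<Delta>"
      proof
        fix z assume "z \<in> T i b ` \<Delta>"
        then obtain u where u: "u \<in> \<Delta>" "z = T i b u" by blast
        then have "u \<in> X" using cls_subset[OF HP] x by blast
        then obtain y where "u = pt y" by (rule pt_surj)
        then have y: "pt y \<in> \<Delta>" "z = pt (\<alpha> ^ i * y + b)" using u by (simp_all add: T_pt)
        obtain h where "h \<in> H" "h (pt y) = z" using rel y(2) by (auto simp: rel_def)
        then show "z \<in> \<Delta>" using inv[OF _ D] y(1) by blast
      qed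
      moreover have "inj_on (T i b) \<Delta>"
        by (rule inj_on_subset[OF carrier_inj[OF T_carrier] subset_UNIV])
      ultimately show "T i b ` \<Delta> = \<Delta>" by (rule endo_inj_surj)
    qed
  qed
  define C where "C = {g \<in> G. \<forall>\<Delta>\<in>point_orbits X H. g ` \<Delta> = \<Delta>}"
  have "relatively_closed X G H \<longleftrightarrow> C = H"
    unfolding relatively_closed_def relative_closure_eq[OF G HG] C_def using HG by blast
  moreover have "H \<subseteq> C" unfolding C_def using inv H(2) by blast
  ultimately have closed_C: "relatively_closed X G H \<longleftrightarrow> C \<subseteq> H" by blast
  have TG: "T i b \<in> G" for i b unfolding G_eq by blast
  have T_C: "T i b \<in> C \<longleftrightarrow> (\<forall>x. rel H x (\<alpha> ^ i * x + b))" for i b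
    unfolding pres[symmetric] C_def using TG[of i b] by simp
  have C_H: "C \<subseteq> H \<longleftrightarrow> (\<forall>i b. T i b \<in> C \<longrightarrow> T i b \<in> H)"
  proof
    assume all: "\<forall>i b. T i b \<in> C \<longrightarrow> T i b \<in> H"
    show "C \<subseteq> H"
    proof
      fix g assume g: "g \<in> C"
      then have "g \<in> G" unfolding C_def by simp
      then obtain i b where "g = T i b" unfolding G_eq by blast
      then show "g \<in> H" using all g by simp
    qed
  qed (intro allI impI, rule subsetD)
  show ?thesis unfolding closed_C C_H T_C ..
qed

subsection \<open>Subgroups as affine maps\<close>

text \<open>
  The subgroup generated by \<open>T k c\<close> and the translation by \<open>d\<close>; for suitable parameters this is any
  of \<open>H\<^sub>1\<close>, \<open>H\<^sub>2\<close>, \<open>H\<^sub>3\<close>, \<open>H\<^sub>4\<close>, and by \<open>subgroup_eq_fam\<close> every subgroup of \<open>G\<close> has this form.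
\<close>

definition fam :: "nat \<Rightarrow> int \<Rightarrow> int \<Rightarrow> ('x \<Rightarrow> 'x) set" where
  "fam k c d = {T (k * q) ((aff (\<alpha> ^ k) c ^^ q) 0 + d * t) | q t. True}"

text \<open>The translation part of a power of \<open>T k c\<close> is an iterate of the affine map
  at 0; this cocycle identity makes \<open>fam\<close> closed under products.\<close>

lemma aff_0_add: "(aff \<beta> c ^^ (p + q)) 0 = \<beta> ^ q * (aff \<beta> c ^^ p) 0 + (aff \<beta> c ^^ q) 0"
  unfolding add.commute[of p q] funpow_add o_apply by (rule aff_funpow)

lemma fam_subgroup: "subgroup (fam k c d) P"
proof (rule subgroup_perm_groupI[OF finX])
  show "fam k c d \<subseteq> carrier P" using T_carrier by (auto simp: fam_def)
  show "fam k c d \<noteq> {}" by (auto simp: fam_def)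
  fix x y assume "x \<in> fam k c d" "y \<in> fam k c d"
  then obtain p s q t where xy: "x = T (k * p) ((aff (\<alpha> ^ k) c ^^ p) 0 + d * s)"
    "y = T (k * q) ((aff (\<alpha> ^ k) c ^^ q) 0 + d * t)" by (auto simp: fam_def)
  have "x \<otimes>\<^bsub>P\<^esub> y = T (k * (p + q)) ((aff (\<alpha> ^ k) c ^^ (p + q)) 0 + d * ((\<alpha> ^ k) ^ q * s + t))"
    unfolding xy T_mult aff_0_add by (simp add: algebra_simps power_mult)
  then show "x \<otimes>\<^bsub>P\<^esub> y \<in> fam k c d" unfolding fam_def by blast
qed

lemma fam_G: "fam k c d \<subseteq> G"
  unfolding fam_def G_eq by blast

lemma fam_gens: "T k c \<in> fam k c d" "T 0 (d * t) \<in> fam k c d"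
proof -
  have "T k c = T (k * 1) ((aff (\<alpha> ^ k) c ^^ 1) 0 + d * 0)" by (simp add: aff_def)
  then show "T k c \<in> fam k c d" unfolding fam_def by blast
  have "T 0 (d * t) = T (k * 0) ((aff (\<alpha> ^ k) c ^^ 0) 0 + d * t)" by simp
  then show "T 0 (d * t) \<in> fam k c d" unfolding fam_def by blast
qed

lemma T_0_pow: assumes "subgroup H P" "T 0 d \<in> H" shows "T 0 (d * t) \<in> H"
proof -
  have "T 0 d [^]\<^bsub>P\<^esub> t = T 0 (d * t)"
    unfolding w_T[symmetric] using P.int_pow_pow[OF w_carrier] by simp
  then show ?thesis using P.subgroup_int_pow_closed[OF assms, of t] by simp
qed

lemma fam_least:
  assumes H: "subgroup H P" "T k c \<in> H" "T 0 d \<in> H"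
  shows "fam k c d \<subseteq> H"
proof
  fix x assume "x \<in> fam k c d"
  then obtain q t where x: "x = T (k * q) ((aff (\<alpha> ^ k) c ^^ q) 0 + d * t)" by (auto simp: fam_def)
  have "T (k * q) ((aff (\<alpha> ^ k) c ^^ q) 0) \<in> H"
  proof (induction q)
    case 0
    then show ?case using T_0_pow[OF H(1,3), of 0] by simp
  next
    case (Suc q)
    have "T (k * q) ((aff (\<alpha> ^ k) c ^^ q) 0) \<otimes>\<^bsub>P\<^esub> T k c
        = T (k * Suc q) ((aff (\<alpha> ^ k) c ^^ Suc q) 0)"
      unfolding T_mult by (simp add: aff_def add.commute)
    then show ?case using subgroup.m_closed[OF H(1) Suc H(2)] by simp
  qed
  from subgroup.m_closed[OF H(1) this T_0_pow[OF H(1,3), of t]]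
  show "x \<in> H" unfolding T_mult x by simp
qed

lemma fam_generate: "generate P {T k c, T 0 d} = fam k c d"
proof
  show "generate P {T k c, T 0 d} \<subseteq> fam k c d"
    using fam_gens(1)[of k c d] fam_gens(2)[of d 1 k c] by (intro P.generate_subgroup_incl[OF _ fam_subgroup]) simp
  show "fam k c d \<subseteq> generate P {T k c, T 0 d}"
    by (intro fam_least P.generate_is_subgroup) (auto intro: generate.incl T_carrier)
qed

text \<open>Translations by multiples of \<open>d\<close> absorb every difference divisible by
  \<open>d\<close>, and a power of \<open>T k c\<close> acts as an iterate of the affine
  map.\<close>

lemma rel_fam: assumes "d dvd int n" shows "rel (fam k c d) x y \<longleftrightarrow> reach d (\<alpha> ^ k) c x y"
proof
  assume "rel (fam k c d) x y"
  then obtain q t where "T (k * q) ((aff (\<alpha> ^ k) c ^^ q) 0 + d * t) (pt x) = pt y"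
    by (auto simp: rel_def fam_def)
  then have "[(\<alpha> ^ k) ^ q * x + ((aff (\<alpha> ^ k) c ^^ q) 0 + d * t) = y] (mod d)"
    using cong_dvd_modulus[OF _ assms] by (simp add: T_pt pt_eq_iff power_mult)
  moreover have "(\<alpha> ^ k) ^ q * x + ((aff (\<alpha> ^ k) c ^^ q) 0 + d * t) = (aff (\<alpha> ^ k) c ^^ q) x + d * t"
    by (subst aff_funpow[of _ _ _ x]) simp
  ultimately have "[(aff (\<alpha> ^ k) c ^^ q) x = y] (mod d)" by (simp add: cong_def)
  then show "reach d (\<alpha> ^ k) c x y" unfolding reach_def by blast
next
  assume "reach d (\<alpha> ^ k) c x y"
  then obtain q t where "y = (aff (\<alpha> ^ k) c ^^ q) x + d * t" unfolding reach_def cong_iff_lin by blast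
  then have "y = \<alpha> ^ (k * q) * x + ((aff (\<alpha> ^ k) c ^^ q) 0 + d * t)"
    by (subst (asm) aff_funpow) (simp add: power_mult)
  then have "T (k * q) ((aff (\<alpha> ^ k) c ^^ q) 0 + d * t) (pt x) = pt y" by (simp add: T_pt)
  then show "rel (fam k c d) x y" unfolding rel_def fam_def by blast
qed

text \<open>\<open>d\<close> is the least positive translation in \<open>H\<close> and
  \<open>k\<close> the least positive exponent of \<open>a\<close> in an element of
  \<open>H\<close>; they exist because translation by \<open>n\<close> and the power of
  \<open>a\<close> by its order are trivial. Division of exponents by \<open>k\<close> leaves a
  translation, which is a multiple of \<open>d\<close>.\<close>

lemma subgroup_eq_fam:
  assumes H: "subgroup H P" "H \<subseteq> G"
  shows "\<exists>k c d. 0 < d \<and> d dvd int n \<and> H = fam k c d \<and> (\<forall>t. T 0 t \<in> H \<longrightarrow> d dvd t)"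
proof -
  have one: "T 0 0 \<in> H" using subgroup.one_closed[OF H(1)] by (simp add: T_def one_perm_group)
  have "T 0 (int n) = T 0 0" by (simp add: T_eq_iff cong_def)
  then have "0 < n \<and> T 0 (int n) \<in> H" using one n_pos by simp
  then obtain d where d: "0 < d" "T 0 (int d) \<in> H" and d_min: "\<And>e. e < d \<Longrightarrow> \<not> (0 < e \<and> T 0 (int e) \<in> H)"
    using exists_least_iff[of "\<lambda>e. 0 < e \<and> T 0 (int e) \<in> H"] by blast
  have d_dvd: "int d dvd t" if t: "T 0 t \<in> H" for t
  proof -
    have "T 0 t \<otimes>\<^bsub>P\<^esub> T 0 (int d * - (t div int d)) = T 0 (t mod int d)"
      unfolding T_mult by (simp add: minus_mult_div_eq_mod[symmetric])
    then have "T 0 (t mod int d) \<in> H"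
      using subgroup.m_closed[OF H(1) t T_0_pow[OF H(1) d(2), of "- (t div int d)"]] by simp
    moreover have "0 \<le> t mod int d" "t mod int d < int d" using d(1) by simp_all
    ultimately have "t mod int d = 0"
      using d_min[of "nat (t mod int d)"] by (cases "t mod int d = 0") (simp_all add: nat_less_iff)
    then show ?thesis by (simp add: dvd_eq_mod_eq_0)
  qed
  have "T (P.ord a) 0 = T 0 0" unfolding pow_a_T[symmetric] using a_carrier by (simp add: T_def one_perm_group)
  moreover have "0 < P.ord a" using P.ord_ge_1[OF finite_carrier a_carrier] by simp
  ultimately have "\<exists>i. 0 < i \<and> (\<exists>b. T i b \<in> H)" using one by metis
  then obtain k c where k: "0 < k" "T k c \<in> H" and k_min: "\<And>i. i < k \<Longrightarrow> \<not> (0 < i \<and> (\<exists>b. T i b \<in> H))"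
    using exists_least_iff[of "\<lambda>i. 0 < i \<and> (\<exists>b. T i b \<in> H)"] by blast
  have sub: "fam k c (int d) \<subseteq> H" using fam_least[OF H(1) k(2) d(2)] .
  have "H \<subseteq> fam k c (int d)"
  proof
    fix h assume h: "h \<in> H"
    then obtain i b where ib: "h = T i b" using H(2) unfolding G_eq by blast
    define q u where "q = i div k" and "u = (aff (\<alpha> ^ k) c ^^ q) 0"
    define b' where "b' = b - \<alpha> ^ (i mod k) * u"
    have "T (k * q) u = T (k * q) ((aff (\<alpha> ^ k) c ^^ q) 0 + int d * 0)" by (simp add: u_def)
    then have gH: "T (k * q) u \<in> H" using sub unfolding fam_def by blast
    have split: "T (k * q) u \<otimes>\<^bsub>P\<^esub> T (i mod k) b' = h"
      unfolding T_mult ib b'_def q_def by simp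
    have "T (i mod k) b' = inv\<^bsub>P\<^esub> (T (k * q) u) \<otimes>\<^bsub>P\<^esub> h"
      unfolding split[symmetric] using T_carrier by (simp only: P.m_assoc[symmetric] P.l_inv P.l_one P.inv_closed)
    then have mem: "T (i mod k) b' \<in> H"
      using subgroup.m_closed[OF H(1) subgroup.m_inv_closed[OF H(1) gH] h] by simp
    then have i0: "i mod k = 0" using k_min[of "i mod k"] k(1) by (meson mod_less_divisor neq0_conv)
    then obtain t where "b' = int d * t" using d_dvd mem by auto
    then have "h = T (k * q) (u + int d * t)" unfolding split[symmetric] T_mult i0 by simp
    then show "h \<in> fam k c (int d)" unfolding fam_def u_def by blast
  qed
  then have "H = fam k c (int d)" using sub by blast
  moreover have "int d dvd int n" using d_dvd \<open>0 < n \<and> T 0 (int n) \<in> H\<close> by blast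
  ultimately show ?thesis using d(1) d_dvd by (intro exI[of _ k] exI[of _ c] exI[of _ "int d"]) auto
qed

lemma affine_mod_\<alpha>: assumes "0 < d" "d dvd int n" shows "affine_mod d (\<alpha> ^ k)"
proof
  show "coprime (\<alpha> ^ k) d" using coprime_divisors[OF dvd_refl assms(2) coprime_\<alpha>] by simp
qed (rule assms(1))

text \<open>An orbit of \<open>H\<close> is the preimage of an orbit of the affine map under
  reduction from modulus \<open>n\<close> to modulus \<open>d\<close>. \<open>S\<close> lists it as
  y + d * k, with y in that orbit and n / d choices of k.\<close>

lemma card_cls:
  assumes H: "H \<subseteq> carrier P" and rel: "\<And>x y. rel H x y \<longleftrightarrow> reach d \<beta> c x y"
    and d: "0 < d" "d dvd int n" "affine_mod d \<beta>"
  shows "card (cls H x) = nat (int n div d) * period d \<beta> c x"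
proof -
  interpret affine_mod d \<beta> c by (rule d(3))
  define N where "N = int n div d"
  have N: "int n = d * N" using d(2) by (simp add: N_def)
  have N0: "0 < N" using N d(1) n_pos zero_less_mult_pos[of d N] by simp
  define S where "S = (\<lambda>(y, k). y + d * k) ` (orb' x \<times> {0..<N})"
  have bounds: "0 \<le> y \<and> y < d" if "y \<in> orb' x" for y using that by (auto simp: orb_def)
  have md: "(y + d * k) mod d = y" "(y + d * k) div d = k" if "y \<in> orb' x" for y k
    using bounds[OF that] by (simp_all add: div_pos_pos_trivial)
  have "inj_on (\<lambda>(y, k). y + d * k) (orb' x \<times> {0..<N})"
    unfolding inj_on_def using md by (auto; metis)
  then have card_S: "card S = per x * nat N" by (simp add: S_def card_image card_cartesian_product card_orb)
  have S_range: "0 \<le> z \<and> z < int n" if "z \<in> S" for z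
  proof -
    from that obtain y k where z: "z = y + d * k" "y \<in> orb' x" "0 \<le> k" "k < N" by (auto simp: S_def)
    have "d * k \<le> d * (N - 1)" using z(4) d(1) by (intro mult_left_mono) auto
    then have "z < d * N" using z(1) bounds[OF z(2)] by (simp add: algebra_simps)
    moreover have "0 \<le> d * k" using z(3) d(1) by simp
    ultimately show ?thesis using z(1) bounds[OF z(2)] N by simp
  qed
  have "cls H x = pt ` S"
  proof
    show "pt ` S \<subseteq> cls H x"
    proof
      fix p assume "p \<in> pt ` S"
      then obtain y k where p: "p = pt (y + d * k)" "y \<in> orb' x" by (auto simp: S_def)
      have "R x (y + d * k)" using p(2) md(1)[OF p(2), of k] R_mod[of x "y + d * k"] by (simp add: orb_def)
      then show "p \<in> cls H x" by (simp add: p(1) pt_in_cls rel)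
    qed
    show "cls H x \<subseteq> pt ` S"
    proof
      fix p assume "p \<in> cls H x"
      then obtain y where y: "p = pt y" "R x y" unfolding cls_eq_image[OF H] rel by blast
      define z where "z = y mod int n"
      have z: "0 \<le> z" "z < int n" using n_pos by (simp_all add: z_def)
      have "p = pt z" unfolding y(1) pt_eq_iff by (simp add: z_def cong_def)
      moreover have "z mod d = y mod d" using d(2) by (simp add: z_def mod_mod_cancel)
      then have "z mod d \<in> orb' x" using y(2) mod_in_orb by simp
      moreover have "z div d \<in> {0..<N}"
      proof -
        have "0 \<le> z div d" using z(1) d(1) by (simp add: pos_imp_zdiv_nonneg_iff)
        moreover have "d * (z div d) < d * N"
          using z(2) N d(1) mult_div_mod_eq[of d z] pos_mod_sign[of d z] by linarith
        ultimately show ?thesis using d(1) by simp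
      qed
      moreover have "z = z mod d + d * (z div d)" by simp
      ultimately show "p \<in> pt ` S" unfolding S_def by (metis (mono_tags, lifting) SigmaI case_prod_conv image_eqI)
    qed
  qed
  moreover have "inj_on pt S"
  proof (rule inj_onI)
    fix y z assume "y \<in> S" "z \<in> S" "pt y = pt z"
    then show "y = z" using S_range[of y] S_range[of z] by (simp add: pt_eq_iff cong_def)
  qed
  ultimately show ?thesis using card_S by (simp add: card_image N_def mult.commute)
qed

lemma rel_equiv:
  assumes "subgroup H P"
  shows "rel H x x" "rel H x y \<Longrightarrow> rel H y x" "rel H x y \<Longrightarrow> rel H y z \<Longrightarrow> rel H x z"
proof -
  show "rel H x x" using subgroup.one_closed[OF assms] by (auto simp: rel_def one_perm_group intro: bexI[of _ id])
  show "rel H y x" if "rel H x y"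
  proof -
    obtain h where h: "h \<in> H" "h (pt x) = pt y" using \<open>rel H x y\<close> by (auto simp: rel_def)
    have "h \<otimes>\<^bsub>P\<^esub> inv\<^bsub>P\<^esub> h = id" using h(1) subgroup.mem_carrier[OF assms] P.r_inv[of h] by (simp add: one_perm_group)
    then have "(inv\<^bsub>P\<^esub> h) (h (pt x)) = pt x" by (simp add: fun_eq_iff)
    then show ?thesis using h subgroup.m_inv_closed[OF assms h(1)] by (auto simp: rel_def)
  qed
  show "rel H x z" if xy: "rel H x y" and yz: "rel H y z"
  proof -
    obtain h h' where h: "h \<in> H" "h (pt x) = pt y" "h' \<in> H" "h' (pt y) = pt z"
      using xy yz by (auto simp: rel_def)
    have "h \<otimes>\<^bsub>P\<^esub> h' \<in> H" using subgroup.m_closed[OF assms h(1,3)] .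
    moreover have "(h \<otimes>\<^bsub>P\<^esub> h') (pt x) = pt z" using h by simp
    ultimately show ?thesis unfolding rel_def by blast
  qed
qed

lemma cls_eq_iff: assumes "subgroup H P" shows "cls H x = cls H y \<longleftrightarrow> rel H x y"
proof
  assume "cls H x = cls H y"
  moreover have "pt y \<in> cls H y" unfolding pt_in_cls by (rule rel_equiv(1)[OF assms])
  ultimately show "rel H x y" unfolding pt_in_cls[symmetric] by simp
next
  assume "rel H x y"
  then have "rel H x z \<longleftrightarrow> rel H y z" for z using rel_equiv(2,3)[OF assms] by blast
  then show "cls H x = cls H y" unfolding cls_eq_image[OF subgroup.subset[OF assms]] by (simp add: image_def)
qed

lemma three_orbit_lengths:
  assumes H: "subgroup H P" and rel: "\<And>x y. rel H x y \<longleftrightarrow> reach d \<beta> c x y"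
    and d: "0 < d" "d dvd int n" "affine_mod d \<beta>" and th: "affine_mod.three d \<beta> c x y z"
  shows "orbit_lengths X H = {#nat (int n div d) * period d \<beta> c x, nat (int n div d) * period d \<beta> c y,
    nat (int n div d) * period d \<beta> c z#}"
proof -
  interpret affine_mod d \<beta> c by (rule d(3))
  have HP: "H \<subseteq> carrier P" by (rule subgroup.subset[OF H])
  have "cls H t \<in> {cls H x, cls H y, cls H z}" for t
    using three_total[OF th, of t] cls_eq_iff[OF H] rel by blast
  then have orbs: "point_orbits X H = {cls H x, cls H y, cls H z}" unfolding point_orbits_eq by blast
  have "cls H x \<noteq> cls H y" "cls H x \<noteq> cls H z" "cls H y \<noteq> cls H z"
    using th unfolding cls_eq_iff[OF H] rel three_def by blast+
  then show ?thesis unfolding orbit_lengths_def orbs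
    by (simp add: card_cls[OF HP rel d])
qed

lemma three_orbits_reps:
  assumes H: "subgroup H P" and rel: "\<And>x y. rel H x y \<longleftrightarrow> reach d \<beta> c x y"
    and d: "affine_mod d \<beta>" and card: "card (point_orbits X H) = 3"
  shows "\<exists>x y z. affine_mod.three d \<beta> c x y z"
proof -
  interpret affine_mod d \<beta> c by (rule d)
  obtain A B C where ABC: "point_orbits X H = {A, B, C}" "A \<noteq> B" "A \<noteq> C" "B \<noteq> C"
    using card unfolding card_3_iff by blast
  then obtain x y z where xyz: "A = cls H x" "B = cls H y" "C = cls H z"
    unfolding point_orbits_eq by (metis insertCI rangeE)
  have "\<not> R x y" "\<not> R x z" "\<not> R y z" using ABC(2-4) unfolding xyz cls_eq_iff[OF H] rel by blast+
  moreover have "R x t \<or> R y t \<or> R z t" for t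
  proof -
    have "cls H t \<in> {cls H x, cls H y, cls H z}" using ABC(1) unfolding point_orbits_eq xyz by blast
    then show ?thesis unfolding insert_iff cls_eq_iff[OF H] rel using R_sym by blast
  qed
  ultimately show ?thesis unfolding three_def by blast
qed

end

subsection \<open>The four families\<close>

text \<open>With an even order, a power determines the parity of its exponent. This recovers the
  parity of the exponent of \<open>a\<close> in the closedness of \<open>Fam2\<close> and
  \<open>Fam4\<close>.\<close>

lemma power_cong_parity:
  fixes m a :: int
  assumes "0 < m" "coprime a m" "even (ord m a)" "[a ^ i = a ^ j] (mod m)"
  shows "even i \<longleftrightarrow> even j"
  using assms(4)
proof (induction i j rule: linorder_wlog)
  case (le i j)
  have "[a ^ i * a ^ (j - i) = a ^ i * 1] (mod m)"
    using le by (simp add: cong_sym flip: power_add)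
  moreover have "coprime (a ^ i) m" using assms(2) by simp
  ultimately have "[a ^ (j - i) = 1] (mod m)" by (simp only: cong_mult_lcancel)
  then have "even (j - i)" using ord_dvd_int[OF assms(1)] assms(3) dvd_trans by blast
  then show ?case using le(1) by auto
next
  case (sym i j)
  then show ?case using cong_sym by blast
qed

lemma ord_eq_period:
  fixes m a :: int
  assumes "0 < m" "coprime a m"
  shows "ord m a = period m a 0 1"
proof -
  interpret affine_mod m a 0 using assms by unfold_locales
  have "[(f ^^ j) 1 = 1] (mod m) \<longleftrightarrow> ord m a dvd j" for j
    by (simp add: aff_0_funpow ord_dvd_int[OF assms(1)])
  then show ?thesis by (metis dvd_antisym dvd_refl per_dvd_iff)
qed

lemma ord_pos_int:
  fixes m a :: int
  assumes "0 < m" "coprime a m"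
  shows "0 < ord m a"
proof -
  interpret affine_mod m a 0 using assms by unfold_locales
  show ?thesis unfolding ord_eq_period[OF assms] by (rule per_pos)
qed

text \<open>The order is the length of the orbit of 1 under multiplication by \<open>a\<close>, and
  this orbit avoids the multiples of \<open>r\<close>. For m = r and m = r^2 the bounds are r - 1
  and r^2 - r.\<close>

lemma ord_le_nonmultiples:
  fixes m a r :: int
  assumes "0 < m" "coprime a m" "r dvd m" "1 < r"
  shows "int (ord m a) \<le> m - m div r"
proof -
  interpret affine_mod m a 0 using assms(1,2) by unfold_locales
  have "orb' 1 \<subseteq> {x \<in> {0..<m}. \<not> r dvd x}"
    using R_dvd[OF assms(3), of 1] zdvd_not_zless[of 1 r] assms(4) unfolding orb_def by auto
  then have "card (orb' 1) \<le> card {x \<in> {0..<m}. \<not> r dvd x}"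
    by (rule card_mono[rotated]) (rule finite_subset[of _ "{0..<m}"], auto)
  then show ?thesis
    using card_nonmultiples[OF assms(1,3)] assms(4) card_orb[of 1] ord_eq_period[OF assms(1,2)] by linarith
qed

text \<open>Together with \<open>fam_shift\<close> and \<open>fam_mod\<close>, these are the
  parameters for which the four families take the form \<open>fam k c d\<close>.\<close>

fun fam_exp :: "three_orbit_family \<Rightarrow> nat" where
  "fam_exp Fam2 = 2"
| "fam_exp _ = 1"

fun fam_shift :: "three_orbit_family \<Rightarrow> nat \<Rightarrow> int" where
  "fam_shift Fam4 r = int r"
| "fam_shift _ r = 0"

fun fam_mod :: "three_orbit_family \<Rightarrow> nat \<Rightarrow> int" where
  "fam_mod Fam3 r = (int r)\<^sup>2"
| "fam_mod Fam4 r = 2 * int r"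
| "fam_mod _ r = int r"

context cyclic_regular_normal
begin

lemma family_subgroup_eq: "family_subgroup P a w i r = fam (fam_exp i) (fam_shift i r) (fam_mod i r)"
proof -
  have "a \<otimes>\<^bsub>P\<^esub> w [^]\<^bsub>P\<^esub> r = T 1 (int r)" unfolding pow_w_T by (subst a_T, subst T_mult) simp
  then show ?thesis
    by (cases i) (simp_all only: family_subgroup.simps fam_exp.simps fam_shift.simps fam_mod.simps
        fam_generate[symmetric] pow_w_T pow_a_T a_T[symmetric] of_nat_power of_nat_mult of_nat_numeral)
qed

lemma admissible_prime: "admissible n \<alpha> i r \<Longrightarrow> prime r \<and> r dvd n"
  by (cases i) (auto simp: prime_factors_dvd)

lemma fam_mod_dvd:
  assumes adm: "admissible n \<alpha> i r"
  shows "0 < fam_mod i r" "fam_mod i r dvd int n"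
proof -
  have r: "prime r" "r dvd n" using admissible_prime[OF adm] by simp_all
  have r0: "0 < r" using r(1) prime_gt_0_nat by blast
  show "0 < fam_mod i r" using r0 by (cases i) auto
  show "fam_mod i r dvd int n"
  proof (cases i)
    case Fam3
    then show ?thesis using adm by (simp flip: of_nat_power)
  next
    case Fam4
    then have "odd r" using adm r(1) prime_odd_nat[of r] prime_ge_2_nat[of r] by force
    then have "coprime 2 r" by simp
    then have "2 * r dvd n" using adm Fam4 r(2) by (simp add: divides_mult)
    then have "int (2 * r) dvd int n" by (simp only: int_dvd_int_iff)
    then show ?thesis using Fam4 by simp
  qed (use r in auto)
qed

lemma ord_square:
  assumes "0 < m" "ord m \<alpha> = 2 * h"
  shows "ord m (\<alpha>\<^sup>2) = h"
proof (rule ord_eqI[OF assms(1)])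
  fix j
  have "[(\<alpha>\<^sup>2) ^ j = 1] (mod m) \<longleftrightarrow> 2 * h dvd 2 * j"
    using ord_dvd_int[OF assms(1), of \<alpha> "2 * j"] assms(2) by (simp add: power_mult)
  then show "[(\<alpha>\<^sup>2) ^ j = 1] (mod m) \<longleftrightarrow> h dvd j" by simp
qed

lemma nat_div_eq: "nat (int n div int d) = n div d"
  by (simp flip: zdiv_int)

lemma half_prime_length:
  assumes "r dvd n" "odd r"
  shows "n div r * ((r - 1) div 2) = n * (r - 1) div (2 * r)"
proof -
  obtain q where q: "n = r * q" using assms(1) by auto
  obtain h where h: "r = 2 * h + 1" using assms(2) oddE by blast
  have "n * (r - 1) = (2 * r) * (q * h)" by (simp add: q h algebra_simps)
  moreover have "0 < 2 * r" "0 < r" using h by simp_all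
  ultimately have "n * (r - 1) div (2 * r) = q * h" by (metis nonzero_mult_div_cancel_left not_gr_zero)
  moreover have "n div r = q" using q \<open>0 < r\<close> by simp
  ultimately show ?thesis using h by simp
qed

lemma family_three:
  assumes adm: "admissible n \<alpha> i r"
  defines "d \<equiv> fam_mod i r" and "\<beta> \<equiv> \<alpha> ^ fam_exp i" and "c \<equiv> fam_shift i r"
  shows "\<exists>x y z. affine_mod.three d \<beta> c x y z \<and>
    {#nat (int n div d) * period d \<beta> c x, nat (int n div d) * period d \<beta> c y,
      nat (int n div d) * period d \<beta> c z#} = family_orbit_lengths n i r"
proof -
  note d = fam_mod_dvd[OF adm, folded d_def]
  interpret affine_mod d \<beta> c unfolding \<beta>_def by (rule affine_mod_\<alpha>[OF d])
  have r: "prime r" "r dvd n" using admissible_prime[OF adm] by simp_all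
  have pr: "prime (int r)" using r(1) by simp
  have r0: "0 < r" using r(1) prime_gt_0_nat by blast
  have odd_r: "odd r" if "r \<noteq> 2" using that r(1) prime_odd_nat prime_ge_2_nat[of r] by force
  \<comment> \<open>\<open>Fam1\<close> and \<open>Fam2\<close> share this computation, because the
    square of \<alpha> has half the order of \<alpha> in the second.\<close>
  have half: ?thesis if H: "d = int r" "c = 0" "r \<noteq> 2" "ord (int r) \<beta> = (r - 1) div 2"
    "family_orbit_lengths n i r = {#n div r, n * (r - 1) div (2 * r), n * (r - 1) div (2 * r)#}"
  proof -
    have h: "nat ((int r - 1) div 2) = (r - 1) div 2" using r0 by (simp add: nat_div_distrib of_nat_diff)
    obtain z where z: "three 0 1 z" "per 0 = 1" "per 1 = (r - 1) div 2" "per z = (r - 1) div 2"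
      using three_prime H pr h by auto
    then show ?thesis using H(1,5) half_prime_length[OF r(2) odd_r[OF H(3)]] nat_div_eq[of r]
      by (intro exI[of _ 0] exI[of _ 1] exI[of _ z]) simp
  qed
  show ?thesis
  proof (cases i)
    case Fam1
    then show ?thesis using adm by (intro half) (auto simp: d_def c_def \<beta>_def)
  next
    case Fam2
    then have "r \<noteq> 2" "ord (int r) \<alpha> = r - 1" using adm by auto
    moreover from this obtain h where h: "r = 2 * h + 1" using odd_r oddE by blast
    ultimately have "ord (int r) (\<alpha>\<^sup>2) = h" using r0 by (intro ord_square) auto
    then show ?thesis using Fam2 h \<open>r \<noteq> 2\<close> by (intro half) (auto simp: d_def c_def \<beta>_def)
  next
    case Fam3
    then have "ord d \<beta> = r\<^sup>2 - r" using adm by (simp add: d_def \<beta>_def)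
    moreover have "nat ((int r)\<^sup>2 - int r) = r\<^sup>2 - r"
      using r0 by (simp add: nat_diff_distrib power2_eq_square nat_mult_distrib)
    ultimately have th: "three 0 (int r) 1" "per 0 = 1" "per (int r) = r - 1" "per 1 = r\<^sup>2 - r"
      using three_prime_square[OF pr] Fam3 by (auto simp: d_def c_def nat_diff_distrib)
    have "r\<^sup>2 dvd n" using adm Fam3 by simp
    moreover have "nat (int n div d) = n div r\<^sup>2" using nat_div_eq[of "r\<^sup>2"] Fam3 by (simp add: d_def)
    ultimately show ?thesis using th Fam3
      by (intro exI[of _ 0] exI[of _ "int r"] exI[of _ 1]) (simp add: dvd_div_mult)
  next
    case Fam4
    then have "r \<noteq> 2" "ord (int r) \<beta> = r - 1" using adm by (auto simp: \<beta>_def)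
    moreover have "nat (int r - 1) = r - 1" by (simp add: nat_diff_distrib)
    ultimately have th: "three 0 1 (1 + int r)" "per 0 = 2" "per 1 = r - 1" "per (1 + int r) = r - 1"
      using three_double_prime[OF pr] odd_r Fam4 by (auto simp: d_def c_def)
    have "2 * r dvd n" using d(2) Fam4 by (simp add: d_def flip: int_dvd_int_iff)
    moreover have "nat (int n div d) = n div (2 * r)" using nat_div_eq[of "2 * r"] Fam4 by (simp add: d_def)
    moreover have "n div (2 * r) * 2 = n div r" using \<open>2 * r dvd n\<close> r0 by auto
    ultimately show ?thesis using th Fam4
      by (intro exI[of _ 0] exI[of _ 1] exI[of _ "1 + int r"]) (simp add: dvd_div_mult)
  qed
qed

lemma T_in_fam: assumes "[b = (aff (\<alpha> ^ k) c ^^ q) 0] (mod d)" shows "T (k * q) b \<in> fam k c d"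
proof -
  obtain t where "b = (aff (\<alpha> ^ k) c ^^ q) 0 + d * t"
    using cong_sym[OF assms] unfolding cong_iff_lin by blast
  then show ?thesis unfolding fam_def by blast
qed

text \<open>The images of 0 and 1 suffice. For \<open>Fam1\<close> and \<open>Fam3\<close> the image
  of 0 forces \<open>b\<close> to vanish modulo \<open>fam_mod i r\<close>. For \<open>Fam2\<close>
  the image of 1 shows in addition that \<open>j\<close> is even. For \<open>Fam4\<close> it shows
  that \<open>b\<close> has the parity of the j-th iterate of 0; with the congruence modulo
  \<open>r\<close> this determines \<open>b\<close> modulo \<open>2 * r\<close>.\<close>

lemma family_closed:
  assumes adm: "admissible n \<alpha> i r"
    and pres: "\<And>x. reach (fam_mod i r) (\<alpha> ^ fam_exp i) (fam_shift i r) x (\<alpha> ^ j * x + b)"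
  shows "T j b \<in> fam (fam_exp i) (fam_shift i r) (fam_mod i r)"
proof -
  have r: "prime r" "r dvd n" using admissible_prime[OF adm] by simp_all
  have r0: "0 < r" using r(1) prime_gt_0_nat by blast
  have odd_r: "odd r" if "r \<noteq> 2" using that r(1) prime_odd_nat prime_ge_2_nat[of r] by force
  have cop_r: "coprime \<alpha> (int r)" using coprime_divisors[OF dvd_refl _ coprime_\<alpha>] r(2) by simp
  obtain p where p: "[(aff (\<alpha> ^ fam_exp i) (fam_shift i r) ^^ p) 0 = b] (mod fam_mod i r)"
    using pres[of 0] by (auto simp: reach_def)
  obtain q where q: "[(aff (\<alpha> ^ fam_exp i) (fam_shift i r) ^^ q) 1 = \<alpha> ^ j + b] (mod fam_mod i r)"
    using pres[of 1] by (auto simp: reach_def)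
  have easy: ?thesis if "fam_exp i = 1" "fam_shift i r = 0"
    using T_in_fam[where k = 1 and c = 0 and q = j and d = "fam_mod i r" and b = b] p that by (simp add: aff_0_funpow cong_sym)
  show ?thesis
  proof (cases i)
    case Fam2
    then have i: "r \<noteq> 2" "ord (int r) \<alpha> = r - 1" using adm by auto
    have b: "[b = 0] (mod int r)" using p Fam2 by (simp add: aff_0_funpow cong_sym)
    have "[\<alpha> ^ (2 * q) = \<alpha> ^ j + b] (mod int r)" using q Fam2 by (simp add: aff_0_funpow power_mult)
    moreover have "[\<alpha> ^ j + b = \<alpha> ^ j + 0] (mod int r)" using b by (intro cong_add) auto
    ultimately have "[\<alpha> ^ (2 * q) = \<alpha> ^ j] (mod int r)" using cong_trans by force
    moreover have "even (ord (int r) \<alpha>)" using i odd_r by simp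
    ultimately have "even j" using power_cong_parity[OF _ cop_r, of "2 * q" j] r0 by simp
    then obtain u where "j = 2 * u" by auto
    then show ?thesis using T_in_fam[where k = 2 and c = 0 and q = u and d = "int r" and b = b] b Fam2 by (simp add: aff_0_funpow)
  next
    case Fam4
    then have i: "r \<noteq> 2" "ord (int r) \<alpha> = r - 1" "odd \<alpha>" using adm by auto
    have mods: "[x = y] (mod int r)" "even x \<longleftrightarrow> even y" if "[x = y] (mod 2 * int r)" for x y
      using that cong_dvd_modulus[OF that, of "int r"] cong_dvd_iff[OF cong_dvd_modulus[OF that, of 2]] by auto
    have z: "[(aff \<alpha> (int r) ^^ s) x = \<alpha> ^ s * x] (mod int r)" for s x
      by (subst aff_funpow) (simp add: aff_funpow_0 cong_iff_dvd_diff)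
    interpret affine_mod "2 * int r" \<alpha> "int r"
      using affine_mod_\<alpha>[OF fam_mod_dvd[OF adm], of 1] Fam4 by simp
    note par = funpow_parity[OF i(3)]
    have odd_r': "odd (int r)" using odd_r i(1) by simp
    have p: "[(f ^^ p) 0 = b] (mod 2 * int r)" using p Fam4 by simp
    have q: "[(f ^^ q) 1 = \<alpha> ^ j + b] (mod 2 * int r)" using q Fam4 by simp
    have b: "[b = 0] (mod int r)" using mods(1)[OF p] z[of p 0] by (simp add: cong_def)
    have "[\<alpha> ^ q = \<alpha> ^ j + b] (mod int r)" using mods(1)[OF q] z[of q 1] by (simp add: cong_def)
    moreover have "[\<alpha> ^ j + b = \<alpha> ^ j + 0] (mod int r)" using b by (intro cong_add) auto
    ultimately have "[\<alpha> ^ q = \<alpha> ^ j] (mod int r)" using cong_trans by force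
    moreover have "even (ord (int r) \<alpha>)" using i odd_r by simp
    ultimately have "even q \<longleftrightarrow> even j" using power_cong_parity[OF _ cop_r, of q j] r0 by simp
    moreover have "even (1 + int q) \<longleftrightarrow> even (\<alpha> ^ j + b)" using mods(2)[OF q] par[OF odd_r', of q 1] by simp
    ultimately have "even b \<longleftrightarrow> even ((f ^^ j) 0)" using par[OF odd_r', of j 0] i(3) by auto
    then have "even (b - (f ^^ j) 0)" by simp
    moreover have "int r dvd b - (f ^^ j) 0" using b z[of j 0] by (simp add: cong_iff_dvd_diff)
    moreover have "coprime 2 (int r)" using odd_r' by simp
    ultimately have "2 * int r dvd b - (f ^^ j) 0" by (intro divides_mult)
    then show ?thesis using T_in_fam[where k = 1 and c = "int r" and q = j and d = "2 * int r" and b = b] Fam4 by (simp add: cong_iff_dvd_diff)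
  qed (use easy in simp_all)
qed

lemma rel_family:
  assumes "admissible n \<alpha> i r"
  shows "rel (family_subgroup P a w i r) x y \<longleftrightarrow>
    reach (fam_mod i r) (\<alpha> ^ fam_exp i) (fam_shift i r) x y"
  unfolding family_subgroup_eq by (rule rel_fam[OF fam_mod_dvd(2)[OF assms]])

lemma family_relatively_closed:
  assumes "admissible n \<alpha> i r"
  shows "relatively_closed X G (family_subgroup P a w i r)"
proof -
  have "T j b \<in> family_subgroup P a w i r"
    if pres: "\<And>x. rel (family_subgroup P a w i r) x (\<alpha> ^ j * x + b)" for j b
  proof -
    have "reach (fam_mod i r) (\<alpha> ^ fam_exp i) (fam_shift i r) x (\<alpha> ^ j * x + b)" for x
      using pres[of x] unfolding rel_family[OF assms] .
    then show ?thesis unfolding family_subgroup_eq by (rule family_closed[OF assms])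
  qed
  then show ?thesis
    by (subst relatively_closed_iff) (auto simp: family_subgroup_eq fam_subgroup intro: subsetD[OF fam_G])
qed

lemma family_lengths:
  assumes adm: "admissible n \<alpha> i r"
  shows "orbit_lengths X (family_subgroup P a w i r) = family_orbit_lengths n i r"
proof -
  obtain x y z where xyz: "affine_mod.three (fam_mod i r) (\<alpha> ^ fam_exp i) (fam_shift i r) x y z"
    "{#nat (int n div fam_mod i r) * period (fam_mod i r) (\<alpha> ^ fam_exp i) (fam_shift i r) x,
       nat (int n div fam_mod i r) * period (fam_mod i r) (\<alpha> ^ fam_exp i) (fam_shift i r) y,
       nat (int n div fam_mod i r) * period (fam_mod i r) (\<alpha> ^ fam_exp i) (fam_shift i r) z#}
     = family_orbit_lengths n i r"
    using family_three[OF adm] by blast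
  have "subgroup (family_subgroup P a w i r) P" unfolding family_subgroup_eq by (rule fam_subgroup)
  from three_orbit_lengths[OF this rel_family[OF adm] fam_mod_dvd[OF adm]
      affine_mod_\<alpha>[OF fam_mod_dvd[OF adm]] xyz(1)]
  show ?thesis using xyz(2) by simp
qed

text \<open>The order of \<alpha>^k divides that of \<alpha>, which is bounded by
  \<open>ord_le_nonmultiples\<close>. This forces equality, except that (r - 1) / 2 also allows
  order r - 1 for \<alpha>; here \<open>Fam1\<close> and \<open>Fam2\<close> part. Only membership
  of the generator is claimed, which is all that \<open>family_exists\<close> requires.\<close>

lemma special_admissible:
  assumes sp: "special d (\<alpha> ^ k) c" and d: "d dvd int n"
  shows "\<exists>i r. admissible n \<alpha> i r \<and> fam_mod i r = d \<and> T k c \<in> fam (fam_exp i) (fam_shift i r) d"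
proof -
  obtain R where R: "prime R" and cases:
    "R \<noteq> 2 \<and> d = R \<and> R dvd c \<and> ord R (\<alpha> ^ k) = nat ((R - 1) div 2) \<or>
      d = R\<^sup>2 \<and> R\<^sup>2 dvd c \<and> ord (R\<^sup>2) (\<alpha> ^ k) = nat (R\<^sup>2 - R) \<or>
      R \<noteq> 2 \<and> d = 2 * R \<and> R dvd c \<and> odd c \<and> ord R (\<alpha> ^ k) = nat (R - 1)"
    using sp unfolding special_def by blast
  have R2: "2 \<le> R" using R prime_ge_2_int by blast
  define r where "r = nat R"
  have r: "R = int r" using R2 by (simp add: r_def)
  have pr: "prime r" using R r by simp
  have odd_r: "odd r" if "r \<noteq> 2" using that pr prime_odd_nat prime_ge_2_nat[of r] by force
  have "R dvd int n" using cases d by (auto intro: dvd_trans simp: power2_eq_square)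
  then have rn: "r dvd n" unfolding r by simp
  then have r_pf: "r \<in> prime_factors n" using pr n_pos by (simp add: prime_factors_dvd)
  have cop: "coprime \<alpha> e" if "e dvd int n" for e
    using coprime_divisors[OF dvd_refl that coprime_\<alpha>] .
  have cop_r: "coprime \<alpha> (int r)" using cop rn by simp
  have ord_pow: "ord e (\<alpha> ^ k) dvd j \<longleftrightarrow> ord e \<alpha> dvd k * j" if "0 < e" for e j
    using ord_dvd_int[OF that, of "\<alpha> ^ k" j] ord_dvd_int[OF that, of \<alpha> "k * j"] by (simp add: power_mult)
  have ord_pow_dvd: "ord e (\<alpha> ^ k) dvd ord e \<alpha>" if "0 < e" for e
    using ord_pow[OF that, of "ord e \<alpha>"] by simp
  have ord_le: "ord (int r) \<alpha> \<le> r - 1"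
    using ord_le_nonmultiples[OF _ cop_r dvd_refl] R2 r by simp
  have ord0: "0 < ord (int r) \<alpha>" using ord_pos_int[OF _ cop_r] R2 r by simp
  show ?thesis using cases
  proof (elim disjE conjE)
    assume *: "R \<noteq> 2" "d = R" "R dvd c" "ord R (\<alpha> ^ k) = nat ((R - 1) div 2)"
    then have "odd r" using odd_r r by simp
    then obtain h where h: "r = 2 * h + 1" by (rule oddE)
    have h0: "0 < h" using h pr by (cases h) auto
    have oh: "ord (int r) (\<alpha> ^ k) = h" using *(4) h r by simp
    then have "h dvd ord (int r) \<alpha>" using ord_pow_dvd[of "int r"] R2 r by simp
    then obtain g where g: "ord (int r) \<alpha> = h * g" by auto
    have "h * g \<le> h * 2" using ord_le g h by simp
    then have "g \<le> 2" using h0 by simp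
    moreover have "g \<noteq> 0" using ord0 g by auto
    ultimately consider "g = 1" | "g = 2" by linarith
    then show ?thesis
    proof cases
      case 1
      have "T (1 * k) c \<in> fam 1 0 d"
        using *(2,3) by (intro T_in_fam) (simp add: aff_0_funpow cong_0_iff)
      then show ?thesis using 1 g h * r_pf r by (intro exI[of _ Fam1] exI[of _ r]) simp
    next
      case 2
      have "ord (int r) \<alpha> dvd k * h" using ord_pow[of "int r" h] oh R2 r by simp
      then have "even k" using g 2 h0 by simp
      then obtain u where u: "k = 2 * u" by auto
      have "T (2 * u) c \<in> fam 2 0 d"
        using *(2,3) by (intro T_in_fam) (simp add: aff_0_funpow cong_0_iff)
      then show ?thesis using 2 g h * r_pf r u by (intro exI[of _ Fam2] exI[of _ r]) simp
    qed
  next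
    assume *: "d = R\<^sup>2" "R\<^sup>2 dvd c" "ord (R\<^sup>2) (\<alpha> ^ k) = nat (R\<^sup>2 - R)"
    have d0: "0 < d" using *(1) R2 by simp
    have "R * 1 < R * R" using R2 by (intro mult_strict_left_mono) auto
    then have pos: "0 < R\<^sup>2 - R" by (simp add: power2_eq_square)
    have "nat (R\<^sup>2 - R) dvd ord d \<alpha>" using ord_pow_dvd[OF d0] * by simp
    moreover have "int (ord d \<alpha>) \<le> R\<^sup>2 - R"
      using ord_le_nonmultiples[OF d0 cop[OF d], of R] R2 * by (simp add: power2_eq_square)
    moreover have "0 < ord d \<alpha>" by (rule ord_pos_int[OF d0 cop[OF d]])
    ultimately have o: "ord d \<alpha> = nat (R\<^sup>2 - R)" using dvd_imp_le by fastforce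
    have "nat (R\<^sup>2 - R) = r\<^sup>2 - r" unfolding r by (simp add: nat_diff_distrib flip: of_nat_power)
    moreover have "r\<^sup>2 dvd n" using d * r by (simp flip: of_nat_power)
    moreover have "T (1 * k) c \<in> fam 1 0 d"
      using * by (intro T_in_fam) (simp add: aff_0_funpow cong_0_iff)
    ultimately show ?thesis using o * r_pf r by (intro exI[of _ Fam3] exI[of _ r]) simp
  next
    assume *: "R \<noteq> 2" "d = 2 * R" "R dvd c" "odd c" "ord R (\<alpha> ^ k) = nat (R - 1)"
    have or: "odd r" using odd_r * r by simp
    then obtain h where h: "r = 2 * h + 1" by (rule oddE)
    have h0: "0 < h" using h pr by (cases h) auto
    have ok: "ord (int r) (\<alpha> ^ k) = 2 * h" using * h r by simp
    then have "2 * h dvd ord (int r) \<alpha>" using ord_pow_dvd[of "int r"] R2 r by simp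
    moreover have "0 < ord (int r) \<alpha>" by (rule ord0)
    ultimately have o: "ord (int r) \<alpha> = 2 * h" using ord_le h dvd_imp_le by fastforce
    \<comment> \<open>For even \<open>k\<close> the order of \<alpha>^k would divide
      \<open>h\<close>. Oddness of \<open>k\<close> is what gives the k-th iterate of 0 the parity
      of \<open>c\<close>.\<close>
    have "odd k"
    proof
      assume "even k"
      then have "ord (int r) \<alpha> dvd k * h" using o by (simp add: mult_dvd_mono)
      then have "2 * h dvd h" using ord_pow[of "int r" h] ok R2 r by simp
      then show False using h0 by (auto dest: dvd_imp_le)
    qed
    have "even (int n)" using d *(2) by (auto dest: dvd_mult_left)
    then have en: "even n" by simp
    have oa: "odd \<alpha>" using cop[OF \<open>even (int n)\<close>] by simp
    have "coprime 2 R" using or r by simp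
    moreover have "R dvd (aff (\<alpha> ^ 1) R ^^ k) 0" by (simp add: aff_funpow_0)
    then have "R dvd c - (aff (\<alpha> ^ 1) R ^^ k) 0" using *(3) by simp
    moreover have "2 dvd c - (aff (\<alpha> ^ 1) R ^^ k) 0"
    proof -
      interpret affine_mod 1 \<alpha> R by unfold_locales auto
      show ?thesis using funpow_parity[OF oa, of k 0] or r *(4) \<open>odd k\<close> by simp
    qed
    ultimately have "[c = (aff (\<alpha> ^ 1) R ^^ k) 0] (mod d)"
      unfolding *(2) cong_iff_dvd_diff by (intro divides_mult)
    then have "T (1 * k) c \<in> fam 1 R d" by (rule T_in_fam)
    then show ?thesis using o h * r_pf r en oa by (intro exI[of _ Fam4] exI[of _ r]) simp
  qed
qed

subsection \<open>Uniqueness and existence\<close>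

lemma family_orbit_lengths_min:
  assumes adm: "admissible n \<alpha> i r"
  defines "e \<equiv> (if i = Fam3 then r\<^sup>2 else r)"
  shows "e dvd n" "Min (set_mset (family_orbit_lengths n i r)) = n div e"
proof -
  have r: "prime r" "r dvd n" using admissible_prime[OF adm] by simp_all
  have r2: "2 \<le> r" using r(1) prime_ge_2_nat by blast
  show en: "e dvd n" using adm r(2) by (auto simp: e_def)
  show "Min (set_mset (family_orbit_lengths n i r)) = n div e"
  proof (cases "i = Fam3")
    case True
    have "r\<^sup>2 - r = r * (r - 1)" by (simp add: power2_eq_square diff_mult_distrib2)
    then have "1 \<le> r\<^sup>2 - r" using r2 by simp
    then have "n div e * 1 \<le> n div e * (r\<^sup>2 - r)" by (intro mult_le_mono2)
    moreover have "n div e * 1 \<le> n div e * (r - 1)" using r2 by (intro mult_le_mono2) simp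
    moreover have "family_orbit_lengths n i r = {#n div e, n div e * (r - 1), n div e * (r\<^sup>2 - r)#}"
      using True en by (simp add: e_def dvd_div_mult)
    ultimately show ?thesis by simp
  next
    case False
    then have "r \<noteq> 2" using adm by (cases i) auto
    then have "odd r" using r(1) prime_odd_nat[of r] r2 by force
    from half_prime_length[OF r(2) this]
    have "family_orbit_lengths n i r = {#n div e, n div e * ((r - 1) div 2), n div e * ((r - 1) div 2)#}"
      using False by (cases i) (simp_all add: e_def)
    moreover have "1 \<le> (r - 1) div 2" using r2 \<open>r \<noteq> 2\<close> by simp
    then have "n div e * 1 \<le> n div e * ((r - 1) div 2)" by (intro mult_le_mono2)
    ultimately show ?thesis by simp
  qed
qed

text \<open>The shortest orbit has length n / e, where \<open>e\<close> is r^2 for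
  \<open>Fam3\<close> and \<open>r\<close> otherwise. So the lengths determine \<open>e\<close>, and
  a prime is never the square of a prime.\<close>

lemma family_orbit_lengths_inject:
  assumes adm: "admissible n \<alpha> i r" "admissible n \<alpha> i' r'"
    and eq: "family_orbit_lengths n i r = family_orbit_lengths n i' r'"
  shows "r = r'" "i = Fam3 \<longleftrightarrow> i' = Fam3"
proof -
  define e e' where "e = (if i = Fam3 then r\<^sup>2 else r)" and "e' = (if i' = Fam3 then r'\<^sup>2 else r')"
  note min = family_orbit_lengths_min[OF adm(1), folded e_def] family_orbit_lengths_min[OF adm(2), folded e'_def]
  have "n div e = n div e'" using min eq by simp
  moreover obtain q where q: "n = e * q" using min(1) by (rule dvdE)
  moreover obtain q' where q': "n = e' * q'" using min(3) by (rule dvdE)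
  moreover have e0: "e \<noteq> 0" "e' \<noteq> 0" using min(1,3) n_pos by (metis dvd_0_left less_irrefl)+
  moreover have "n div e = q" using q e0(1) by simp
  moreover have "n div e' = q'" using q' e0(2) by simp
  ultimately have "e * q = e' * q" "q \<noteq> 0" using n_pos by auto
  then have ee: "e = e'" by simp
  have pr: "prime r" "prime r'" using admissible_prime adm by blast+
  have np: "\<not> prime (p\<^sup>2)" for p :: nat by (simp add: prime_power_iff)
  show "i = Fam3 \<longleftrightarrow> i' = Fam3" using ee pr np[of r] np[of r'] unfolding e_def e'_def by metis
  then show "r = r'" using ee unfolding e_def e'_def by (auto split: if_splits)
qed

section \<open>Elements of the holomorph in coordinates\<close>

lemma W_subgroup: "subgroup W P"
  unfolding W_gen using w_carrier by (intro P.generate_is_subgroup) simp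

lemma T_0_holomorph: "T 0 s \<in> holomorph X x\<^sub>0 W"
proof -
  interpret WG: group "perm_subgroup W X" by (rule P.subgroup_imp_group[OF W_subgroup])
  have mem: "T 0 s \<in> W" unfolding W_pow w_T[symmetric] by blast
  have "(\<lambda>x\<in>W. x) \<in> auto (perm_subgroup W X)" using WG.id_in_auto by simp
  moreover have "T 0 s (u x\<^sub>0) = (((\<lambda>x\<in>W. x) u) \<otimes>\<^bsub>P\<^esub> T 0 s) x\<^sub>0" if "u \<in> W" for u
    using that by simp
  ultimately show ?thesis unfolding holomorph_def using T_carrier mem by blast
qed

text \<open>An automorphism of the cyclic group \<open>W\<close> sends \<open>w\<close> to a power
  of \<open>w\<close>, so it multiplies coordinates by the exponent \<open>l\<close>.\<close>

lemma holomorph_affine: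
  assumes "h \<in> holomorph X x\<^sub>0 W"
  shows "\<exists>l e. \<forall>t. h (pt t) = pt (l * t + e)"
proof -
  obtain \<sigma> v where s: "\<sigma> \<in> auto (perm_subgroup W X)" "v \<in> W"
    and h: "\<And>u. u \<in> W \<Longrightarrow> h (u x\<^sub>0) = (\<sigma> u \<otimes>\<^bsub>P\<^esub> v) x\<^sub>0"
    using assms unfolding holomorph_def by blast
  interpret WG: group "perm_subgroup W X" by (rule P.subgroup_imp_group[OF W_subgroup])
  have hom: "\<sigma> \<in> hom (perm_subgroup W X) (perm_subgroup W X)" using s(1) by (simp add: auto_def)
  have wW: "w \<in> W" unfolding W_gen by (rule generate.incl) simp
  then have "\<sigma> w \<in> W" using hom by (auto simp: hom_def)
  then obtain l where l: "\<sigma> w = w [^]\<^bsub>P\<^esub> (l :: int)" unfolding W_pow by blast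
  obtain e where e: "v = w [^]\<^bsub>P\<^esub> (e :: int)" using s(2) unfolding W_pow by blast
  have "h (pt t) = pt (l * t + e)" for t
  proof -
    have "w [^]\<^bsub>P\<^esub> t \<in> W" unfolding W_pow by blast
    moreover have "\<sigma> (w [^]\<^bsub>P\<^esub> t) = w [^]\<^bsub>P\<^esub> (l * t)"
    proof -
      have "\<sigma> (w [^]\<^bsub>perm_subgroup W X\<^esub> t) = \<sigma> w [^]\<^bsub>perm_subgroup W X\<^esub> t"
        using hom_int_pow[OF hom _ WG.is_group WG.is_group] wW by simp
      then show ?thesis
        using P.int_pow_consistent[OF W_subgroup wW] P.int_pow_consistent[OF W_subgroup \<open>\<sigma> w \<in> W\<close>]
          P.int_pow_pow[OF w_carrier] by (simp add: l)
    qed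
    ultimately have "h (pt t) = (w [^]\<^bsub>P\<^esub> e) (pt (l * t))"
      using h[of "w [^]\<^bsub>P\<^esub> t"] by (simp add: e pt_def)
    then show ?thesis by (simp add: pow_w_pt)
  qed
  then show ?thesis by blast
qed

lemma conj_commute:
  assumes "h \<in> carrier P" "x \<in> carrier P" "y = inv\<^bsub>P\<^esub> h \<otimes>\<^bsub>P\<^esub> x \<otimes>\<^bsub>P\<^esub> h"
  shows "y (h z) = h (x z)"
proof -
  have "h \<otimes>\<^bsub>P\<^esub> y = x \<otimes>\<^bsub>P\<^esub> h"
    unfolding assms(3) using assms(1,2)
    by (simp only: P.m_assoc[symmetric] P.r_inv P.l_one P.m_closed P.inv_closed)
  then have "y \<circ> h = h \<circ> x" by simp
  then show ?thesis by (metis o_apply)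
qed

text \<open>
  The subgroups \<open>H\<^sub>2\<close> and \<open>H\<^sub>4\<close> have the same order and the same orbit lengths. They are told apart
  by translations: \<open>H\<^sub>2\<close> contains the translation by \<open>r\<close>, whereas all translations in a conjugate of
  \<open>H\<^sub>4\<close> are by even numbers.
\<close>

lemma Fam2_Fam4_not_conjugate:
  assumes adm: "admissible n \<alpha> Fam4 r" and HG: "H \<subseteq> G"
    and conj2: "conjugate_in X (holomorph X x\<^sub>0 W) H (family_subgroup P a w Fam2 r)"
    and conj4: "conjugate_in X (holomorph X x\<^sub>0 W) H (family_subgroup P a w Fam4 r)"
  shows False
proof -
  have r: "prime r" "r \<noteq> 2" "ord (int r) \<alpha> = r - 1" "odd \<alpha>" "even n"
    using adm by auto
  have r0: "0 < r" using r(1) prime_gt_0_nat by blast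
  have odd_r: "odd r" using r(1,2) prime_odd_nat prime_ge_2_nat[of r] by force
  have rn: "int r dvd int n" using admissible_prime[OF adm] by simp
  have two_n: "(2::int) dvd int n" using r(5) by simp
  have GP: "G \<subseteq> carrier P" by (rule subgroup.subset[OF G])
  have aff: "\<exists>l e. odd l \<and> coprime l (int n) \<and> (\<forall>t. h (pt t) = pt (l * t + e))"
    if h: "h \<in> holomorph X x\<^sub>0 W" for h
  proof -
    obtain l e where le: "\<forall>t. h (pt t) = pt (l * t + e)" using holomorph_affine[OF h] by blast
    have "h \<in> carrier P" using h by (simp add: holomorph_def)
    then have cop: "coprime l (int n)" using coprime_of_affine le by blast
    moreover have "odd l" using cop two_n by (metis coprime_common_divisor odd_one)
    ultimately show ?thesis using le by blast
  qed
  obtain h where h: "h \<in> holomorph X x\<^sub>0 W"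
    and F2: "family_subgroup P a w Fam2 r = (\<lambda>x. inv\<^bsub>P\<^esub> h \<otimes>\<^bsub>P\<^esub> x \<otimes>\<^bsub>P\<^esub> h) ` H"
    using conj2 unfolding conjugate_in_def by blast
  obtain h' where h': "h' \<in> holomorph X x\<^sub>0 W"
    and F4: "family_subgroup P a w Fam4 r = (\<lambda>x. inv\<^bsub>P\<^esub> h' \<otimes>\<^bsub>P\<^esub> x \<otimes>\<^bsub>P\<^esub> h') ` H"
    using conj4 unfolding conjugate_in_def by blast
  have hP: "h \<in> carrier P" "h' \<in> carrier P" using h h' by (simp_all add: holomorph_def)
  obtain l e where l: "odd l" "coprime l (int n)" "\<And>t. h (pt t) = pt (l * t + e)" using aff[OF h] by blast
  obtain l' e' where l': "odd l'" "coprime l' (int n)" "\<And>t. h' (pt t) = pt (l' * t + e')"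
    using aff[OF h'] by blast
  have "T 0 (int r) \<in> family_subgroup P a w Fam2 r"
    unfolding family_subgroup.simps pow_w_T[symmetric] by (rule generate.incl) simp
  then obtain x where x: "x \<in> H" "T 0 (int r) = inv\<^bsub>P\<^esub> h \<otimes>\<^bsub>P\<^esub> x \<otimes>\<^bsub>P\<^esub> h" unfolding F2 by blast
  obtain i b where ib: "x = T i b" using x(1) HG unfolding G_eq by blast
  have xP: "x \<in> carrier P" using x(1) HG GP by blast
  have eq: "[l * t + e + int r = l * (\<alpha> ^ i * t + b) + e] (mod int n)" for t
    using conj_commute[OF hP(1) xP x(2), of "pt t"] by (simp add: ib T_pt l(3) pt_eq_iff)
  have "[int r = l * b] (mod int n)" using eq[of 0] by (simp add: cong_iff_dvd_diff)
  then have "[int r = l * b] (mod 2)" using two_n cong_dvd_modulus by blast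
  then have "even (int r) \<longleftrightarrow> even (l * b)" by (rule cong_dvd_iff)
  then have odd_b: "odd b" using odd_r by simp
  \<comment> \<open>Subtracting the congruence at 0 from the one at 1 isolates the linear part:
    \<open>x\<close> is a translation, by the odd number \<open>b\<close>.\<close>
  have "int n dvd (l * 1 + e + int r) - (l * (\<alpha> ^ i * 1 + b) + e) - ((l * 0 + e + int r) - (l * (\<alpha> ^ i * 0 + b) + e))"
    using eq[of 1] eq[of 0] unfolding cong_iff_dvd_diff by (rule dvd_diff)
  then have "int n dvd l * (1 - \<alpha> ^ i)" by (simp add: algebra_simps)
  then have "int n dvd 1 - \<alpha> ^ i" using l(2) by (simp add: coprime_dvd_mult_right_iff coprime_commute)
  then have \<alpha>i: "[\<alpha> ^ i = 1] (mod int n)" by (simp add: cong_iff_dvd_diff dvd_diff_commute)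
  define y where "y = inv\<^bsub>P\<^esub> h' \<otimes>\<^bsub>P\<^esub> x \<otimes>\<^bsub>P\<^esub> h'"
  have "y \<in> fam 1 (int r) (2 * int r)"
    using x(1) family_subgroup_eq[of Fam4 r] unfolding F4 y_def by auto
  then obtain q t where y: "y = T q ((aff \<alpha> (int r) ^^ q) 0 + 2 * int r * t)" by (auto simp: fam_def)
  define b' where "b' = (aff \<alpha> (int r) ^^ q) 0 + 2 * int r * t"
  have eq': "[\<alpha> ^ q * (l' * t + e') + b' = l' * (\<alpha> ^ i * t + b) + e'] (mod int n)" for t
    using conj_commute[OF hP(2) xP y_def, of "pt t"] by (simp add: ib y b'_def[symmetric] T_pt l'(3) pt_eq_iff)
  have "int n dvd (\<alpha> ^ q * (l' * 1 + e') + b') - (l' * (\<alpha> ^ i * 1 + b) + e') -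
      ((\<alpha> ^ q * (l' * 0 + e') + b') - (l' * (\<alpha> ^ i * 0 + b) + e'))"
    using eq'[of 1] eq'[of 0] unfolding cong_iff_dvd_diff by (rule dvd_diff)
  then have "int n dvd l' * (\<alpha> ^ q - \<alpha> ^ i)" by (simp add: algebra_simps)
  then have "int n dvd \<alpha> ^ q - \<alpha> ^ i" using l'(2) by (simp add: coprime_dvd_mult_right_iff coprime_commute)
  then have "[\<alpha> ^ q = 1] (mod int n)" using \<alpha>i cong_trans unfolding cong_iff_dvd_diff by (metis cong_iff_dvd_diff)
  then have "[\<alpha> ^ q = 1] (mod int r)" using rn cong_dvd_modulus by blast
  \<comment> \<open>As \<open>y\<close> is a translation too, \<open>q\<close> is a multiple of the
    even number \<open>r - 1\<close>. An even number of parity-changing steps makes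
    \<open>b'\<close> even, although \<open>b'\<close> is congruent to the odd number
    \<open>l' * b\<close> modulo 2.\<close>
  then have "r - 1 dvd q" using ord_dvd_int[of "int r" \<alpha> q] r0 r(3) by simp
  moreover have "even (r - 1)" using odd_r by simp
  ultimately have "even q" using dvd_trans by blast
  interpret one: affine_mod 1 \<alpha> "int r" by unfold_locales auto
  have "even b'" using one.funpow_parity[OF r(4), of q 0] odd_r \<open>even q\<close> by (simp add: b'_def)
  moreover have "[\<alpha> ^ q * e' + b' = l' * b + e'] (mod 2)"
    using eq'[of 0] two_n cong_dvd_modulus[of _ _ "int n" 2] by simp
  then have "even (\<alpha> ^ q * e' + b') \<longleftrightarrow> even (l' * b + e')" by (rule cong_dvd_iff)
  ultimately show False using l'(1) odd_b r(4) by auto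
qed

text \<open>Orbit lengths fix \<open>r\<close> and single out \<open>Fam3\<close>; the order of
  \<alpha> modulo \<open>r\<close> separates \<open>Fam1\<close> from \<open>Fam2\<close> and
  \<open>Fam4\<close>. Only the last two can be admissible together with the same
  \<open>r\<close>.\<close>

lemma family_unique:
  assumes adm: "admissible n \<alpha> i r" "admissible n \<alpha> i' r'" and HG: "H \<subseteq> G"
    and conj: "conjugate_in X (holomorph X x\<^sub>0 W) H (family_subgroup P a w i r)"
      "conjugate_in X (holomorph X x\<^sub>0 W) H (family_subgroup P a w i' r')"
  shows "i = i' \<and> r = r'"
proof -
  have HP: "H \<subseteq> carrier P" using HG subgroup.subset[OF G] by blast
  have len: "orbit_lengths X K = orbit_lengths X H" if "conjugate_in X (holomorph X x\<^sub>0 W) H K" for K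
    using that orbit_lengths_conjugate[OF _ HP] unfolding conjugate_in_def holomorph_def by blast
  have "family_orbit_lengths n i r = family_orbit_lengths n i' r'"
    using len[OF conj(1)] len[OF conj(2)] family_lengths[OF adm(1)] family_lengths[OF adm(2)] by simp
  then have r: "r = r'" and F3: "i = Fam3 \<longleftrightarrow> i' = Fam3" using family_orbit_lengths_inject[OF adm] by blast+
  have "r \<noteq> 2 \<Longrightarrow> 3 \<le> r" using admissible_prime[OF adm(1)] prime_ge_2_nat[of r] by simp
  then have half: "r \<noteq> 2 \<Longrightarrow> (r - 1) div 2 \<noteq> r - 1" by simp
  have not24: "\<not> (i = Fam2 \<and> i' = Fam4)" "\<not> (i = Fam4 \<and> i' = Fam2)"
    using Fam2_Fam4_not_conjugate[OF _ HG] adm conj r by blast+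
  show ?thesis using adm r F3 half not24 by (cases i; cases i') auto
qed

lemma family_exists:
  assumes closed: "relatively_closed X G H" and card: "card (point_orbits X H) = 3"
  shows "\<exists>i r. admissible n \<alpha> i r \<and>
    conjugate_in X (holomorph X x\<^sub>0 W) H (family_subgroup P a w i r)"
proof -
  have H: "subgroup H P" "H \<subseteq> G" using closed unfolding relatively_closed_def subgroup_in_G by blast+
  have mem: "T i b \<in> H" if "\<And>x. rel H x (\<alpha> ^ i * x + b)" for i b
    using closed that unfolding relatively_closed_iff[OF H] by blast
  obtain k c d where d: "0 < d" "d dvd int n" and H_fam: "H = fam k c d"
    and trans: "\<And>t. T 0 t \<in> H \<Longrightarrow> d dvd t"
    using subgroup_eq_fam[OF H] by blast
  have rel: "rel H x y \<longleftrightarrow> reach d (\<alpha> ^ k) c x y" for x y unfolding H_fam by (rule rel_fam[OF d(2)])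
  note am = affine_mod_\<alpha>[OF d, of k]
  interpret affine_mod d "\<alpha> ^ k" c by (rule am)
  obtain x y z where xyz: "three x y z" using three_orbits_reps[OF H(1) rel am card] by blast
  have free: "d dvd t" if "\<And>x. R x (x + t)" for t
  proof -
    have "rel H x (\<alpha> ^ 0 * x + t)" for x using that[of x] by (simp add: rel)
    then show ?thesis by (rule trans[OF mem])
  qed
  obtain s where sp: "special d (\<alpha> ^ k) (f s - s)" using three_orbits_special[OF xyz free] by blast
  define c' where "c' = f s - s"
  obtain i r where adm: "admissible n \<alpha> i r" and dm: "fam_mod i r = d"
    and gen: "T k c' \<in> fam (fam_exp i) (fam_shift i r) d"
    using special_admissible[OF sp d(2)] unfolding c'_def by blast
  define F where "F = family_subgroup P a w i r"
  have F_fam: "F = fam (fam_exp i) (fam_shift i r) d" unfolding F_def family_subgroup_eq dm ..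
  have sub: "fam k c' d \<subseteq> F"
    unfolding F_fam using gen fam_gens(2)[of d 1] by (intro fam_least fam_subgroup) simp_all
  interpret N: affine_mod d "\<alpha> ^ k" c' by (rule am)
  have "N.three (x - s) (y - s) (z - s)" unfolding c'_def three_shift using xyz by simp
  moreover obtain x' y' z' where "affine_mod.three d (\<alpha> ^ fam_exp i) (fam_shift i r) x' y' z'"
    using family_three[OF adm] unfolding dm by blast
  moreover have "coprime (\<alpha> ^ fam_exp i) d" using affine_mod_\<alpha>[OF d] by (simp add: affine_mod_def)
  moreover have relF: "rel F u v \<longleftrightarrow> reach d (\<alpha> ^ fam_exp i) (fam_shift i r) u v" for u v
    unfolding F_fam by (rule rel_fam[OF d(2)])
  moreover have "reach d (\<alpha> ^ fam_exp i) (fam_shift i r) u v" if "N.R u v" for u v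
  proof -
    have "rel (fam k c' d) u v" unfolding rel_fam[OF d(2)] by (rule that)
    then have "rel F u v" using sub unfolding rel_def by blast
    then show ?thesis unfolding relF .
  qed
  \<comment> \<open>The shifted group is contained in \<open>F\<close> and both have three orbits,
    so \<open>three_reach_eq\<close> applies.\<close>
  ultimately have same: "N.R u v" if "rel F u v" for u v
    using N.three_reach_eq that unfolding relF by blast
  have inv: "inv\<^bsub>P\<^esub> (T 0 (- s)) = T 0 s"
  proof (rule P.inv_equality[OF _ T_carrier T_carrier])
    show "T 0 s \<otimes>\<^bsub>P\<^esub> T 0 (- s) = \<one>\<^bsub>P\<^esub>" unfolding T_mult by (simp add: T_def one_perm_group)
  qed
  \<comment> \<open>Conjugation by the translation by -s replaces a map g by x |-> g (x + s) - s,
    the shift of \<open>aff_shift_funpow\<close>.\<close>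
  have conj: "inv\<^bsub>P\<^esub> (T 0 (- s)) \<otimes>\<^bsub>P\<^esub> T j b \<otimes>\<^bsub>P\<^esub> T 0 (- s) = T j (\<alpha> ^ j * s + b - s)" for j b
    unfolding inv T_mult by simp
  have "F = (\<lambda>x. inv\<^bsub>P\<^esub> (T 0 (- s)) \<otimes>\<^bsub>P\<^esub> x \<otimes>\<^bsub>P\<^esub> T 0 (- s)) ` H"
  proof (intro equalityI subsetI)
    fix g assume g: "g \<in> F"
    then obtain j b where jb: "g = T j b" unfolding F_fam fam_def by blast
    \<comment> \<open>An element of \<open>F\<close> keeps each point in its orbit under the shifted
      map. Shifted back by \<open>s\<close>, it keeps each point in its orbit of \<open>H\<close>,
      so closedness puts it into \<open>H\<close>.\<close>
    have "rel H u (\<alpha> ^ j * u + (b - \<alpha> ^ j * s + s))" for u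
    proof -
      have "rel F (u - s) (\<alpha> ^ j * (u - s) + b)" using g unfolding jb rel_def by (metis T_pt)
      then have "R (u - s + s) (\<alpha> ^ j * (u - s) + b + s)"
        using same unfolding c'_def reach_shift by blast
      then show ?thesis by (simp add: rel algebra_simps)
    qed
    then have "T j (b - \<alpha> ^ j * s + s) \<in> H" by (rule mem)
    moreover have "g = inv\<^bsub>P\<^esub> (T 0 (- s)) \<otimes>\<^bsub>P\<^esub> T j (b - \<alpha> ^ j * s + s) \<otimes>\<^bsub>P\<^esub> T 0 (- s)"
      unfolding conj jb by simp
    ultimately show "g \<in> (\<lambda>x. inv\<^bsub>P\<^esub> (T 0 (- s)) \<otimes>\<^bsub>P\<^esub> x \<otimes>\<^bsub>P\<^esub> T 0 (- s)) ` H" by blast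
  next
    fix g assume "g \<in> (\<lambda>x. inv\<^bsub>P\<^esub> (T 0 (- s)) \<otimes>\<^bsub>P\<^esub> x \<otimes>\<^bsub>P\<^esub> T 0 (- s)) ` H"
    then obtain q t where "g = inv\<^bsub>P\<^esub> (T 0 (- s)) \<otimes>\<^bsub>P\<^esub> T (k * q) ((f ^^ q) 0 + d * t) \<otimes>\<^bsub>P\<^esub> T 0 (- s)"
      unfolding H_fam fam_def by blast
    then have "g = T (k * q) (\<alpha> ^ (k * q) * s + ((f ^^ q) 0 + d * t) - s)" by (simp only: conj)
    moreover have "(N.f ^^ q) 0 = \<alpha> ^ (k * q) * s + (f ^^ q) 0 - s"
      unfolding c'_def aff_shift_funpow by (subst aff_funpow) (simp add: power_mult)
    then have "\<alpha> ^ (k * q) * s + ((f ^^ q) 0 + d * t) - s = (N.f ^^ q) 0 + d * t" by linarith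
    ultimately have "g = T (k * q) ((N.f ^^ q) 0 + d * t)" by simp
    then show "g \<in> F" using sub unfolding fam_def by blast
  qed
  then have "conjugate_in X (holomorph X x\<^sub>0 W) H F"
    unfolding conjugate_in_def using T_0_holomorph by blast
  then show ?thesis using adm unfolding F_def by blast
qed

end

theorem corollary8p3:
  fixes X :: "'x set" and x\<^sub>0 :: 'x
    and G W A H :: "('x \<Rightarrow> 'x) set" and a w :: "'x \<Rightarrow> 'x"
    and n :: nat and \<alpha> :: int
  assumes "finite X" and "x\<^sub>0 \<in> X"
    and "subgroup G (perm_group X)" and "G = generate (perm_group X) {a, w}"
    and "W \<lhd> perm_subgroup G X" and "regular_on X W"
    and "W = generate (perm_group X) {w}" and "card W = n"
    and "A = point_stabilizer X G x\<^sub>0" and "A = generate (perm_group X) {a}"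
    and "inv\<^bsub>perm_group X\<^esub> a \<otimes>\<^bsub>perm_group X\<^esub> w \<otimes>\<^bsub>perm_group X\<^esub> a = w [^]\<^bsub>perm_group X\<^esub> \<alpha>"
    and "relatively_closed X G H"
  shows
    "(card (point_orbits X H) = 3 \<longrightarrow>
        (\<exists>!(i, r). admissible n \<alpha> i r \<and>
           conjugate_in X (holomorph X x\<^sub>0 W) H (family_subgroup (perm_group X) a w i r))) \<and>
     (\<forall>i r. admissible n \<alpha> i r \<longrightarrow>
        relatively_closed X G (family_subgroup (perm_group X) a w i r) \<and>
        orbit_lengths X (family_subgroup (perm_group X) a w i r) = family_orbit_lengths n i r)"
proof -
  have "a \<in> A" unfolding assms(10) by (rule generate.incl) simp
  then have "a x\<^sub>0 = x\<^sub>0" unfolding assms(9) point_stabilizer_def stabilizer_def by simp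
  then interpret cyclic_regular_normal X x\<^sub>0 G W a w n \<alpha>
    by (intro cyclic_regular_normal.intro assms)
  have HG: "H \<subseteq> G" using assms(12) unfolding relatively_closed_def subgroup_in_G by blast
  have "\<exists>!(i, r). admissible n \<alpha> i r \<and>
      conjugate_in X (holomorph X x\<^sub>0 W) H (family_subgroup (perm_group X) a w i r)"
    if three: "card (point_orbits X H) = 3"
  proof -
    obtain i r where ir: "admissible n \<alpha> i r"
      "conjugate_in X (holomorph X x\<^sub>0 W) H (family_subgroup (perm_group X) a w i r)"
      using family_exists[OF assms(12) three] by blast
    show ?thesis
    proof (rule ex1I[of _ "(i, r)"])
      show "case (i, r) of (i, r) \<Rightarrow> admissible n \<alpha> i r \<and>
          conjugate_in X (holomorph X x\<^sub>0 W) H (family_subgroup (perm_group X) a w i r)"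
        using ir by simp
      fix p assume "case p of (i, r) \<Rightarrow> admissible n \<alpha> i r \<and>
          conjugate_in X (holomorph X x\<^sub>0 W) H (family_subgroup (perm_group X) a w i r)"
      then obtain j s where p: "p = (j, s)" and js: "admissible n \<alpha> j s"
          "conjugate_in X (holomorph X x\<^sub>0 W) H (family_subgroup (perm_group X) a w j s)"
        by (cases p) simp
      show "p = (i, r)" unfolding p using family_unique[OF js(1) ir(1) HG js(2) ir(2)] by simp
    qed
  qed
  then show ?thesis using family_relatively_closed family_lengths by blast
qed

end
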